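(* Let $X$ be a complex Banach space and let $f:\mathbb{R}_+\to X$ be bounded, continuous and Lipschitz continuous, with $\sup_{t\ge0}\left\|\int_0^t f(s)\,\mathrm{d}s\right\|<\infty$. Suppose that $\widehat{f}$ admits a boundary function $F\in L^1_{\mathrm{loc}}(\mathbb{R}\setminus\{0\};X)$, i.e. $$\lim_{\alpha\to0+}\int_\mathbb{R}\widehat{f}(\alpha+\mathrm{i}s)\psi(s)\,\mathrm{d}s=\int_\mathbb{R}F(s)\psi(s)\,\mathrm{d}s\quad\text{for all }\psi\in C_\mathrm{c}(\mathbb{R}\setminus\{0\}).$$ Then $f\in C_0(\mathbb{R}_+;X)$. Moreover, let $m:(0,1]\to[1,\infty)$ be continuous non-increasing and $M:[1,\infty)\to[1,\infty)$ continuous non-decreasing. Then: (a) If $k\ge1$ is an integer, $F\in C^k(\mathbb{R}\setminus\{0\};X)$ and there is $C>0$ with $\|F^{(j)}(s)\|\le C|s|^{k-j}m(|s|)^{k+1}$ for $0<|s|\le1$, $0\le j\le k$, and $\|F^{(j)}(s)\|\le CM(|s|)^{j+1}$ for $|s|\ge1$, $0\le j\le k$, then for every $c>0$, $$\|f(t)\|=O\left(m_k^{-1}(ct)+\frac{1}{M_k^{-1}(ct)}\right),\quad t\to\infty.$$ (b) If $F\in C^\infty(\mathbb{R}\setminus\{0\};X)$ and there is $C>0$ with $\|F^{(j)}(s)\|\le C\,j!\,|s|\,m(|s|)^{j+1}$ for $0<|s|\le1$, $j\ge0$, and $\|F^{(j)}(s)\|\le C\,j!\,M(|s|)^{j+1}$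 for $|s|\ge1$, $j\ge0$, then for every $c\in(0,1/2)$, $$\|f(t)\|=O\left(m_{\log}^{-1}(ct)+\frac{1}{M_{\log}^{-1}(ct)}+\frac1t\right),\quad t\to\infty.$$ Here $m_k(r)=m(r)\left(\frac{m(r)}{r}\right)^{1/k}$ and $m_{\log}(r)=m(r)\log\left(1+\frac{m(r)}{r}\right)$ for $0<r\le1$, $M_k(R)=M(R)\big((1+R)^2M(R)\big)^{1/k}$ and $M_{\log}(R)=M(R)\big(\log(1+R)+\log M(R)\big)$ for $R\ge1$, and $m_k^{-1},m_{\log}^{-1},M_k^{-1},M_{\log}^{-1}$ denote their respective inverse functions.
   Context: The Laplace transform is $\widehat{f}(\lambda)=\int_0^\infty \mathrm{e}^{-\lambda t}f(t)\,\mathrm{d}t$ for $\operatorname{Re}\lambda>0$. The functions $m_k,m_{\log}$ are strictly decreasing and $M_k,M_{\log}$ strictly increasing; their inverses are defined on their ranges, which contain $ct$ for all sufficiently large $t$. *)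

theory Defs
  imports "HOL-Analysis.Analysis" "HOL-Library.Landau_Symbols"
begin

class complex_banach = banach +
  fixes scaleC :: "complex \<Rightarrow> 'a \<Rightarrow> 'a"  (infixr \<open>*\<^sub>C\<close> 75)
  assumes scaleC_add_right: "a *\<^sub>C (x + y) = a *\<^sub>C x + a *\<^sub>C y"
    and scaleC_add_left: "(a + b) *\<^sub>C x = a *\<^sub>C x + b *\<^sub>C x"
    and scaleC_scaleC: "a *\<^sub>C (b *\<^sub>C x) = (a * b) *\<^sub>C x"
    and scaleC_of_real: "complex_of_real r *\<^sub>C x = r *\<^sub>R x"
    and norm_scaleC: "norm (a *\<^sub>C x) = cmod a * norm x"

text \<open>Laplace transform of f on the half-line, for Re lambda > 0.\<close>
definition laplace :: "(real \<Rightarrow> 'a::complex_banach) \<Rightarrow> complex \<Rightarrow> 'a" where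
  "laplace f z = integral {0..} (\<lambda>t. exp (- (z * complex_of_real t)) *\<^sub>C f t)"

definition nth_vderiv :: "nat \<Rightarrow> (real \<Rightarrow> 'a::real_normed_vector) \<Rightarrow> real \<Rightarrow> 'a" where
  "nth_vderiv j F = ((\<lambda>g x. vector_derivative g (at x)) ^^ j) F"

definition Ck_on :: "nat \<Rightarrow> real set \<Rightarrow> (real \<Rightarrow> 'a::real_normed_vector) \<Rightarrow> bool" where
  "Ck_on k S F \<longleftrightarrow> (\<forall>j<k. \<forall>x\<in>S. nth_vderiv j F differentiable (at x))
                   \<and> (\<forall>j\<le>k. continuous_on S (nth_vderiv j F))"

definition Cinf_on :: "real set \<Rightarrow> (real \<Rightarrow> 'a::real_normed_vector) \<Rightarrow> bool" where
  "Cinf_on S F \<longleftrightarrow> (\<forall>k. Ck_on k S F)"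

definition m_k :: "(real \<Rightarrow> real) \<Rightarrow> nat \<Rightarrow> real \<Rightarrow> real" where
  "m_k m k r = m r * (m r / r) powr (1 / real k)"

definition m_log :: "(real \<Rightarrow> real) \<Rightarrow> real \<Rightarrow> real" where
  "m_log m r = m r * ln (1 + m r / r)"

definition M_k :: "(real \<Rightarrow> real) \<Rightarrow> nat \<Rightarrow> real \<Rightarrow> real" where
  "M_k M k R = M R * ((1 + R)^2 * M R) powr (1 / real k)"

definition M_log :: "(real \<Rightarrow> real) \<Rightarrow> real \<Rightarrow> real" where
  "M_log M R = M R * (ln (1 + R) + ln (M R))"

definition inv_small :: "(real \<Rightarrow> real) \<Rightarrow> real \<Rightarrow> real" where
  "inv_small g = the_inv_into {0<..1} g"

definition inv_large :: "(real \<Rightarrow> real) \<Rightarrow> real \<Rightarrow> real" where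
  "inv_large g = the_inv_into {1..} g"

end

theory Submission
  imports Defs "HOL-Probability.Sinc_Integral"
begin

text \<open>
  Let \<open>\<phi>\<close> be the Fourier transform of the bump \<open>(1 - (s / R)\<^sup>2)\<^sup>2\<close> on \<open>[-R, R]\<close>. Since \<open>f\<close> is Lipschitz and
  \<open>\<phi>\<close> has a finite first moment of order \<open>1 / R\<close> and an integral bounded away from \<open>0\<close>, \<open>f\<close> is bounded
  by \<open>f * \<phi>\<close> up to \<open>O(1 / R)\<close>. Multiplying the bump by a cutoff that lives on frequencies of size
  \<open>\<epsilon>\<close> changes \<open>f * \<phi>\<close> by \<open>O(\<epsilon>)\<close>, because \<open>f\<close> has a bounded primitive. What remains is an oscillatory
  integral of the boundary function \<open>F\<close> over \<open>\<epsilon> \<le> \<bar>s\<bar> \<le> R\<close>. It tends to \<open>0\<close> by a Riemann--Lebesgue lemma,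
  and under the growth conditions it is estimated by integrating by parts: \<open>k\<close> times in (a), and in (b)
  about \<open>t / m(\<epsilon>)\<close> times below frequency \<open>1\<close> and \<open>t / M(R)\<close> times above it, where Stirling's bound turns
  the factorials into exponential decay. The values \<open>\<epsilon>\<close> and \<open>1 / R\<close> of the theorem balance the errors.
\<close>

section \<open>Oscillatory integrals and chains of derivatives\<close>

text \<open>The hypotheses dictate the order of limits. The boundary function is tested only against
  functions that vanish near 0, so the low frequencies have to be removed before the damping
  exp(-\<alpha> u) may tend to 1, and every bound up to that point has to be uniform in \<alpha>.
  The bump has a double zero at R for two reasons: its transform decays like |x|^-3, which makes the
  first moment finite, and in the repeated integration by parts the first two boundary terms at R
  vanish while the later ones carry 1/R^2. The rate functions are balances. In (a),
  \<open>m_k m k \<epsilon> = c * t\<close> says that m(\<epsilon>)^(k+1) / t^k = c^k \<epsilon>,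
  and \<open>M_k M k R = c * t\<close> gives R M(R)^(k+1) / t^k <= c^k / R. In (b), y = t / M(R)
  integrations by parts gain about exp(-y) = ((1 + R) M(R))^(-1/c), whereas the high frequencies
  cost R M(R). The product should be at most 1/R. An inverse square of (1 + R) M(R) achieves this,
  hence c < 1/2.\<close>

interpretation scaleC: bounded_bilinear "scaleC :: complex \<Rightarrow> 'a::complex_banach \<Rightarrow> 'a"
proof
  fix a a' :: complex and b b' :: 'a and r :: real
  show "(a + a') *\<^sub>C b = a *\<^sub>C b + a' *\<^sub>C b" by (rule scaleC_add_left)
  show "a *\<^sub>C (b + b') = a *\<^sub>C b + a *\<^sub>C b'" by (rule scaleC_add_right)
  show "(r *\<^sub>R a) *\<^sub>C b = r *\<^sub>R (a *\<^sub>C b)"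
    by (metis scaleC_of_real scaleC_scaleC scaleR_conv_of_real)
  show "a *\<^sub>C (r *\<^sub>R b) = r *\<^sub>R (a *\<^sub>C b)"
    by (metis mult.commute scaleC_of_real scaleC_scaleC)
  show "\<exists>K. \<forall>a (b::'a). norm (a *\<^sub>C b) \<le> norm a * norm b * K"
    by (rule exI[of _ 1]) (simp add: norm_scaleC)
qed

lemmas scaleC_continuous_intros [continuous_intros] = scaleC.continuous_on

lemmas integral_combine_interval = Henstock_Kurzweil_Integration.integral_combine

lemma integral_scaleC_left:
  fixes v :: "'a::complex_banach"
  assumes "c integrable_on S"
  shows "integral S (\<lambda>s. c s *\<^sub>C v) = integral S c *\<^sub>C v"
  using integral_linear[OF assms scaleC.bounded_linear_left[of v]] by (simp add: o_def)

lemma integral_scaleC_right: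
  fixes g :: "real \<Rightarrow> 'a::complex_banach"
  assumes "g integrable_on S"
  shows "integral S (\<lambda>s. c *\<^sub>C g s) = c *\<^sub>C integral S g"
  using integral_linear[OF assms scaleC.bounded_linear_right[of c]] by (simp add: o_def)

lemma continuous_on_cis_comp [continuous_intros]:
  "continuous_on S g \<Longrightarrow> continuous_on S (\<lambda>x. cis (g x))"
  by (auto simp: cis_conv_exp intro!: continuous_intros)

section \<open>Repeated integration by parts against an oscillating factor\<close>

lemma oscillatory_integral_by_parts:
  fixes g g' :: "real \<Rightarrow> 'a::complex_banach"
  assumes ab: "a \<le> b" and "\<tau> \<noteq> 0"
    and g: "\<And>s. s \<in> {a..b} \<Longrightarrow> (g has_vector_derivative g' s) (at s within {a..b})"
    and g': "continuous_on {a..b} g'"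
  shows "norm (integral {a..b} (\<lambda>s. cis (\<tau> * s) *\<^sub>C g s))
    \<le> (norm (g a) + norm (g b) + norm (integral {a..b} (\<lambda>s. cis (\<tau> * s) *\<^sub>C g' s))) / \<bar>\<tau>\<bar>"
proof -
  let ?c = "inverse (\<i> * complex_of_real \<tau>)"
  have gc: "continuous_on {a..b} g"
    using g by (rule continuous_on_vector_derivative)
  have "((\<lambda>s. (?c * cis (\<tau> * s)) *\<^sub>C g s) has_vector_derivative
      (?c * cis (\<tau> * s)) *\<^sub>C g' s + cis (\<tau> * s) *\<^sub>C g s) (at s within {a..b})" if "s \<in> {a..b}" for s
  proof -
    have "((\<lambda>s. ?c * cis (\<tau> * s)) has_vector_derivative cis (\<tau> * s)) (at s within {a..b})"
      unfolding cis_conv_exp using \<open>\<tau> \<noteq> 0\<close>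
      by (auto intro!: derivative_eq_intros has_vector_derivative_real_field simp: field_simps)
    from scaleC.has_vector_derivative[OF this g[OF that]] show ?thesis .
  qed
  from fundamental_theorem_of_calculus[OF ab this]
  have 1: "((\<lambda>s. (?c * cis (\<tau> * s)) *\<^sub>C g' s + cis (\<tau> * s) *\<^sub>C g s) has_integral
      (?c * cis (\<tau> * b)) *\<^sub>C g b - (?c * cis (\<tau> * a)) *\<^sub>C g a) {a..b}" by simp
  have i1: "(\<lambda>s. cis (\<tau> * s) *\<^sub>C g' s) integrable_on {a..b}"
    by (intro integrable_continuous_interval continuous_intros g')
  have i2: "(\<lambda>s. cis (\<tau> * s) *\<^sub>C g s) integrable_on {a..b}"
    by (intro integrable_continuous_interval continuous_intros gc)
  have eq: "integral {a..b} (\<lambda>s. cis (\<tau> * s) *\<^sub>C g s) = (?c * cis (\<tau> * b)) *\<^sub>C g b - (?c * cis (\<tau> * a)) *\<^sub>C g a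
     - ?c *\<^sub>C integral {a..b} (\<lambda>s. cis (\<tau> * s) *\<^sub>C g' s)"
  proof -
    have "((\<lambda>s. ?c *\<^sub>C (cis (\<tau> * s) *\<^sub>C g' s)) has_integral ?c *\<^sub>C integral {a..b} (\<lambda>s. cis (\<tau> * s) *\<^sub>C g' s)) {a..b}"
      using has_integral_linear[OF integrable_integral[OF i1] scaleC.bounded_linear_right[of ?c]]
      by (simp add: o_def)
    from has_integral_diff[OF 1 this] show ?thesis
      by (simp add: scaleC_scaleC integral_unique)
  qed
  have nc: "norm ((?c * cis x) *\<^sub>C v) = norm v / \<bar>\<tau>\<bar>" "norm (?c *\<^sub>C v) = norm v / \<bar>\<tau>\<bar>" for x and v :: 'a
    by (simp_all add: norm_scaleC norm_mult norm_divide norm_inverse divide_inverse mult.commute)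
  show ?thesis
    unfolding eq
    by (rule order_trans[OF norm_triangle_ineq4], rule order_trans[OF add_right_mono[OF norm_triangle_ineq4]])
       (simp only: nc add_divide_distrib add.commute order_refl)
qed

text \<open>The derivatives are given as a chain \<open>D\<close>, differentiated within the
  interval, so that Leibniz products of chains can be inserted directly and one-sided derivatives at
  the endpoints suffice.\<close>

lemma oscillatory_integral_bound:
  fixes D :: "nat \<Rightarrow> real \<Rightarrow> 'a::complex_banach"
  assumes "a \<le> b" and "\<tau> \<noteq> 0"
    and "\<And>j s. j < n \<Longrightarrow> s \<in> {a..b} \<Longrightarrow> (D j has_vector_derivative D (Suc j) s) (at s within {a..b})"
    and "continuous_on {a..b} (D n)"
  shows "norm (integral {a..b} (\<lambda>s. cis (\<tau> * s) *\<^sub>C D 0 s))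
    \<le> (\<Sum>j<n. (norm (D j a) + norm (D j b)) / \<bar>\<tau>\<bar> ^ Suc j)
      + integral {a..b} (\<lambda>s. norm (D n s)) / \<bar>\<tau>\<bar> ^ n"
  using assms(3,4)
proof (induction n arbitrary: D)
  case 0
  have "norm (integral {a..b} (\<lambda>s. cis (\<tau> * s) *\<^sub>C D 0 s)) \<le> integral {a..b} (\<lambda>s. norm (D 0 s))"
    by (rule integral_norm_bound_integral)
       (auto intro!: integrable_continuous_interval continuous_intros 0 simp: norm_scaleC)
  then show ?case by simp
next
  case (Suc n)
  have c1: "continuous_on {a..b} (D 1)"
  proof (cases n)
    case 0 then show ?thesis using Suc.prems(2) by simp
  next
    case (Suc k)
    then show ?thesis using Suc.prems(1)[of 1]
      by (intro continuous_on_vector_derivative) auto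
  qed
  have A: "norm (integral {a..b} (\<lambda>s. cis (\<tau> * s) *\<^sub>C D 0 s))
    \<le> (norm (D 0 a) + norm (D 0 b) + norm (integral {a..b} (\<lambda>s. cis (\<tau> * s) *\<^sub>C D 1 s))) / \<bar>\<tau>\<bar>"
    using oscillatory_integral_by_parts[OF assms(1,2) _ c1, of "D 0"] Suc.prems(1)[of 0] by simp
  have B: "norm (integral {a..b} (\<lambda>s. cis (\<tau> * s) *\<^sub>C D 1 s))
    \<le> (\<Sum>j<n. (norm (D (Suc j) a) + norm (D (Suc j) b)) / \<bar>\<tau>\<bar> ^ Suc j)
      + integral {a..b} (\<lambda>s. norm (D (Suc n) s)) / \<bar>\<tau>\<bar> ^ n"
    using Suc.IH[of "\<lambda>j. D (Suc j)"] Suc.prems by simp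
  have "(norm (D 0 a) + norm (D 0 b) + ((\<Sum>j<n. (norm (D (Suc j) a) + norm (D (Suc j) b)) / \<bar>\<tau>\<bar> ^ Suc j)
      + integral {a..b} (\<lambda>s. norm (D (Suc n) s)) / \<bar>\<tau>\<bar> ^ n)) / \<bar>\<tau>\<bar>
    = (\<Sum>j<Suc n. (norm (D j a) + norm (D j b)) / \<bar>\<tau>\<bar> ^ Suc j)
      + integral {a..b} (\<lambda>s. norm (D (Suc n) s)) / \<bar>\<tau>\<bar> ^ Suc n"
    unfolding sum.lessThan_Suc_shift add_divide_distrib sum_divide_distrib
    by (simp add: add.commute add.left_commute add_divide_distrib mult.commute)
  with A B show ?case
    by (smt (verit) divide_right_mono abs_ge_zero)
qed

section \<open>The Leibniz rule for chains of derivatives\<close>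

definition leibniz :: "(nat \<Rightarrow> real \<Rightarrow> real) \<Rightarrow> (nat \<Rightarrow> real \<Rightarrow> 'a::real_normed_vector) \<Rightarrow> nat \<Rightarrow> real \<Rightarrow> 'a" where
  "leibniz p D j s = (\<Sum>i\<le>j. (real (j choose i) * p i s) *\<^sub>R D (j - i) s)"

text \<open>Pascal's rule separates the terms in which the new derivative falls on \<open>p\<close>
  from those in which it falls on \<open>D\<close>. This is the shape that termwise differentiation
  of \<open>leibniz p D j\<close> produces.\<close>

lemma leibniz_Suc:
  "leibniz p D (Suc j) s = (\<Sum>i\<le>j. (real (j choose i) * p (Suc i) s) *\<^sub>R D (j - i) s)
     + (\<Sum>i\<le>j. (real (j choose i) * p i s) *\<^sub>R D (Suc (j - i)) s)"
proof -
  have "leibniz p D (Suc j) s = p 0 s *\<^sub>R D (Suc j) s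
     + (\<Sum>i\<le>j. (real (Suc j choose Suc i) * p (Suc i) s) *\<^sub>R D (j - i) s)"
    unfolding leibniz_def by (subst sum.atMost_Suc_shift) simp
  also have "(\<Sum>i\<le>j. (real (Suc j choose Suc i) * p (Suc i) s) *\<^sub>R D (j - i) s)
    = (\<Sum>i\<le>j. (real (j choose i) * p (Suc i) s) *\<^sub>R D (j - i) s)
     + (\<Sum>i\<le>j. (real (j choose Suc i) * p (Suc i) s) *\<^sub>R D (j - i) s)"
    by (simp add: sum.distrib[symmetric] algebra_simps)
  also have "(\<Sum>i\<le>j. (real (j choose Suc i) * p (Suc i) s) *\<^sub>R D (j - i) s)
     = (\<Sum>i<j. (real (j choose Suc i) * p (Suc i) s) *\<^sub>R D (Suc (j - Suc i)) s)"
    unfolding lessThan_Suc_atMost[symmetric] sum.lessThan_Suc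
    by (auto intro!: sum.cong simp: Suc_diff_Suc)
  also have "p 0 s *\<^sub>R D (Suc j) s + ((\<Sum>i\<le>j. (real (j choose i) * p (Suc i) s) *\<^sub>R D (j - i) s) + \<dots>)
     = (\<Sum>i\<le>j. (real (j choose i) * p (Suc i) s) *\<^sub>R D (j - i) s)
     + (\<Sum>i\<le>j. (real (j choose i) * p i s) *\<^sub>R D (Suc (j - i)) s)"
    unfolding sum.atMost_shift[of _ j] by simp
  finally show ?thesis .
qed

lemma has_vector_derivative_leibniz:
  assumes "\<And>i. i \<le> j \<Longrightarrow> (p i has_vector_derivative p (Suc i) s) (at s within S)"
    and "\<And>i. i \<le> j \<Longrightarrow> (D i has_vector_derivative D (Suc i) s) (at s within S)"
  shows "(leibniz p D j has_vector_derivative leibniz p D (Suc j) s) (at s within S)"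
proof -
  have "((\<lambda>s. \<Sum>i\<le>j. (real (j choose i) * p i s) *\<^sub>R D (j - i) s) has_vector_derivative
     (\<Sum>i\<le>j. (real (j choose i) * p i s) *\<^sub>R D (Suc (j - i)) s + (real (j choose i) * p (Suc i) s) *\<^sub>R D (j - i) s)) (at s within S)"
    by (rule has_vector_derivative_sum, rule has_vector_derivative_scaleR)
       (auto intro!: assms(2) DERIV_cmult assms(1)[folded has_real_derivative_iff_has_vector_derivative])
  then show ?thesis
    unfolding leibniz_Suc by (simp add: sum.distrib add.commute leibniz_def[abs_def])
qed

lemma continuous_on_leibniz:
  assumes "\<And>i. i \<le> j \<Longrightarrow> continuous_on S (p i)" "\<And>i. i \<le> j \<Longrightarrow> continuous_on S (D i)"
  shows "continuous_on S (leibniz p D j)"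
  unfolding leibniz_def[abs_def] by (intro continuous_intros assms) auto

lemma norm_leibniz_le:
  "norm (leibniz p D j s) \<le> (\<Sum>i\<le>j. real (j choose i) * \<bar>p i s\<bar> * norm (D (j - i) s))"
  unfolding leibniz_def by (rule sum_norm_le) (simp add: abs_mult)

section \<open>The high-frequency kernel\<close>

text \<open>Smooth functions are handled as chains of derivatives: \<^term>\<open>bump R i\<close> is the \<open>i\<close>-th derivative of
  \<^term>\<open>bump R 0\<close>.\<close>

definition bump :: "real \<Rightarrow> nat \<Rightarrow> real \<Rightarrow> real" where
  "bump R i s = (case i of 0 \<Rightarrow> (1 - (s / R)^2)^2
     | Suc 0 \<Rightarrow> - 4 * s / R^2 * (1 - (s / R)^2)
     | Suc (Suc 0) \<Rightarrow> (12 * (s / R)^2 - 4) / R^2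
     | Suc (Suc (Suc 0)) \<Rightarrow> 24 * s / R^4
     | Suc (Suc (Suc (Suc 0))) \<Rightarrow> 24 / R^4
     | _ \<Rightarrow> 0)"

lemma bump_simps:
  "bump R 0 s = (1 - (s / R)^2)^2"
  "bump R (Suc 0) s = - 4 * s / R^2 * (1 - (s / R)^2)"
  "bump R (Suc (Suc 0)) s = (12 * (s / R)^2 - 4) / R^2"
  "bump R (Suc (Suc (Suc 0))) s = 24 * s / R^4"
  "bump R (Suc (Suc (Suc (Suc 0)))) s = 24 / R^4"
  "bump R (Suc (Suc (Suc (Suc (Suc i))))) s = 0"
  by (simp_all add: bump_def)

lemma nat_cases_5:
  obtains "i = 0" | "i = Suc 0" | "i = Suc (Suc 0)" | "i = Suc (Suc (Suc 0))"
  | "i = Suc (Suc (Suc (Suc 0)))" | j where "i = Suc (Suc (Suc (Suc (Suc j))))"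
proof -
  consider "i = 0 \<or> i = 1 \<or> i = 2 \<or> i = 3 \<or> i = 4" | "i = Suc (Suc (Suc (Suc (Suc (i - 5)))))"
    by linarith
  then show ?thesis
    by cases (use that in \<open>auto simp: numeral_eq_Suc\<close>)
qed

lemma has_real_derivative_bump:
  assumes "R \<noteq> 0"
  shows "(bump R i has_real_derivative bump R (Suc i) s) (at s within S)"
proof -
  show ?thesis
  proof (cases i rule: nat_cases_5)
    case 1
    have "bump R i = (\<lambda>s. 1 - 2 / R^2 * s^2 + 1 / R^4 * s^4)"
      using 1 assms by (simp add: bump_def[abs_def] fun_eq_iff power2_diff power_divide power_mult[symmetric])
    moreover have "((\<lambda>s. 1 - 2 / R^2 * s^2 + 1 / R^4 * s^4) has_real_derivative
       0 - 2 / R^2 * (2 * s) + 1 / R^4 * (4 * s^3)) (at s within S)"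
      by (rule derivative_eq_intros refl | simp)+
    moreover have "0 - 2 / R^2 * (2 * s) + 1 / R^4 * (4 * s^3) = bump R (Suc i) s"
      using 1 assms by (simp add: bump_simps field_simps power_numeral_reduce)
    ultimately show ?thesis by simp
  next
    case 2
    have "bump R i = (\<lambda>s. - 4 / R^2 * s + 4 / R^4 * s^3)"
      using 2 assms by (simp add: bump_def[abs_def] fun_eq_iff field_simps power_numeral_reduce)
    moreover have "((\<lambda>s. - 4 / R^2 * s + 4 / R^4 * s^3) has_real_derivative - 4 / R^2 + 4 / R^4 * (3 * s^2)) (at s within S)"
      by (rule derivative_eq_intros refl | simp)+
    moreover have "- 4 / R^2 + 4 / R^4 * (3 * s^2) = bump R (Suc i) s"
      using 2 assms by (simp add: bump_simps field_simps power_numeral_reduce)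
    ultimately show ?thesis by simp
  next
    case 3
    have "bump R i = (\<lambda>s. 12 / R^4 * s^2 - 4 / R^2)"
      using 3 assms by (simp add: bump_def[abs_def] fun_eq_iff field_simps power_numeral_reduce)
    moreover have "((\<lambda>s. 12 / R^4 * s^2 - 4 / R^2) has_real_derivative 12 / R^4 * (2 * s)) (at s within S)"
      by (rule derivative_eq_intros refl | simp)+
    moreover have "12 / R^4 * (2 * s) = bump R (Suc i) s"
      using 3 by (simp add: bump_simps)
    ultimately show ?thesis by simp
  next
    case 4
    have "bump R i = (\<lambda>s. 24 / R^4 * s)"
      using 4 by (simp add: bump_def[abs_def] fun_eq_iff)
    moreover have "((\<lambda>s. 24 / R^4 * s) has_real_derivative 24 / R^4) (at s within S)"
      by (rule derivative_eq_intros refl | simp)+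
    moreover have "24 / R^4 = bump R (Suc i) s" using 4 by (simp add: bump_simps)
    ultimately show ?thesis by simp
  next
    case 5
    have "bump R i = (\<lambda>s. 24 / R^4)" using 5 by (simp add: bump_def[abs_def] fun_eq_iff)
    then show ?thesis using 5 by (simp add: bump_simps)
  next
    case 6
    have "bump R i = (\<lambda>s. 0)" using 6 by (simp add: bump_def[abs_def] fun_eq_iff)
    then show ?thesis using 6 by (simp add: bump_simps)
  qed
qed

lemma has_vector_derivative_bump:
  "R \<noteq> 0 \<Longrightarrow> (bump R i has_vector_derivative bump R (Suc i) s) (at s within S)"
  using has_real_derivative_bump by (simp add: has_real_derivative_iff_has_vector_derivative)

lemma continuous_on_bump [continuous_intros]: "R \<noteq> 0 \<Longrightarrow> continuous_on S (bump R i)"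
  using has_real_derivative_bump by (meson DERIV_continuous_on)

lemma continuous_on_bump_comp [continuous_intros]:
  "R \<noteq> 0 \<Longrightarrow> continuous_on S g \<Longrightarrow> continuous_on S (\<lambda>x. bump R i (g x))"
  using continuous_on_compose2[OF continuous_on_bump[of R UNIV i]] by auto

lemma bump_zero_end: assumes "R > 0" shows "bump R 0 R = 0" "bump R (Suc 0) R = 0"
  using assms by (simp_all add: bump_simps)

text \<open>By scaling, this is \<open>1 / R ^ i\<close> times the i-th derivative of (1 - v^2)^2 at
  v = s / R. On [0, 1] all these derivatives are dominated by the fourth, which is the constant
  24.\<close>

lemma abs_bump_le:
  assumes R: "R > 0" and s: "0 \<le> s" "s \<le> R"
  shows "\<bar>bump R i s\<bar> \<le> 24 / R ^ i"
proof -
  define v where "v = s / R"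
  have v: "0 \<le> v" "v \<le> 1" using s R by (auto simp: v_def)
  have sv: "s = v * R" using R by (simp add: v_def)
  have v2: "v^2 \<le> 1" "0 \<le> v^2" using v by (auto simp: power_le_one)
  show ?thesis
  proof (cases i rule: nat_cases_5)
    case 1
    have "(1 - v^2)^2 \<le> 1" using v2 by (simp add: power_le_one)
    then show ?thesis using 1 by (simp add: bump_simps v_def[symmetric])
  next
    case 2
    have "\<bar>v * (1 - v^2)\<bar> \<le> 1" using v v2 by (simp add: abs_mult mult_le_one)
    then have "\<bar>4 * (v * (1 - v^2))\<bar> / R \<le> 24 / R" using R by (intro divide_right_mono) auto
    moreover have "bump R i s = - (4 * (v * (1 - v^2))) / R"
      using 2 R by (simp add: bump_simps v_def field_simps power2_eq_square)
    ultimately show ?thesis using R 2 by simp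
  next
    case 3
    have "\<bar>12 * v^2 - 4\<bar> \<le> 24" unfolding abs_le_iff using v2 by linarith
    then have "\<bar>12 * v^2 - 4\<bar> / R^2 \<le> 24 / R^2" by (intro divide_right_mono) auto
    moreover have "bump R i s = (12 * v^2 - 4) / R^2"
      using 3 by (simp add: bump_simps v_def)
    ultimately show ?thesis using R 3 by (simp add: power_numeral_reduce)
  next
    case 4
    have "\<bar>24 * v\<bar> / R^3 \<le> 24 / R^3" using R v by (intro divide_right_mono) auto
    moreover have "bump R i s = 24 * v / R^3"
      using 4 R by (simp add: bump_simps v_def power_numeral_reduce)
    ultimately show ?thesis using R 4 by (simp add: power_numeral_reduce)
  next
    case 5
    then have "bump R i s = 24 / R^4" by (simp add: bump_simps)
    then show ?thesis using R 5 by (simp add: power_numeral_reduce)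
  next
    case 6 then show ?thesis using R by (simp add: bump_simps)
  qed
qed

lemma abs_bump_0_le: assumes "R > 0" "0 \<le> s" "s \<le> R" shows "\<bar>bump R 0 s\<bar> \<le> 1"
proof -
  have "(s/R)^2 \<le> 1" using assms by (intro power_le_one) auto
  then have "(1 - (s/R)^2)^2 \<le> 1" by (intro power_le_one) auto
  then show ?thesis by (simp add: bump_simps)
qed

text \<open>The bump is even, so this is its Fourier transform over [-R, R]. The integral of the
  kernel over the whole line is 2 pi.\<close>

definition bump_kernel :: "real \<Rightarrow> real \<Rightarrow> real" where
  "bump_kernel R x = 2 * integral {0..R} (\<lambda>s. bump R 0 s * cos (s * x))"

lemma cos_transform_bound:
  fixes g :: "real \<Rightarrow> real"
  assumes g: "continuous_on {a..b} g" and ab: "a \<le> b"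
  shows "\<bar>integral {a..b} (\<lambda>s. g s * cos (s * x))\<bar> \<le> integral {a..b} (\<lambda>s. \<bar>g s\<bar>)"
    and "\<bar>integral {a..b} (\<lambda>s. g s * sin (s * x))\<bar> \<le> integral {a..b} (\<lambda>s. \<bar>g s\<bar>)"
proof -
  have "norm (integral {a..b} (\<lambda>s. g s * cos (s * x))) \<le> integral {a..b} (\<lambda>s. \<bar>g s\<bar>)"
    by (rule integral_norm_bound_integral)
       (auto intro!: integrable_continuous_interval continuous_intros g simp: abs_mult mult_left_le)
  then show "\<bar>integral {a..b} (\<lambda>s. g s * cos (s * x))\<bar> \<le> integral {a..b} (\<lambda>s. \<bar>g s\<bar>)" by simp
  have "norm (integral {a..b} (\<lambda>s. g s * sin (s * x))) \<le> integral {a..b} (\<lambda>s. \<bar>g s\<bar>)"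
    by (rule integral_norm_bound_integral)
       (auto intro!: integrable_continuous_interval continuous_intros g simp: abs_mult mult_left_le)
  then show "\<bar>integral {a..b} (\<lambda>s. g s * sin (s * x))\<bar> \<le> integral {a..b} (\<lambda>s. \<bar>g s\<bar>)" by simp
qed

lemma DERIV_sin_mult: "((\<lambda>s. sin (s * x)) has_real_derivative cos (s * x) * x) (at s within S)"
  and DERIV_cos_mult: "((\<lambda>s. cos (s * x)) has_real_derivative - sin (s * x) * x) (at s within S)" for x :: real
  by (auto intro!: derivative_eq_intros)

lemma has_integral_diff_cancel:
  fixes f g :: "real \<Rightarrow> real"
  assumes "((\<lambda>s. f s + g s) has_integral I) S" "(g has_integral J) S"
  shows "(f has_integral I - J) S"
  using has_integral_diff[OF assms] by simp

lemma has_integral_add_cancel: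
  fixes f g :: "real \<Rightarrow> real"
  assumes "((\<lambda>s. f s - g s) has_integral I) S" "(g has_integral J) S"
  shows "(f has_integral I + J) S"
  using has_integral_add[OF assms] by simp

lemma sin_transform_by_parts:
  fixes h h1 h2 :: "real \<Rightarrow> real"
  assumes ab: "a \<le> b" and x: "x \<noteq> 0"
    and h: "\<And>s. s \<in> {a..b} \<Longrightarrow> (h has_real_derivative h1 s) (at s within {a..b})"
    and h1: "\<And>s. s \<in> {a..b} \<Longrightarrow> (h1 has_real_derivative h2 s) (at s within {a..b})"
    and h2: "continuous_on {a..b} h2"
  shows "integral {a..b} (\<lambda>s. h s * sin (s * x)) = (h a * cos (a * x) - h b * cos (b * x)) / x
     + (h1 b * sin (b * x) - h1 a * sin (a * x)) / x^2 - integral {a..b} (\<lambda>s. h2 s * sin (s * x)) / x^2"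
proof -
  have hc: "continuous_on {a..b} h" using h by (meson DERIV_continuous_on)
  have "((\<lambda>s. - h s * cos (s * x) / x + h1 s * sin (s * x) / x^2) has_real_derivative
      h s * sin (s * x) + h2 s * sin (s * x) / x^2) (at s within {a..b})" if "s \<in> {a..b}" for s
  proof -
    have "((\<lambda>s. - h s * cos (s * x) / x + h1 s * sin (s * x) / x^2) has_real_derivative
      (- h1 s * cos (s * x) + (- sin (s * x) * x) * (- h s)) / x + (h2 s * sin (s * x) + (cos (s * x) * x) * h1 s) / x^2)
      (at s within {a..b})"
      by (intro DERIV_add DERIV_cdivide DERIV_mult DERIV_minus h[OF that] h1[OF that]
          DERIV_sin_mult DERIV_cos_mult)
    moreover have "(- h1 s * cos (s * x) + (- sin (s * x) * x) * (- h s)) / x + (h2 s * sin (s * x) + (cos (s * x) * x) * h1 s) / x^2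
       = h s * sin (s * x) + h2 s * sin (s * x) / x^2"
      using x by (simp add: field_simps power2_eq_square)
    ultimately show ?thesis by simp
  qed
  then have "((\<lambda>s. h s * sin (s * x) + h2 s * sin (s * x) / x^2) has_integral
     (- h b * cos (b * x) / x + h1 b * sin (b * x) / x^2) - (- h a * cos (a * x) / x + h1 a * sin (a * x) / x^2)) {a..b}"
    by (intro fundamental_theorem_of_calculus ab) (simp add: has_real_derivative_iff_has_vector_derivative)
  moreover have "((\<lambda>s. h2 s * sin (s * x) / x^2) has_integral integral {a..b} (\<lambda>s. h2 s * sin (s * x)) / x^2) {a..b}"
    by (intro has_integral_divide integrable_integral integrable_continuous_interval continuous_intros h2)
  ultimately have "((\<lambda>s. h s * sin (s * x)) has_integral
     (- h b * cos (b * x) / x + h1 b * sin (b * x) / x^2) - (- h a * cos (a * x) / x + h1 a * sin (a * x) / x^2)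
     - integral {a..b} (\<lambda>s. h2 s * sin (s * x)) / x^2) {a..b}"
    by (rule has_integral_diff_cancel)
  then show ?thesis
    by (simp add: integral_unique diff_divide_distrib)
qed

text \<open>The second bound takes three integrations by parts. At R the double zero removes the
  terms with the bump and its first derivative; at 0 all terms vanish because of the sines and
  because the first derivative is odd. There remain the second derivative at R, 8 / R^2, and the
  total variation of the second derivative on [0, R], 12 / R^2; twice their sum is 40 / R^2.\<close>

lemma bump_kernel_bounds:
  assumes R: "R > 0"
  shows "\<bar>bump_kernel R x\<bar> \<le> 2 * R" and "\<bar>bump_kernel R x\<bar> * \<bar>x\<bar>^3 \<le> 40 / R^2"
proof -
  have "\<bar>integral {0..R} (\<lambda>s. bump R 0 s * cos (s * x))\<bar> \<le> integral {0..R} (\<lambda>s. \<bar>bump R 0 s\<bar>)"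
    using R by (intro cos_transform_bound continuous_intros) auto
  also have "\<dots> \<le> integral {0..R} (\<lambda>s. 1)"
    using R by (intro integral_le integrable_continuous_interval continuous_intros abs_bump_0_le) auto
  finally show "\<bar>bump_kernel R x\<bar> \<le> 2 * R" using R by (simp add: bump_kernel_def)
  show "\<bar>bump_kernel R x\<bar> * \<bar>x\<bar>^3 \<le> 40 / R^2"
  proof (cases "x = 0")
    case False
    have "((\<lambda>s. bump R 0 s * sin (s * x) / x + bump R (Suc 0) s * cos (s * x) / x^2 - bump R (Suc (Suc 0)) s * sin (s * x) / x^3)
       has_real_derivative bump R 0 s * cos (s * x) - bump R (Suc (Suc (Suc 0))) s * sin (s * x) / x^3) (at s within {0..R})" for s
    proof -
      let ?b = "\<lambda>i. bump R i s"
      have R0: "R \<noteq> 0" using R by simp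
      have "((\<lambda>s. bump R 0 s * sin (s * x) / x + bump R (Suc 0) s * cos (s * x) / x^2 - bump R (Suc (Suc 0)) s * sin (s * x) / x^3)
       has_real_derivative (?b (Suc 0) * sin (s * x) + cos (s * x) * x * ?b 0) / x
          + (?b (Suc (Suc 0)) * cos (s * x) + - sin (s * x) * x * ?b (Suc 0)) / x^2
          - (?b (Suc (Suc (Suc 0))) * sin (s * x) + cos (s * x) * x * ?b (Suc (Suc 0))) / x^3) (at s within {0..R})"
        by (intro DERIV_add DERIV_diff DERIV_cdivide DERIV_mult has_real_derivative_bump[OF R0]
             DERIV_sin_mult DERIV_cos_mult)
      moreover have "(?b (Suc 0) * sin (s * x) + cos (s * x) * x * ?b 0) / x
          + (?b (Suc (Suc 0)) * cos (s * x) + - sin (s * x) * x * ?b (Suc 0)) / x^2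
          - (?b (Suc (Suc (Suc 0))) * sin (s * x) + cos (s * x) * x * ?b (Suc (Suc 0))) / x^3
          = ?b 0 * cos (s * x) - ?b (Suc (Suc (Suc 0))) * sin (s * x) / x^3"
        using False by (simp add: field_simps power_numeral_reduce)
      ultimately show ?thesis by simp
    qed
    then have "((\<lambda>s. bump R 0 s * cos (s * x) - bump R (Suc (Suc (Suc 0))) s * sin (s * x) / x^3) has_integral
       (bump R 0 R * sin (R * x) / x + bump R (Suc 0) R * cos (R * x) / x^2 - bump R (Suc (Suc 0)) R * sin (R * x) / x^3) -
       (bump R 0 0 * sin (0 * x) / x + bump R (Suc 0) 0 * cos (0 * x) / x^2 - bump R (Suc (Suc 0)) 0 * sin (0 * x) / x^3)) {0..R}"
      using R by (intro fundamental_theorem_of_calculus) (auto simp: has_real_derivative_iff_has_vector_derivative)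
    moreover have "((\<lambda>s. bump R (Suc (Suc (Suc 0))) s * sin (s * x) / x^3) has_integral integral {0..R} (\<lambda>s. bump R (Suc (Suc (Suc 0))) s * sin (s * x)) / x^3) {0..R}"
      using R by (intro has_integral_divide integrable_integral integrable_continuous_interval continuous_intros) auto
    ultimately have "((\<lambda>s. bump R 0 s * cos (s * x)) has_integral
       (bump R 0 R * sin (R * x) / x + bump R (Suc 0) R * cos (R * x) / x^2 - bump R (Suc (Suc 0)) R * sin (R * x) / x^3) -
       (bump R 0 0 * sin (0 * x) / x + bump R (Suc 0) 0 * cos (0 * x) / x^2 - bump R (Suc (Suc 0)) 0 * sin (0 * x) / x^3)
       + integral {0..R} (\<lambda>s. bump R (Suc (Suc (Suc 0))) s * sin (s * x)) / x^3) {0..R}"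
      by (rule has_integral_add_cancel)
    then have eq: "integral {0..R} (\<lambda>s. bump R 0 s * cos (s * x)) =
       (integral {0..R} (\<lambda>s. bump R (Suc (Suc (Suc 0))) s * sin (s * x)) - 8 / R^2 * sin (R * x)) / x^3"
      using R by (simp add: integral_unique bump_simps diff_divide_distrib)
    have "\<bar>integral {0..R} (\<lambda>s. bump R (Suc (Suc (Suc 0))) s * sin (s * x))\<bar> \<le> integral {0..R} (\<lambda>s. \<bar>bump R (Suc (Suc (Suc 0))) s\<bar>)"
      using R by (intro cos_transform_bound continuous_intros) auto
    also have "\<dots> = integral {0..R} (\<lambda>s. bump R (Suc (Suc (Suc 0))) s)"
      using R by (intro integral_cong) (auto simp: bump_simps)
    also have "\<dots> = bump R (Suc (Suc 0)) R - bump R (Suc (Suc 0)) 0"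
      using R has_real_derivative_bump[of R "Suc (Suc 0)"]
      by (intro integral_unique fundamental_theorem_of_calculus)
         (auto simp: has_real_derivative_iff_has_vector_derivative)
    also have "\<dots> = 12 / R^2" using R by (simp add: bump_simps diff_divide_distrib[symmetric])
    finally have 1: "\<bar>integral {0..R} (\<lambda>s. bump R (Suc (Suc (Suc 0))) s * sin (s * x))\<bar> \<le> 12 / R^2" .
    have "\<bar>8 / R^2 * sin (R * x)\<bar> \<le> 8 / R^2" by (simp add: abs_mult divide_right_mono)
    moreover have "12 / R^2 + 8 / R^2 = 20 / R^2" by (simp add: add_divide_distrib[symmetric])
    ultimately have "\<bar>integral {0..R} (\<lambda>s. bump R (Suc (Suc (Suc 0))) s * sin (s * x)) - 8 / R^2 * sin (R * x)\<bar> \<le> 20 / R^2"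
      using 1 by linarith
    then show ?thesis
      unfolding bump_kernel_def eq using False by (simp add: abs_mult abs_divide power_abs)
  qed simp
qed

lemma min_bound_rational:
  fixes a y :: real
  assumes "0 \<le> y" "a \<le> C" "a * y^2 \<le> C"
  shows "a \<le> 2 * C / (1 + y^2)"
proof -
  have "a * (1 + y^2) \<le> 2 * C" using assms by (simp add: algebra_simps)
  moreover have "1 + y^2 > 0" by (simp add: add_pos_nonneg)
  ultimately show ?thesis by (simp add: pos_le_divide_eq)
qed

text \<open>Against a Lipschitz function the kernel occurs with a factor |x|. The majorant is
  integrable with integral 80 pi / R, which is where the error O(1/R) comes from.\<close>

lemma bump_kernel_moment_bound:
  assumes R: "R > 0"
  shows "\<bar>x\<bar> * \<bar>bump_kernel R x\<bar> \<le> 80 / (1 + (R * \<bar>x\<bar>)^2)"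
proof -
  define y where "y = R * \<bar>x\<bar>"
  have y: "0 \<le> y" using R by (simp add: y_def)
  have k3: "\<bar>x\<bar> * \<bar>bump_kernel R x\<bar> * y^2 \<le> 40"
    using bump_kernel_bounds(2)[OF R, of x] R
    by (simp add: y_def field_simps power2_eq_square power3_eq_cube)
  have k1: "\<bar>x\<bar> * \<bar>bump_kernel R x\<bar> \<le> 2 * y"
    using mult_left_mono[OF bump_kernel_bounds(1)[OF R, of x], of "\<bar>x\<bar>"] by (simp add: y_def ac_simps)
  have "\<bar>x\<bar> * \<bar>bump_kernel R x\<bar> \<le> 40"
  proof (cases "y \<le> 1")
    case True then show ?thesis using k1 by linarith
  next
    case False
    then have "1 \<le> y^2" by (simp add: one_le_power)
    then have "\<bar>x\<bar> * \<bar>bump_kernel R x\<bar> * 1 \<le> \<bar>x\<bar> * \<bar>bump_kernel R x\<bar> * y^2"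
      by (intro mult_left_mono) auto
    then show ?thesis using k3 by linarith
  qed
  from min_bound_rational[OF y this k3] show ?thesis by (simp add: y_def)
qed

lemma integral_arctan_bound:
  fixes a t T :: real
  assumes a: "a > 0" and T: "T \<ge> 0"
  shows "(\<lambda>u. 1 / (1 + (a * \<bar>t - u\<bar>)^2)) integrable_on {0..T}"
    and "integral {0..T} (\<lambda>u. 1 / (1 + (a * \<bar>t - u\<bar>)^2)) \<le> pi / a"
proof -
  have nz: "1 + (a * (t - u))^2 \<noteq> 0" for u
    by (metis add.commute le_add_same_cancel1 not_one_le_zero zero_le_power2)
  have "((\<lambda>u. - arctan (a * (t - u)) / a) has_real_derivative 1 / (1 + (a * (t - u))^2)) (at u within {0..T})" for u
  proof -
    have "((\<lambda>u. - arctan (a * (t - u)) / a) has_real_derivative - (inverse (1 + (a * (t - u))^2) * (a * (0 - 1))) / a)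
      (at u within {0..T})"
      by (intro DERIV_cdivide DERIV_minus DERIV_chain2[OF DERIV_arctan])
         (rule derivative_eq_intros refl | simp)+
    moreover have "- (inverse (1 + (a * (t - u))^2) * (a * (0 - 1))) / a = 1 / (1 + (a * (t - u))^2)"
      using a by (simp add: divide_inverse)
    ultimately show ?thesis by simp
  qed
  then have I: "((\<lambda>u. 1 / (1 + (a * (t - u))^2)) has_integral
     (- arctan (a * (t - T)) / a) - (- arctan (a * (t - 0)) / a)) {0..T}"
    using T by (intro fundamental_theorem_of_calculus) (auto simp: has_real_derivative_iff_has_vector_derivative)
  have sq: "(a * \<bar>t - u\<bar>)^2 = (a * (t - u))^2" for u by (simp add: power_mult_distrib)
  show "(\<lambda>u. 1 / (1 + (a * \<bar>t - u\<bar>)^2)) integrable_on {0..T}"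
    unfolding sq using I by blast
  have "arctan (a * t) - arctan (a * (t - T)) \<le> pi"
    using arctan_bounded[of "a * t"] arctan_bounded[of "a * (t - T)"] by linarith
  then show "integral {0..T} (\<lambda>u. 1 / (1 + (a * \<bar>t - u\<bar>)^2)) \<le> pi / a"
    unfolding sq integral_unique[OF I] using a by (simp add: divide_right_mono diff_divide_distrib[symmetric])
qed

section \<open>A lower bound for the mass of the kernel\<close>

lemma integral_sinc: "R \<ge> 0 \<Longrightarrow> ((\<lambda>s. y * sinc (s * y)) has_integral Si (R * y)) {0..R}"
proof -
  assume "R \<ge> 0"
  have "((\<lambda>s. Si (s * y)) has_real_derivative sinc (s * y) * y) (at s within {0..R})" for s
    by (rule DERIV_chain2[OF DERIV_Si]) (auto intro!: derivative_eq_intros)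
  then have "((\<lambda>s. sinc (s * y) * y) has_integral Si (R * y) - Si (0 * y)) {0..R}"
    using \<open>R \<ge> 0\<close> by (intro fundamental_theorem_of_calculus) (auto simp: has_real_derivative_iff_has_vector_derivative)
  moreover have "Si 0 = 0" by (simp add: Si_def zero_ereal_def)
  ultimately show ?thesis by (simp add: mult.commute)
qed

text \<open>Subtracting the pure sine integral leaves the polynomial \<^term>\<open>(bump R 0 s - 1) / s\<close>,
  which one integration by parts controls.\<close>

lemma bump_sine_integral_lower_bound:
  obtains X where "X > 0"
    "\<And>R y. R > 0 \<Longrightarrow> R * y \<ge> X \<Longrightarrow> 1 / 2 \<le> integral {0..R} (\<lambda>s. bump R 0 s * (y * sinc (s * y)))"
proof -
  have "eventually (\<lambda>x. Si x > 1) at_top"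
    using order_tendstoD(1)[OF Si_at_top, of 1] pi_gt3 by simp
  then obtain X0 where X0: "\<And>x. x \<ge> X0 \<Longrightarrow> Si x > 1"
    by (auto simp: eventually_at_top_linorder)
  \<comment> \<open>Si tends to pi / 2, so it exceeds 1 beyond \<open>X0\<close>. The remainder is
    at most 3 / (R y), and R y >= 6 keeps it within 1/2.\<close>
  have "1 / 2 \<le> integral {0..R} (\<lambda>s. bump R 0 s * (y * sinc (s * y)))"
    if R: "R > 0" and y: "R * y \<ge> max X0 6" for R y
  proof -
    have y0: "y > 0" using R y by (metis (no_types) less_le_trans max.cobounded2 zero_less_mult_pos zero_less_numeral order_trans)
    define r where "r = (\<lambda>s. - 2 * s / R^2 + s^3 / R^4)"
    define r' where "r' = (\<lambda>s. - 2 / R^2 + 3 * s^2 / R^4)"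
    have rc: "continuous_on S r'" for S using R unfolding r'_def by (intro continuous_intros) auto
    have rr: "(r has_real_derivative r' s) (at s within S)" for s S
    proof -
      have "((\<lambda>s. - 2 * s / R^2 + s^3 / R^4) has_real_derivative - 2 * 1 / R^2 + (3 * s^2) / R^4) (at s within S)"
        by (intro DERIV_add DERIV_cdivide DERIV_cmult DERIV_ident) (auto intro!: derivative_eq_intros)
      then show ?thesis by (simp add: r_def[abs_def] r'_def)
    qed
    have rc0: "continuous_on S r" for S using rr by (meson DERIV_continuous_on)
    have r'b: "\<bar>r' s\<bar> \<le> 2 / R^2" if "s \<in> {0..R}" for s
    proof -
      have "(s / R)^2 \<le> 1" using that R by (intro power_le_one) auto
      then have "\<bar>- 2 + 3 * (s / R)^2\<bar> \<le> 2" by (auto simp: abs_le_iff)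
      then have "\<bar>- 2 + 3 * (s / R)^2\<bar> / R^2 \<le> 2 / R^2" by (intro divide_right_mono) auto
      moreover have "r' s = (- 2 + 3 * (s / R)^2) / R^2"
        using R by (simp add: r'_def field_simps power_numeral_reduce)
      ultimately show ?thesis using R by (simp add: abs_divide)
    qed
    have eq: "bump R 0 s * (y * sinc (s * y)) = y * sinc (s * y) + r s * sin (s * y)" for s
    proof (cases "s = 0")
      case True then show ?thesis by (simp add: bump_simps r_def)
    next
      case False
      have "bump R 0 s = 1 + r s * s" using R
        by (simp add: bump_simps r_def power2_diff power_divide field_simps power_numeral_reduce)
      moreover have "s * (y * sinc (s * y)) = sin (s * y)" using False y0 by simp
      ultimately show ?thesis by (simp add: distrib_right mult.assoc)
    qed
    have ir: "((\<lambda>s. r' s * cos (s * y) / y) has_integral integral {0..R} (\<lambda>s. r' s * cos (s * y)) / y) {0..R}"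
      by (intro has_integral_divide integrable_integral integrable_continuous_interval continuous_intros rc)
    have "((\<lambda>s. - r s * cos (s * y) / y) has_real_derivative r s * sin (s * y) - r' s * cos (s * y) / y) (at s within {0..R})" for s
    proof -
      have "((\<lambda>s. - r s * cos (s * y) / y) has_real_derivative
         (- r' s * cos (s * y) + (- sin (s * y) * y) * (- r s)) / y) (at s within {0..R})"
        by (intro DERIV_cdivide DERIV_mult DERIV_minus rr DERIV_cos_mult)
      then show ?thesis using y0 by (simp add: add_divide_distrib diff_divide_distrib mult.commute)
    qed
    then have "((\<lambda>s. r s * sin (s * y) - r' s * cos (s * y) / y) has_integral
       (- r R * cos (R * y) / y) - (- r 0 * cos (0 * y) / y)) {0..R}"
      using R by (intro fundamental_theorem_of_calculus) (auto simp: has_real_derivative_iff_has_vector_derivative)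
    from has_integral_add_cancel[OF this ir]
    have I2: "((\<lambda>s. r s * sin (s * y)) has_integral
       (cos (R * y) / R + integral {0..R} (\<lambda>s. r' s * cos (s * y))) / y) {0..R}"
      using R y0 by (simp add: r_def add_divide_distrib power_numeral_reduce)
    have "\<bar>integral {0..R} (\<lambda>s. r' s * cos (s * y))\<bar> \<le> integral {0..R} (\<lambda>s. \<bar>r' s\<bar>)"
      using R by (intro cos_transform_bound rc) auto
    also have "\<dots> \<le> integral {0..R} (\<lambda>s. 2 / R^2)"
      by (intro integral_le integrable_continuous_interval continuous_intros rc r'b) auto
    also have "\<dots> = 2 / R" using R by (simp add: power2_eq_square)
    finally have "\<bar>integral {0..R} (\<lambda>s. r' s * cos (s * y))\<bar> \<le> 2 / R" .
    moreover have "\<bar>cos (R * y) / R\<bar> \<le> 1 / R" using R by (simp add: abs_divide divide_right_mono)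
    moreover have "1 / R + 2 / R = 3 / R" by (simp add: add_divide_distrib[symmetric])
    ultimately have "\<bar>cos (R * y) / R + integral {0..R} (\<lambda>s. r' s * cos (s * y))\<bar> \<le> 3 / R"
      by linarith
    then have "\<bar>(cos (R * y) / R + integral {0..R} (\<lambda>s. r' s * cos (s * y))) / y\<bar> \<le> 3 / R / y"
      using divide_right_mono[of _ "3 / R" y] y0 by (simp only: abs_divide abs_of_pos less_imp_le)
    also have "\<dots> \<le> 1 / 2" using R y0 y by (simp add: field_simps)
    finally have b: "\<bar>(cos (R * y) / R + integral {0..R} (\<lambda>s. r' s * cos (s * y))) / y\<bar> \<le> 1 / 2" .
    have "integral {0..R} (\<lambda>s. bump R 0 s * (y * sinc (s * y))) = Si (R * y) + (cos (R * y) / R + integral {0..R} (\<lambda>s. r' s * cos (s * y))) / y"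
      unfolding eq using integral_sinc[of R y] I2 R
      by (intro integral_unique has_integral_add) auto
    moreover have "Si (R * y) > 1" using X0 y by simp
    ultimately show ?thesis using b by linarith
  qed
  then show thesis using that[of "max X0 6"] by auto
qed

text \<open>Exchanging the integrals turns the mass on [0, T] into a sum of two sine integrals, one
  for each end of the interval; hence both t and T - t have to be at least X. As R >= 1, one X
  serves all R.\<close>

lemma bump_kernel_mass:
  obtains X where "X > 0"
    "\<And>R t T. R \<ge> 1 \<Longrightarrow> t \<ge> X \<Longrightarrow> T \<ge> t + X \<Longrightarrow> 1 \<le> integral {0..T} (\<lambda>u. bump_kernel R (t - u))"
proof -
  obtain X where X: "X > 0"
    "\<And>R y. R > 0 \<Longrightarrow> R * y \<ge> X \<Longrightarrow> 1 / 2 \<le> integral {0..R} (\<lambda>s. bump R 0 s * (y * sinc (s * y)))"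
    using bump_sine_integral_lower_bound by blast
  have "1 \<le> integral {0..T} (\<lambda>u. bump_kernel R (t - u))" if R: "R \<ge> 1" and t: "t \<ge> X" and T: "T \<ge> t + X" for R t T
  proof -
    have R0: "R > 0" using R by simp
    have T0: "T > 0" using t T X(1) by linarith
    let ?V = "\<lambda>y. integral {0..R} (\<lambda>s. bump R 0 s * (y * sinc (s * y)))"
    have sc: "continuous_on {0..R} (\<lambda>s. bump R 0 s * (y * sinc (s * y)))" for y
      using R0 by (intro continuous_intros continuous_on_compose2[OF continuous_at_imp_continuous_on[of UNIV sinc]] isCont_sinc) auto
    have inner: "integral {0..T} (\<lambda>u. bump R 0 s * cos (s * (t - u))) =
        bump R 0 s * (t * sinc (s * t)) + bump R 0 s * ((T - t) * sinc (s * (T - t)))" for s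
    proof -
      have "((\<lambda>u. cos (s * (t - u))) has_integral t * sinc (s * t) + (T - t) * sinc (s * (T - t))) {0..T}"
      proof (cases "s = 0")
        case True
        then show ?thesis using has_integral_const_real[of "1::real" 0 T] T0 by simp
      next
        case False
        have "((\<lambda>u. - sin (s * (t - u)) / s) has_real_derivative cos (s * (t - u))) (at u within {0..T})" for u
        proof -
          have "((\<lambda>u. - sin (s * (t - u)) / s) has_real_derivative - (cos (s * (t - u)) * (s * (0 - 1))) / s) (at u within {0..T})"
            by (intro DERIV_cdivide DERIV_minus DERIV_chain2[OF DERIV_sin] DERIV_cmult DERIV_diff DERIV_ident DERIV_const)
          then show ?thesis using False by simp
        qed
        then have "((\<lambda>u. cos (s * (t - u))) has_integral (- sin (s * (t - T)) / s) - (- sin (s * (t - 0)) / s)) {0..T}"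
          using T0 by (intro fundamental_theorem_of_calculus) (auto simp: has_real_derivative_iff_has_vector_derivative)
        moreover have "(- sin (s * (t - T)) / s) - (- sin (s * (t - 0)) / s) = t * sinc (s * t) + (T - t) * sinc (s * (T - t))"
        proof -
          have "- sin (s * (t - T)) = sin (s * (T - t))"
            by (metis minus_diff_eq mult_minus_right sin_minus)
          then show ?thesis using False t T X(1) by simp
        qed
        ultimately show ?thesis by simp
      qed
      then show ?thesis by (simp add: integral_unique distrib_left)
    qed
    have "integral {0..T} (\<lambda>u. bump_kernel R (t - u)) = 2 * integral {0..T} (\<lambda>u. integral {0..R} (\<lambda>s. bump R 0 s * cos (s * (t - u))))"
      by (simp add: bump_kernel_def)
    also have "integral {0..T} (\<lambda>u. integral {0..R} (\<lambda>s. bump R 0 s * cos (s * (t - u)))) =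
       integral {0..R} (\<lambda>s. integral {0..T} (\<lambda>u. bump R 0 s * cos (s * (t - u))))"
      using R0 integral_swap_continuous[of 0 0 T R "\<lambda>u s. bump R 0 s * cos (s * (t - u))"]
      by (simp add: case_prod_unfold continuous_intros)
    also have "\<dots> = ?V t + ?V (T - t)"
      unfolding inner by (intro integral_add integrable_continuous_interval sc)
    finally have eq: "integral {0..T} (\<lambda>u. bump_kernel R (t - u)) = 2 * (?V t + ?V (T - t))" .
    show ?thesis
    proof -
      have "R * t \<ge> X" "R * (T - t) \<ge> X"
        using mult_mono[of 1 R X t] mult_mono[of 1 R X "T - t"] R t T X(1) by auto
      then show ?thesis unfolding eq using X(2)[OF R0, of t] X(2)[OF R0, of "T - t"] by simp
    qed
  qed
  with X(1) that show thesis by blast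
qed

section \<open>Approximation of Lipschitz functions\<close>

lemma continuous_on_cos_transform:
  fixes g :: "real \<Rightarrow> real"
  assumes "continuous_on {a..b} g"
  shows "continuous_on S (\<lambda>x. integral {a..b} (\<lambda>s. g s * cos (s * x)))"
    and "continuous_on S (\<lambda>x. integral {a..b} (\<lambda>s. g s * sin (s * x)))"
proof -
  have g: "continuous_on (UNIV \<times> cbox a b) (\<lambda>z. g (snd z))"
    by (rule continuous_on_compose2[OF assms]) (auto intro!: continuous_intros)
  have "continuous_on UNIV (\<lambda>x. integral (cbox a b) (\<lambda>s. g s * cos (s * x)))"
    by (rule integral_continuous_on_param) (auto simp: case_prod_unfold intro!: continuous_intros g[simplified])
  then show "continuous_on S (\<lambda>x. integral {a..b} (\<lambda>s. g s * cos (s * x)))"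
    by (auto intro: continuous_on_subset)
  have "continuous_on UNIV (\<lambda>x. integral (cbox a b) (\<lambda>s. g s * sin (s * x)))"
    by (rule integral_continuous_on_param) (auto simp: case_prod_unfold intro!: continuous_intros g[simplified])
  then show "continuous_on S (\<lambda>x. integral {a..b} (\<lambda>s. g s * sin (s * x)))"
    by (auto intro: continuous_on_subset)
qed

lemma continuous_on_transform_comp:
  fixes g :: "real \<Rightarrow> real"
  assumes "continuous_on {a..b} g" "continuous_on S h"
  shows "continuous_on S (\<lambda>u. integral {a..b} (\<lambda>s. g s * cos (s * h u)))"
    and "continuous_on S (\<lambda>u. integral {a..b} (\<lambda>s. g s * sin (s * h u)))"
  using continuous_on_compose2[OF continuous_on_cos_transform(1)[OF assms(1), of UNIV] assms(2)]
    continuous_on_compose2[OF continuous_on_cos_transform(2)[OF assms(1), of UNIV] assms(2)] by auto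

lemma continuous_on_bump_kernel_comp:
  "R > 0 \<Longrightarrow> continuous_on S h \<Longrightarrow> continuous_on S (\<lambda>u. bump_kernel R (h u))"
  unfolding bump_kernel_def
  by (intro continuous_intros continuous_on_transform_comp(1)) auto

text \<open>A mass of at least 1 allows g(t) to be put under the integral; replacing it by g(u)
  costs a first moment. The threshold X is chosen before R, T and g, because the lemma is applied to
  exp(-\<alpha> u) f(u) for all small \<alpha> at once.\<close>

lemma bump_kernel_approximation:
  obtains X where "X > 0"
    "\<And>(R::real) t T L (g :: real \<Rightarrow> 'a::banach). R \<ge> 1 \<Longrightarrow> t \<ge> X \<Longrightarrow> T \<ge> t + X \<Longrightarrow> L \<ge> 0 \<Longrightarrow> continuous_on {0..} g \<Longrightarrow>
      (\<And>u v. 0 \<le> u \<Longrightarrow> 0 \<le> v \<Longrightarrow> norm (g u - g v) \<le> L * \<bar>u - v\<bar>) \<Longrightarrow>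
      norm (g t) \<le> norm (integral {0..T} (\<lambda>u. bump_kernel R (t - u) *\<^sub>R g u)) + 80 * pi * L / R"
proof -
  obtain X where X: "X > 0"
    "\<And>R t T. R \<ge> 1 \<Longrightarrow> t \<ge> X \<Longrightarrow> T \<ge> t + X \<Longrightarrow> 1 \<le> integral {0..T} (\<lambda>u. bump_kernel R (t - u))"
    using bump_kernel_mass by blast
  show thesis
  proof (rule that[OF X(1)])
    fix R t T L :: real and g :: "real \<Rightarrow> 'a"
    assume R: "R \<ge> 1" and t: "t \<ge> X" and T: "T \<ge> t + X" and L: "L \<ge> 0" and gc: "continuous_on {0..} g"
      and g: "\<And>u v. 0 \<le> u \<Longrightarrow> 0 \<le> v \<Longrightarrow> norm (g u - g v) \<le> L * \<bar>u - v\<bar>"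
    have R0: "R > 0" and t0: "t \<ge> 0" and T0: "T \<ge> 0" using R t T X(1) by auto
    have gc': "continuous_on {0..T} g" using gc by (rule continuous_on_subset) auto
    note ci = integrable_continuous_interval continuous_intros continuous_on_bump_kernel_comp[OF R0] gc'
    let ?m = "integral {0..T} (\<lambda>u. bump_kernel R (t - u))"
    have "norm (g t) = norm (g t) * 1" by simp
    also have "\<dots> \<le> norm (g t) * ?m"
      by (intro mult_left_mono X(2) R t T) auto
    also have "\<dots> = norm (?m *\<^sub>R g t)"
      using X(2)[OF R t T] by simp
    also have "?m *\<^sub>R g t = integral {0..T} (\<lambda>u. bump_kernel R (t - u) *\<^sub>R g t)"
      by (subst integral_linear[OF _ bounded_linear_scaleR_left, unfolded o_def]) (auto intro!: ci)
    also have "\<dots> = integral {0..T} (\<lambda>u. bump_kernel R (t - u) *\<^sub>R g u + bump_kernel R (t - u) *\<^sub>R (g t - g u))"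
      by (simp add: algebra_simps)
    also have "\<dots> = integral {0..T} (\<lambda>u. bump_kernel R (t - u) *\<^sub>R g u) + integral {0..T} (\<lambda>u. bump_kernel R (t - u) *\<^sub>R (g t - g u))"
      by (intro integral_add ci)
    also have "norm \<dots> \<le> norm (integral {0..T} (\<lambda>u. bump_kernel R (t - u) *\<^sub>R g u)) + norm (integral {0..T} (\<lambda>u. bump_kernel R (t - u) *\<^sub>R (g t - g u)))"
      by (rule norm_triangle_ineq)
    also have "norm (integral {0..T} (\<lambda>u. bump_kernel R (t - u) *\<^sub>R (g t - g u))) \<le>
       integral {0..T} (\<lambda>u. 80 * L * (1 / (1 + (R * \<bar>t - u\<bar>)^2)))"
    proof (rule integral_norm_bound_integral)
      show "(\<lambda>u. bump_kernel R (t - u) *\<^sub>R (g t - g u)) integrable_on {0..T}" by (intro ci)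
      show "(\<lambda>u. 80 * L * (1 / (1 + (R * \<bar>t - u\<bar>)^2))) integrable_on {0..T}"
        using integrable_cmul[OF integral_arctan_bound(1)[OF R0 T0, of t], of "80 * L"] by simp
      fix u assume u: "u \<in> {0..T}"
      have "norm (bump_kernel R (t - u) *\<^sub>R (g t - g u)) \<le> \<bar>bump_kernel R (t - u)\<bar> * (L * \<bar>t - u\<bar>)"
        using u t0 g[of t u] by (simp add: mult_left_mono)
      also have "\<dots> = L * (\<bar>t - u\<bar> * \<bar>bump_kernel R (t - u)\<bar>)" by simp
      also have "\<dots> \<le> L * (80 / (1 + (R * \<bar>t - u\<bar>)^2))"
        by (intro mult_left_mono bump_kernel_moment_bound R0 L)
      finally show "norm (bump_kernel R (t - u) *\<^sub>R (g t - g u)) \<le> 80 * L * (1 / (1 + (R * \<bar>t - u\<bar>)^2))"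
        by (simp add: mult.commute[of L])
    qed
    also have "\<dots> = 80 * L * integral {0..T} (\<lambda>u. 1 / (1 + (R * \<bar>t - u\<bar>)^2))" by (rule integral_mult_right)
    also have "\<dots> \<le> 80 * L * (pi / R)"
      using L by (intro mult_left_mono integral_arctan_bound R0 T0) auto
    finally show "norm (g t) \<le> norm (integral {0..T} (\<lambda>u. bump_kernel R (t - u) *\<^sub>R g u)) + 80 * pi * L / R"
      by (simp add: mult.commute mult.left_commute)
  qed
qed

section \<open>The low-frequency kernel\<close>

text \<open>Here \<open>c\<close> is the chain of derivatives on \<open>[\<epsilon>, b]\<close> of a cutoff that is \<open>1\<close> on \<open>[0, \<epsilon>]\<close> and \<open>0\<close> beyond \<open>b\<close>.
  It need not vanish at \<open>b\<close> if \<open>b = R\<close>, since the bump does.\<close>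

definition low_cutoff :: "real \<Rightarrow> real \<Rightarrow> real \<Rightarrow> (nat \<Rightarrow> real \<Rightarrow> real) \<Rightarrow> real \<Rightarrow> bool" where
  "low_cutoff A \<epsilon> b c R \<longleftrightarrow> 1 \<le> A \<and> 0 < \<epsilon> \<and> \<epsilon> < b \<and> b \<le> R \<and> 1 \<le> R
     \<and> (\<forall>i<2. \<forall>s\<in>{\<epsilon>..b}. (c i has_real_derivative c (Suc i) s) (at s within {\<epsilon>..b}))
     \<and> continuous_on {\<epsilon>..b} (c 2)
     \<and> (\<forall>i\<le>2. \<forall>s\<in>{\<epsilon>..b}. \<bar>c i s\<bar> \<le> A * \<epsilon>^3 / s^(3 + i))
     \<and> c 0 \<epsilon> = 1 \<and> (b = R \<or> c 0 b = 0)"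

definition low_profile :: "real \<Rightarrow> real \<Rightarrow> (nat \<Rightarrow> real \<Rightarrow> real) \<Rightarrow> real \<Rightarrow> real" where
  "low_profile \<epsilon> b c s = (if s \<le> \<epsilon> then 1 else if s \<le> b then c 0 s else 0)"

definition low_kernel :: "real \<Rightarrow> real \<Rightarrow> (nat \<Rightarrow> real \<Rightarrow> real) \<Rightarrow> real \<Rightarrow> real \<Rightarrow> real" where
  "low_kernel \<epsilon> b c R x = 2 * integral {0..b} (\<lambda>s. bump R 0 s * low_profile \<epsilon> b c s * cos (s * x))"

lemma integral_inverse_power_le:
  fixes \<epsilon> b :: real
  assumes "0 < \<epsilon>" "\<epsilon> \<le> b" "n > 0"
  shows "(\<lambda>s. 1 / s ^ Suc n) integrable_on {\<epsilon>..b}"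
    and "integral {\<epsilon>..b} (\<lambda>s. 1 / s ^ Suc n) \<le> 1 / \<epsilon> ^ n"
proof -
  obtain k where n: "n = Suc k" using assms(3) by (cases n) auto
  have "((\<lambda>s. - (1 / real n) * inverse (s ^ n)) has_real_derivative - (1 / real n) * (- (inverse (s ^ n) * (real n * s ^ k) * inverse (s ^ n)))) (at s within {\<epsilon>..b})"
    if "s \<in> {\<epsilon>..b}" for s
    using that assms n DERIV_pow[of n s "{\<epsilon>..b}"]
    by (intro DERIV_cmult DERIV_inverse') auto
  moreover have "- (1 / real n) * (- (inverse (s ^ n) * (real n * s ^ k) * inverse (s ^ n))) = 1 / s ^ Suc n"
    if "s \<in> {\<epsilon>..b}" for s
  proof -
    have "s ^ k > 0" "s > 0" "real n > 0" using that assms n by auto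
    then show ?thesis using n by (simp add: inverse_eq_divide)
  qed
  ultimately have D: "((\<lambda>s. - (1 / real n) * inverse (s ^ n)) has_real_derivative 1 / s ^ Suc n) (at s within {\<epsilon>..b})"
    if "s \<in> {\<epsilon>..b}" for s using that by metis
  then have I: "((\<lambda>s. 1 / s ^ Suc n) has_integral - (1 / real n) * inverse (b ^ n) - - (1 / real n) * inverse (\<epsilon> ^ n)) {\<epsilon>..b}"
    using assms by (intro fundamental_theorem_of_calculus) (auto simp: has_real_derivative_iff_has_vector_derivative)
  show "(\<lambda>s. 1 / s ^ Suc n) integrable_on {\<epsilon>..b}" using I by blast
  have "(1 / real n) * inverse (\<epsilon> ^ n) \<le> 1 * inverse (\<epsilon> ^ n)"
    using assms by (intro mult_right_mono) auto
  moreover have "(1 / real n) * inverse (b ^ n) \<ge> 0" using assms by simp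
  ultimately have "integral {\<epsilon>..b} (\<lambda>s. 1 / s ^ Suc n) \<le> inverse (\<epsilon> ^ n)"
    unfolding integral_unique[OF I] by linarith
  then show "integral {\<epsilon>..b} (\<lambda>s. 1 / s ^ Suc n) \<le> 1 / \<epsilon> ^ n" by (simp add: inverse_eq_divide)
qed

context
  fixes A \<epsilon> b R :: real and c :: "nat \<Rightarrow> real \<Rightarrow> real"
  assumes lc: "low_cutoff A \<epsilon> b c R"
begin

lemma low_cutoff_pos: "1 \<le> A" "0 < \<epsilon>" "\<epsilon> < b" "b \<le> R" "1 \<le> R" "R > 0" "R \<noteq> 0"
  using lc by (auto simp: low_cutoff_def)

lemma low_cutoff_deriv:
  "s \<in> {\<epsilon>..b} \<Longrightarrow> (c 0 has_real_derivative c 1 s) (at s within {\<epsilon>..b})"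
  "s \<in> {\<epsilon>..b} \<Longrightarrow> (c 1 has_real_derivative c 2 s) (at s within {\<epsilon>..b})"
  using lc by (auto simp: low_cutoff_def numeral_2_eq_2)

lemma low_cutoff_continuous: "i \<le> 2 \<Longrightarrow> continuous_on {\<epsilon>..b} (c i)"
proof -
  assume "i \<le> 2"
  then consider "i = 0" | "i = 1" | "i = 2" by linarith
  then show ?thesis
  proof cases
    case 1 then show ?thesis using DERIV_continuous_on[OF low_cutoff_deriv(1)] by simp
  next
    case 2 then show ?thesis using DERIV_continuous_on[OF low_cutoff_deriv(2)] by simp
  next
    case 3 then show ?thesis using lc by (simp add: low_cutoff_def)
  qed
qed

lemma low_cutoff_bound: "i \<le> 2 \<Longrightarrow> s \<in> {\<epsilon>..b} \<Longrightarrow> \<bar>c i s\<bar> \<le> A * \<epsilon>^3 * (1 / s^(3 + i))"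
  using lc by (auto simp: low_cutoff_def)

lemma continuous_on_low_profile: "continuous_on {0..b} (low_profile \<epsilon> b c)"
proof -
  have eq: "{0..b} = {0..\<epsilon>} \<union> {\<epsilon>..b}" using low_cutoff_pos by auto
  have "continuous_on ({0..\<epsilon>} \<union> {\<epsilon>..b}) (\<lambda>s. if s \<le> \<epsilon> then 1 else c 0 s)"
    by (rule continuous_on_cases) (use low_cutoff_continuous[of 0] lc in \<open>auto simp: low_cutoff_def\<close>)
  then show ?thesis unfolding eq
    by (rule continuous_on_eq) (use low_cutoff_pos in \<open>auto simp: low_profile_def\<close>)
qed

text \<open>Beyond \<epsilon> the decay \<epsilon>^3 / s^3 beats both weights, 1 and s, so that the
  tail has the same order as the part below \<epsilon>, wherever b lies.\<close>

lemma low_profile_abs_le: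
  assumes g: "continuous_on {0..b} g" and gb: "\<And>s. s \<in> {0..b} \<Longrightarrow> \<bar>g s\<bar> \<le> s ^ n" and n: "n \<le> 1"
  shows "integral {0..b} (\<lambda>s. \<bar>g s * low_profile \<epsilon> b c s\<bar>) \<le> 2 * A * \<epsilon> ^ Suc n"
proof -
  note p = low_cutoff_pos
  have c: "continuous_on {0..b} (\<lambda>s. \<bar>g s * low_profile \<epsilon> b c s\<bar>)"
    by (intro continuous_intros g continuous_on_low_profile)
  have "integral {0..b} (\<lambda>s. \<bar>g s * low_profile \<epsilon> b c s\<bar>) =
     integral {0..\<epsilon>} (\<lambda>s. \<bar>g s * low_profile \<epsilon> b c s\<bar>) + integral {\<epsilon>..b} (\<lambda>s. \<bar>g s * low_profile \<epsilon> b c s\<bar>)"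
    using p c by (intro integral_combine_interval[symmetric] integrable_continuous_interval) auto
  also have "integral {0..\<epsilon>} (\<lambda>s. \<bar>g s * low_profile \<epsilon> b c s\<bar>) \<le> integral {0..\<epsilon>} (\<lambda>s. \<epsilon> ^ n)"
  proof (rule integral_le)
    show "(\<lambda>s. \<bar>g s * low_profile \<epsilon> b c s\<bar>) integrable_on {0..\<epsilon>}"
      using p by (intro integrable_continuous_interval continuous_on_subset[OF c]) auto
    fix s assume s: "s \<in> {0..\<epsilon>}"
    then have "\<bar>g s\<bar> \<le> s ^ n" using gb p by auto
    also have "\<dots> \<le> \<epsilon> ^ n" using s by (intro power_mono) auto
    finally show "\<bar>g s * low_profile \<epsilon> b c s\<bar> \<le> \<epsilon> ^ n" using s by (simp add: low_profile_def)
  qed auto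
  also have "integral {0..\<epsilon>} (\<lambda>s. \<epsilon> ^ n) = \<epsilon> ^ Suc n" using p by simp
  also have "integral {\<epsilon>..b} (\<lambda>s. \<bar>g s * low_profile \<epsilon> b c s\<bar>) \<le> integral {\<epsilon>..b} (\<lambda>s. A * \<epsilon>^3 * (1 / s ^ Suc (2 - n)))"
  proof (rule integral_le)
    show "(\<lambda>s. \<bar>g s * low_profile \<epsilon> b c s\<bar>) integrable_on {\<epsilon>..b}"
      using p by (intro integrable_continuous_interval continuous_on_subset[OF c]) auto
    show "(\<lambda>s. A * \<epsilon>^3 * (1 / s ^ Suc (2 - n))) integrable_on {\<epsilon>..b}"
      using integrable_cmul[OF integral_inverse_power_le(1)[of \<epsilon> b "2 - n"], of "A * \<epsilon>^3"] p n by simp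
    fix s assume s: "s \<in> {\<epsilon>..b}"
    have s0: "s > 0" using s p by auto
    have "low_profile \<epsilon> b c s = c 0 s" using s lc by (auto simp: low_profile_def low_cutoff_def)
    then have "\<bar>g s * low_profile \<epsilon> b c s\<bar> \<le> s ^ n * (A * \<epsilon>^3 * (1 / s ^ (3 + 0)))"
      unfolding abs_mult using gb[of s] low_cutoff_bound[of 0 s] s p
      by (intro mult_mono) (auto simp: low_profile_def)
    also have "\<dots> = A * \<epsilon>^3 * (1 / s ^ Suc (2 - n))"
    proof -
      have "n = 0 \<or> n = 1" using n by linarith
      then show ?thesis using s0 by (auto simp: power_numeral_reduce)
    qed
    finally show "\<bar>g s * low_profile \<epsilon> b c s\<bar> \<le> A * \<epsilon>^3 * (1 / s ^ Suc (2 - n))" .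
  qed
  also have "\<dots> = A * \<epsilon>^3 * integral {\<epsilon>..b} (\<lambda>s. 1 / s ^ Suc (2 - n))" by (rule integral_mult_right)
  also have "\<dots> \<le> A * \<epsilon>^3 * (1 / \<epsilon> ^ (2 - n))"
    using p n by (intro mult_left_mono integral_inverse_power_le) auto
  also have "\<dots> = A * \<epsilon> ^ Suc n"
  proof -
    have "n = 0 \<or> n = 1" using n by linarith
    then show ?thesis using p by (auto simp: power_numeral_reduce)
  qed
  also have "\<epsilon> ^ Suc n + A * \<epsilon> ^ Suc n \<le> 2 * A * \<epsilon> ^ Suc n"
    using mult_right_mono[of 1 A "\<epsilon> ^ Suc n"] p by simp
  finally show ?thesis by simp
qed

lemma low_kernel_bound: "\<bar>low_kernel \<epsilon> b c R x\<bar> \<le> 4 * A * \<epsilon>"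
proof -
  note p = low_cutoff_pos
  have "\<bar>integral {0..b} (\<lambda>s. bump R 0 s * low_profile \<epsilon> b c s * cos (s * x))\<bar> \<le> integral {0..b} (\<lambda>s. \<bar>bump R 0 s * low_profile \<epsilon> b c s\<bar>)"
    using p by (intro cos_transform_bound continuous_intros continuous_on_low_profile) auto
  also have "\<dots> \<le> 2 * A * \<epsilon> ^ Suc 0"
    using p by (intro low_profile_abs_le continuous_intros) (auto intro!: abs_bump_0_le)
  finally show ?thesis by (simp add: low_kernel_def)
qed

definition low_kernel' :: "real \<Rightarrow> real" where
  "low_kernel' x = - 2 * integral {0..b} (\<lambda>s. s * bump R 0 s * low_profile \<epsilon> b c s * sin (s * x))"

lemma low_kernel_deriv: "(low_kernel \<epsilon> b c R has_real_derivative low_kernel' x) (at x)"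
proof -
  have cp: "continuous_on (UNIV \<times> cbox 0 b) (\<lambda>z. low_profile \<epsilon> b c (snd z))"
    by (rule continuous_on_compose2[OF continuous_on_low_profile]) (auto intro!: continuous_intros)
  have "((\<lambda>x. integral (cbox 0 b) (\<lambda>s. bump R 0 s * low_profile \<epsilon> b c s * cos (s * x))) has_real_derivative
     integral (cbox 0 b) (\<lambda>s. bump R 0 s * low_profile \<epsilon> b c s * (- sin (s * x) * s))) (at x within UNIV)"
  proof (rule leibniz_rule_field_derivative)
    fix x s :: real
    show "((\<lambda>x. bump R 0 s * low_profile \<epsilon> b c s * cos (s * x)) has_real_derivative
        bump R 0 s * low_profile \<epsilon> b c s * (- sin (s * x) * s)) (at x within UNIV)"
      by (intro DERIV_cmult) (auto intro!: derivative_eq_intros)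
  next
    fix x :: real
    show "(\<lambda>s. bump R 0 s * low_profile \<epsilon> b c s * cos (s * x)) integrable_on cbox 0 b"
      using low_cutoff_pos continuous_on_low_profile by (intro integrable_continuous continuous_intros) auto
  next
    show "continuous_on (UNIV \<times> cbox 0 b) (\<lambda>(x, s). bump R 0 s * low_profile \<epsilon> b c s * (- sin (s * x) * s))"
      using low_cutoff_pos cp by (auto simp: case_prod_unfold intro!: continuous_intros)
  qed auto
  then have "((\<lambda>x. 2 * integral {0..b} (\<lambda>s. bump R 0 s * low_profile \<epsilon> b c s * cos (s * x))) has_real_derivative
     2 * integral {0..b} (\<lambda>s. bump R 0 s * low_profile \<epsilon> b c s * (- sin (s * x) * s))) (at x)"
    by (intro DERIV_cmult) simp
  moreover have "2 * integral {0..b} (\<lambda>s. bump R 0 s * low_profile \<epsilon> b c s * (- sin (s * x) * s)) = low_kernel' x"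
  proof -
    have "integral {0..b} (\<lambda>s. bump R 0 s * low_profile \<epsilon> b c s * (- sin (s * x) * s)) =
      integral {0..b} (\<lambda>s. - (s * bump R 0 s * low_profile \<epsilon> b c s * sin (s * x)))"
      by (intro integral_cong) (simp add: ac_simps)
    then show ?thesis by (simp add: low_kernel'_def)
  qed
  ultimately show ?thesis by (simp add: low_kernel_def[abs_def])
qed

text \<open>The sine integral is bounded by 2 A \<epsilon>^2 through absolute values, and by 272 A /
  x^2 after two integrations by parts, 272 being 25 + 26 + 26 + 72 + 123. Together they give a
  majorant whose integral over the line is of order A \<epsilon>. In 1088 = 2 * 2 * 272 one factor 2
  comes from the definition of \<open>low_kernel'\<close> and the other from
  \<open>min_bound_rational\<close>.\<close>

lemma low_kernel'_bound: "\<bar>low_kernel' x\<bar> \<le> 1088 * A * \<epsilon>^2 / (1 + (\<epsilon> * \<bar>x\<bar>)^2)"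
proof -
  note p = low_cutoff_pos
  define \<theta> where "\<theta> = (\<lambda>s. s * bump R 0 s * low_profile \<epsilon> b c s)"
  define h where "h = (\<lambda>s. s * bump R 0 s)"
  define h1 where "h1 = (\<lambda>s. bump R 0 s + s * bump R (Suc 0) s)"
  define h2 where "h2 = (\<lambda>s. 2 * bump R (Suc 0) s + s * bump R (Suc (Suc 0)) s)"
  have \<theta>c: "continuous_on {0..b} \<theta>"
    unfolding \<theta>_def using p by (intro continuous_intros continuous_on_low_profile)
  have dh: "(h has_real_derivative h1 s) (at s within S)" "(h1 has_real_derivative h2 s) (at s within S)" for s S
  proof -
    have "(h has_real_derivative 1 * bump R 0 s + bump R (Suc 0) s * s) (at s within S)"
      unfolding h_def using p by (intro DERIV_mult has_real_derivative_bump DERIV_ident) auto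
    then show "(h has_real_derivative h1 s) (at s within S)" by (simp add: h1_def mult.commute)
    have "(h1 has_real_derivative bump R (Suc 0) s + (1 * bump R (Suc 0) s + bump R (Suc (Suc 0)) s * s)) (at s within S)"
      unfolding h1_def using p by (intro DERIV_add DERIV_mult has_real_derivative_bump DERIV_ident) auto
    then show "(h1 has_real_derivative h2 s) (at s within S)" by (simp add: h2_def mult.commute)
  qed
  have h2c: "continuous_on S h2" for S unfolding h2_def using p by (intro continuous_intros) auto
  have b0: "\<bar>h s\<bar> \<le> s" and b1: "\<bar>h1 s\<bar> \<le> 25" and b2: "\<bar>h2 s\<bar> \<le> 72 / R" if s: "s \<in> {0..R}" for s
  proof -
    have i: "\<bar>bump R 0 s\<bar> \<le> 1" "\<bar>bump R (Suc 0) s\<bar> \<le> 24 / R" "\<bar>bump R (Suc (Suc 0)) s\<bar> \<le> 24 / R^2"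
      using abs_bump_0_le[of R s] abs_bump_le[of R s "Suc 0"] abs_bump_le[of R s "Suc (Suc 0)"] p s
      by (auto simp: power2_eq_square)
    show "\<bar>h s\<bar> \<le> s" using s mult_left_mono[OF i(1), of s] by (simp add: h_def abs_mult)
    have "\<bar>s * bump R (Suc 0) s\<bar> \<le> R * (24 / R)"
      unfolding abs_mult using i s p by (intro mult_mono) auto
    then have "\<bar>s * bump R (Suc 0) s\<bar> \<le> 24" using p by simp
    then show "\<bar>h1 s\<bar> \<le> 25" using i(1) unfolding h1_def by linarith
    have "\<bar>s * bump R (Suc (Suc 0)) s\<bar> \<le> R * (24 / R^2)"
      unfolding abs_mult using i s p by (intro mult_mono) auto
    then have "\<bar>s * bump R (Suc (Suc 0)) s\<bar> \<le> 24 / R" using p by (simp add: power2_eq_square)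
    moreover have "72 / R = 2 * (24 / R) + 24 / R" by simp
    ultimately show "\<bar>h2 s\<bar> \<le> 72 / R" using i(2) unfolding h2_def by linarith
  qed
  define H where "H = (\<lambda>s. h s * c 0 s)"
  define H1 where "H1 = (\<lambda>s. h1 s * c 0 s + h s * c 1 s)"
  define H2 where "H2 = (\<lambda>s. h2 s * c 0 s + 2 * (h1 s * c 1 s) + h s * c 2 s)"
  have dH: "(H has_real_derivative H1 s) (at s within {\<epsilon>..b})" "(H1 has_real_derivative H2 s) (at s within {\<epsilon>..b})"
    if s: "s \<in> {\<epsilon>..b}" for s
  proof -
    have "(H has_real_derivative h1 s * c 0 s + c 1 s * h s) (at s within {\<epsilon>..b})"
      unfolding H_def by (intro DERIV_mult dh low_cutoff_deriv s)
    then show "(H has_real_derivative H1 s) (at s within {\<epsilon>..b})" by (simp add: H1_def mult.commute)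
    have "(H1 has_real_derivative (h2 s * c 0 s + c 1 s * h1 s) + (h1 s * c 1 s + c 2 s * h s)) (at s within {\<epsilon>..b})"
      unfolding H1_def by (intro DERIV_add DERIV_mult dh low_cutoff_deriv s)
    then show "(H1 has_real_derivative H2 s) (at s within {\<epsilon>..b})" by (simp add: H2_def algebra_simps)
  qed
  have hc: "continuous_on S h" "continuous_on S h1" for S
    using dh by (meson DERIV_continuous_on)+
  have H2c: "continuous_on {\<epsilon>..b} H2"
    unfolding H2_def using low_cutoff_continuous[of 0] low_cutoff_continuous[of 1] low_cutoff_continuous[of 2]
    by (intro continuous_intros hc h2c) auto
  have bH1: "\<bar>H1 s\<bar> \<le> 26 * A" and bH2: "\<bar>H2 s\<bar> \<le> 123 * A * \<epsilon>^3 * (1 / s ^ Suc 3)" if s: "s \<in> {\<epsilon>..b}" for s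
  proof -
    have s0: "s > 0" and sR: "s \<in> {0..R}" using s p by auto
    define q where "q = A * \<epsilon>^3 / s^3"
    have q0: "q \<ge> 0" using p s0 by (simp add: q_def)
    have k: "\<bar>c 0 s\<bar> \<le> q" "\<bar>c 1 s\<bar> \<le> q / s" "\<bar>c 2 s\<bar> \<le> q / s^2"
      using low_cutoff_bound[of 0 s] low_cutoff_bound[of 1 s] low_cutoff_bound[of 2 s] s s0
      by (simp_all add: q_def power_numeral_reduce mult_ac)
    have "\<epsilon>^3 / s^3 \<le> 1" using s p s0 by (simp add: power_mono)
    then have "q \<le> A * 1" unfolding q_def times_divide_eq_right[symmetric] using p by (intro mult_left_mono) auto
    then have qA: "q \<le> A" by simp
    have "\<bar>h1 s * c 0 s\<bar> \<le> 25 * q" unfolding abs_mult using b1[OF sR] k(1) by (intro mult_mono) auto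
    moreover have "\<bar>h s * c 1 s\<bar> \<le> s * (q / s)" unfolding abs_mult using b0[OF sR] k(2) s0 by (intro mult_mono) auto
    then have "\<bar>h s * c 1 s\<bar> \<le> q" using s0 by simp
    ultimately show "\<bar>H1 s\<bar> \<le> 26 * A" using qA unfolding H1_def by linarith
    have "72 / R \<le> 72 / s" using sR s0 by (intro divide_left_mono) auto
    then have "\<bar>h2 s * c 0 s\<bar> \<le> (72 / s) * q" unfolding abs_mult using b2[OF sR] k(1) s0 by (intro mult_mono) auto
    moreover have "\<bar>h1 s * c 1 s\<bar> \<le> 25 * (q / s)" unfolding abs_mult using b1[OF sR] k(2) by (intro mult_mono) auto
    moreover have "\<bar>h s * c 2 s\<bar> \<le> s * (q / s^2)" unfolding abs_mult using b0[OF sR] k(3) s0 by (intro mult_mono) auto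
    then have "\<bar>h s * c 2 s\<bar> \<le> q / s" using s0 by (simp add: power2_eq_square)
    moreover have "(72 / s) * q = 72 * (q / s)" by simp
    ultimately have "\<bar>H2 s\<bar> \<le> 123 * (q / s)" unfolding H2_def by linarith
    also have "\<dots> = 123 * A * \<epsilon>^3 * (1 / s ^ Suc 3)" by (simp add: q_def power_numeral_reduce mult_ac)
    finally show "\<bar>H2 s\<bar> \<le> 123 * A * \<epsilon>^3 * (1 / s ^ Suc 3)" .
  qed
  let ?I = "integral {0..b} (\<lambda>s. \<theta> s * sin (s * x))"
  have kI: "low_kernel' x = - 2 * ?I" by (simp add: low_kernel'_def \<theta>_def)
  have I0: "\<bar>?I\<bar> \<le> 2 * A * \<epsilon>^2"
  proof -
    have "\<bar>?I\<bar> \<le> integral {0..b} (\<lambda>s. \<bar>\<theta> s\<bar>)"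
      using p by (intro cos_transform_bound \<theta>c) auto
    also have "\<dots> = integral {0..b} (\<lambda>s. \<bar>h s * low_profile \<epsilon> b c s\<bar>)" by (simp add: \<theta>_def h_def)
    also have "\<dots> \<le> 2 * A * \<epsilon> ^ Suc 1"
      using p b0 by (intro low_profile_abs_le hc) auto
    finally show ?thesis by (simp add: power2_eq_square)
  qed
  have I2: "\<bar>?I\<bar> * x^2 \<le> 272 * A"
  proof (cases "x = 0")
    case True then show ?thesis using p by simp
  next
    case False
    have \<theta>i: "\<theta> s = h s" if "s \<in> {0..\<epsilon>}" for s using that by (simp add: \<theta>_def h_def low_profile_def)
    have \<theta>o: "\<theta> s = H s" if "s \<in> {\<epsilon>..b}" for s
      using that lc by (auto simp: \<theta>_def h_def H_def low_profile_def low_cutoff_def)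
    \<comment> \<open>The profile has a kink at \<epsilon>, so the two sides are integrated by parts
      separately.\<close>
    have "?I = integral {0..\<epsilon>} (\<lambda>s. \<theta> s * sin (s * x)) + integral {\<epsilon>..b} (\<lambda>s. \<theta> s * sin (s * x))"
      using p by (intro integral_combine_interval[symmetric] integrable_continuous_interval continuous_intros \<theta>c) auto
    also have "integral {0..\<epsilon>} (\<lambda>s. \<theta> s * sin (s * x)) = integral {0..\<epsilon>} (\<lambda>s. h s * sin (s * x))"
      by (intro integral_cong) (simp add: \<theta>i)
    also have "integral {\<epsilon>..b} (\<lambda>s. \<theta> s * sin (s * x)) = integral {\<epsilon>..b} (\<lambda>s. H s * sin (s * x))"
      by (intro integral_cong) (simp add: \<theta>o)
    finally have eq: "?I = integral {0..\<epsilon>} (\<lambda>s. h s * sin (s * x)) + integral {\<epsilon>..b} (\<lambda>s. H s * sin (s * x))" .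
    let ?J1 = "integral {0..\<epsilon>} (\<lambda>s. h2 s * sin (s * x))" and ?J2 = "integral {\<epsilon>..b} (\<lambda>s. H2 s * sin (s * x))"
    have e1: "integral {0..\<epsilon>} (\<lambda>s. h s * sin (s * x)) = (h 0 * cos (0 * x) - h \<epsilon> * cos (\<epsilon> * x)) / x
     + (h1 \<epsilon> * sin (\<epsilon> * x) - h1 0 * sin (0 * x)) / x^2 - ?J1 / x^2"
      using p False by (intro sin_transform_by_parts dh h2c) auto
    have e2: "integral {\<epsilon>..b} (\<lambda>s. H s * sin (s * x)) = (H \<epsilon> * cos (\<epsilon> * x) - H b * cos (b * x)) / x
     + (H1 b * sin (b * x) - H1 \<epsilon> * sin (\<epsilon> * x)) / x^2 - ?J2 / x^2"
      using p False by (intro sin_transform_by_parts dH H2c) auto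
    \<comment> \<open>Continuity at the kink cancels the boundary terms of order 1/x there. At b the
      product vanishes through the cutoff or, if b = R, through the bump.\<close>
    have "H \<epsilon> = h \<epsilon>" "h 0 = 0" using lc by (auto simp: H_def h_def low_cutoff_def)
    moreover have "H b = 0" using lc p bump_zero_end(1)[of R] by (auto simp: H_def h_def low_cutoff_def)
    ultimately have "?I = (h1 \<epsilon> * sin (\<epsilon> * x) + H1 b * sin (b * x) - H1 \<epsilon> * sin (\<epsilon> * x) - ?J1 - ?J2) / x^2"
      unfolding eq e1 e2 by (simp add: add_divide_distrib diff_divide_distrib)
    then have eqI: "?I * x^2 = h1 \<epsilon> * sin (\<epsilon> * x) + H1 b * sin (b * x) - H1 \<epsilon> * sin (\<epsilon> * x) - ?J1 - ?J2"
      using False by simp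
    have sb: "\<bar>v * sin y\<bar> \<le> \<bar>v\<bar>" for v y :: real by (simp add: abs_mult mult_left_le)
    have "\<bar>?J1\<bar> \<le> integral {0..\<epsilon>} (\<lambda>s. \<bar>h2 s\<bar>)" using p by (intro cos_transform_bound h2c) auto
    also have "\<dots> \<le> integral {0..\<epsilon>} (\<lambda>s. 72 / R)"
      using p by (intro integral_le integrable_continuous_interval continuous_intros h2c b2) auto
    also have "\<dots> = 72 * (\<epsilon> / R)" using p by simp
    also have "\<dots> \<le> 72 * 1" using p by (intro mult_left_mono) auto
    finally have J1: "\<bar>?J1\<bar> \<le> 72" by simp
    have "\<bar>?J2\<bar> \<le> integral {\<epsilon>..b} (\<lambda>s. \<bar>H2 s\<bar>)" using p by (intro cos_transform_bound H2c) auto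
    also have "\<dots> \<le> integral {\<epsilon>..b} (\<lambda>s. 123 * A * \<epsilon>^3 * (1 / s ^ Suc 3))"
    proof (rule integral_le)
      show "(\<lambda>s. 123 * A * \<epsilon>^3 * (1 / s ^ Suc 3)) integrable_on {\<epsilon>..b}"
        using integrable_cmul[OF integral_inverse_power_le(1)[of \<epsilon> b 3], of "123 * A * \<epsilon>^3"] p by simp
    qed (use bH2 in \<open>auto intro!: integrable_continuous_interval continuous_intros H2c\<close>)
    also have "\<dots> = 123 * A * \<epsilon>^3 * integral {\<epsilon>..b} (\<lambda>s. 1 / s ^ Suc 3)" by (rule integral_mult_right)
    also have "\<dots> \<le> 123 * A * \<epsilon>^3 * (1 / \<epsilon> ^ 3)"
      using p by (intro mult_left_mono integral_inverse_power_le) auto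
    also have "\<dots> = 123 * A" using p by simp
    finally have J2: "\<bar>?J2\<bar> \<le> 123 * A" .
    have "\<bar>?I\<bar> * x^2 = \<bar>?I * x^2\<bar>" by (simp add: abs_mult)
    also have "\<dots> \<le> 25 + 26 * A + 26 * A + 72 + 123 * A"
    proof -
      have "\<bar>h1 \<epsilon>\<bar> \<le> 25" "\<bar>H1 b\<bar> \<le> 26 * A" "\<bar>H1 \<epsilon>\<bar> \<le> 26 * A" using b1[of \<epsilon>] bH1 p by auto
      then have "\<bar>h1 \<epsilon> * sin (\<epsilon> * x)\<bar> \<le> 25" "\<bar>H1 b * sin (b * x)\<bar> \<le> 26 * A" "\<bar>H1 \<epsilon> * sin (\<epsilon> * x)\<bar> \<le> 26 * A"
        using sb[of "h1 \<epsilon>" "\<epsilon> * x"] sb[of "H1 b" "b * x"] sb[of "H1 \<epsilon>" "\<epsilon> * x"] by linarith+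
      with J1 J2 show ?thesis unfolding eqI abs_le_iff by linarith
    qed
    also have "\<dots> \<le> 272 * A" using p by simp
    finally show ?thesis .
  qed
  have "\<bar>?I\<bar> / \<epsilon>^2 \<le> 2 * (272 * A) / (1 + (\<epsilon> * \<bar>x\<bar>)^2)"
  proof (rule min_bound_rational)
    have "\<bar>?I\<bar> / \<epsilon>^2 \<le> 2 * A" using I0 p by (simp add: pos_divide_le_eq)
    then show "\<bar>?I\<bar> / \<epsilon>^2 \<le> 272 * A" using p by linarith
    show "\<bar>?I\<bar> / \<epsilon>^2 * (\<epsilon> * \<bar>x\<bar>)^2 \<le> 272 * A" using I2 p by (simp add: power_mult_distrib)
  qed (use p in auto)
  then have "\<bar>?I\<bar> \<le> 2 * (272 * A) / (1 + (\<epsilon> * \<bar>x\<bar>)^2) * \<epsilon>^2"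
    using p by (simp add: pos_divide_le_eq)
  then show ?thesis unfolding kI by (simp add: abs_mult)
qed

text \<open>Integration by parts puts the derivative of the damped kernel against the primitive of
  f, which is bounded by P. The derivative of the kernel has integral O(A \<epsilon>), its boundary
  value is at most 4 A \<epsilon>, and the derivative of the damping, \<alpha> exp(-\<alpha> u), has
  mass at most 1. Hence neither \<alpha> nor T enters the bound. The constant 5000 exceeds 8 + 1088
  pi.\<close>

lemma low_kernel_integral_bound:
  fixes f :: "real \<Rightarrow> 'a::banach"
  assumes fc: "continuous_on {0..} f" and P: "\<And>u. u \<ge> 0 \<Longrightarrow> norm (integral {0..u} f) \<le> P"
    and \<alpha>: "\<alpha> > 0" and T: "T \<ge> 0"
  shows "norm (integral {0..T} (\<lambda>u. (exp (- (\<alpha> * u)) * low_kernel \<epsilon> b c R (t - u)) *\<^sub>R f u)) \<le> 5000 * P * A * \<epsilon>"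
proof -
  note p = low_cutoff_pos
  have P0: "P \<ge> 0" using P[of 0] by simp
  have fT: "continuous_on {0..T} f" using fc by (rule continuous_on_subset) auto
  define G where "G = (\<lambda>u. integral {0..u} f)"
  have dG: "(G has_vector_derivative f u) (at u within {0..T})" if "u \<in> {0..T}" for u
    unfolding G_def using integral_has_vector_derivative[OF fT that] .
  have Gc: "continuous_on {0..T} G" using dG by (rule continuous_on_vector_derivative)
  define k where "k = low_kernel \<epsilon> b c R"
  define w where "w = (\<lambda>u. exp (- (\<alpha> * u)) * k (t - u))"
  define w' where "w' = (\<lambda>u. - \<alpha> * exp (- (\<alpha> * u)) * k (t - u) - exp (- (\<alpha> * u)) * low_kernel' (t - u))"
  have dk: "((\<lambda>u. k (t - u)) has_real_derivative low_kernel' (t - u) * (0 - 1)) (at u within S)" for u S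
    unfolding k_def by (rule DERIV_chain2[OF low_kernel_deriv]) (intro DERIV_diff DERIV_ident DERIV_const)
  have dw: "(w has_real_derivative w' u) (at u within S)" for u S
  proof -
    have "(w has_real_derivative (exp (- (\<alpha> * u)) * - (\<alpha> * 1)) * k (t - u) + low_kernel' (t - u) * (0 - 1) * exp (- (\<alpha> * u))) (at u within S)"
      unfolding w_def by (intro DERIV_mult dk DERIV_chain2[OF DERIV_exp] DERIV_minus DERIV_cmult DERIV_ident)
    then show ?thesis by (simp add: w'_def mult_ac)
  qed
  have k'c: "continuous_on S (\<lambda>u. low_kernel' (t - u))" for S
    unfolding low_kernel'_def using p
    by (intro continuous_intros continuous_on_transform_comp(2) continuous_on_low_profile) auto
  have kc: "continuous_on S (\<lambda>u. k (t - u))" for S using dk by (meson DERIV_continuous_on)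
  have wc: "continuous_on S w" for S using dw by (meson DERIV_continuous_on)
  have w'c: "continuous_on S w'" for S unfolding w'_def by (intro continuous_intros k'c kc)
  have "((\<lambda>u. w u *\<^sub>R G u) has_vector_derivative w u *\<^sub>R f u + w' u *\<^sub>R G u) (at u within {0..T})" if "u \<in> {0..T}" for u
    by (rule has_vector_derivative_scaleR[OF dw dG[OF that]])
  then have "((\<lambda>u. w u *\<^sub>R f u + w' u *\<^sub>R G u) has_integral w T *\<^sub>R G T - w 0 *\<^sub>R G 0) {0..T}"
    by (intro fundamental_theorem_of_calculus T)
  moreover have "((\<lambda>u. w' u *\<^sub>R G u) has_integral integral {0..T} (\<lambda>u. w' u *\<^sub>R G u)) {0..T}"
    by (intro integrable_integral integrable_continuous_interval continuous_intros w'c Gc)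
  ultimately have "((\<lambda>u. w u *\<^sub>R f u) has_integral w T *\<^sub>R G T - integral {0..T} (\<lambda>u. w' u *\<^sub>R G u)) {0..T}"
    using has_integral_diff[of "\<lambda>u. w u *\<^sub>R f u + w' u *\<^sub>R G u" _ "{0..T}" "\<lambda>u. w' u *\<^sub>R G u"]
    by (simp add: G_def)
  then have eq: "integral {0..T} (\<lambda>u. w u *\<^sub>R f u) = w T *\<^sub>R G T - integral {0..T} (\<lambda>u. w' u *\<^sub>R G u)"
    by (rule integral_unique)
  have e1: "exp (- (\<alpha> * u)) \<le> 1" if "u \<ge> 0" for u using that \<alpha> by simp
  have "\<bar>w T\<bar> \<le> 1 * (4 * A * \<epsilon>)"
    unfolding w_def k_def abs_mult using e1[OF T] low_kernel_bound by (intro mult_mono) auto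
  then have n1: "norm (w T *\<^sub>R G T) \<le> (4 * A * \<epsilon>) * P"
    unfolding norm_scaleR G_def using P[OF T] p by (intro mult_mono) auto
  define B where "B = (\<lambda>u. (4 * A * \<epsilon> * P) * (\<alpha> * exp (- (\<alpha> * u))) + (1088 * A * \<epsilon>^2 * P) * (1 / (1 + (\<epsilon> * \<bar>t - u\<bar>)^2)))"
  have iB1: "((\<lambda>u. \<alpha> * exp (- (\<alpha> * u))) has_integral 1 - exp (- (\<alpha> * T))) {0..T}"
  proof -
    have "((\<lambda>u. - exp (- (\<alpha> * u))) has_real_derivative - (exp (- (\<alpha> * u)) * - (\<alpha> * 1))) (at u within {0..T})" for u
      by (intro DERIV_minus DERIV_chain2[OF DERIV_exp] DERIV_cmult DERIV_ident)
    then have "((\<lambda>u. \<alpha> * exp (- (\<alpha> * u))) has_integral - exp (- (\<alpha> * T)) - - exp (- (\<alpha> * 0))) {0..T}"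
      using T by (intro fundamental_theorem_of_calculus)
        (auto simp: has_real_derivative_iff_has_vector_derivative[symmetric] mult.commute)
    then show ?thesis by simp
  qed
  have iB: "B integrable_on {0..T}"
    and vB: "integral {0..T} B = (4 * A * \<epsilon> * P) * (1 - exp (- (\<alpha> * T))) +
      (1088 * A * \<epsilon>^2 * P) * integral {0..T} (\<lambda>u. 1 / (1 + (\<epsilon> * \<bar>t - u\<bar>)^2))"
  proof -
    have "(B has_integral (4 * A * \<epsilon> * P) * (1 - exp (- (\<alpha> * T))) +
      (1088 * A * \<epsilon>^2 * P) * integral {0..T} (\<lambda>u. 1 / (1 + (\<epsilon> * \<bar>t - u\<bar>)^2))) {0..T}"
      unfolding B_def using integral_arctan_bound(1)[OF p(2) T, of t]
      by (intro has_integral_add has_integral_mult_right iB1 integrable_integral)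
    then show "B integrable_on {0..T}" "integral {0..T} B = (4 * A * \<epsilon> * P) * (1 - exp (- (\<alpha> * T))) +
      (1088 * A * \<epsilon>^2 * P) * integral {0..T} (\<lambda>u. 1 / (1 + (\<epsilon> * \<bar>t - u\<bar>)^2))"
      by (auto simp: integral_unique)
  qed
  have "norm (integral {0..T} (\<lambda>u. w' u *\<^sub>R G u)) \<le> integral {0..T} B"
  proof (rule integral_norm_bound_integral)
    show "(\<lambda>u. w' u *\<^sub>R G u) integrable_on {0..T}"
      by (intro integrable_continuous_interval continuous_intros w'c Gc)
    fix u assume u: "u \<in> {0..T}"
    have "\<bar>\<alpha> * exp (- (\<alpha> * u)) * k (t - u)\<bar> \<le> \<alpha> * exp (- (\<alpha> * u)) * (4 * A * \<epsilon>)"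
      unfolding abs_mult[of "\<alpha> * exp (- (\<alpha> * u))"] k_def using \<alpha> low_kernel_bound by (intro mult_mono) auto
    moreover have "\<bar>exp (- (\<alpha> * u)) * low_kernel' (t - u)\<bar> \<le> 1 * (1088 * A * \<epsilon>^2 / (1 + (\<epsilon> * \<bar>t - u\<bar>)^2))"
      unfolding abs_mult using e1[of u] u low_kernel'_bound[of "t - u"] by (intro mult_mono) auto
    ultimately have "\<bar>w' u\<bar> \<le> \<alpha> * exp (- (\<alpha> * u)) * (4 * A * \<epsilon>) + 1088 * A * \<epsilon>^2 / (1 + (\<epsilon> * \<bar>t - u\<bar>)^2)"
      unfolding w'_def by linarith
    then have "norm (w' u *\<^sub>R G u) \<le> (\<alpha> * exp (- (\<alpha> * u)) * (4 * A * \<epsilon>) + 1088 * A * \<epsilon>^2 / (1 + (\<epsilon> * \<bar>t - u\<bar>)^2)) * P"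
      unfolding norm_scaleR G_def using P[of u] u by (intro mult_mono) auto
    also have "\<dots> = B u" by (simp add: B_def algebra_simps)
    finally show "norm (w' u *\<^sub>R G u) \<le> B u" .
  qed (rule iB)
  also have "\<dots> \<le> (4 * A * \<epsilon> * P) * 1 + (1088 * A * \<epsilon>^2 * P) * (pi / \<epsilon>)"
    unfolding vB using p P0 T by (intro add_mono mult_left_mono integral_arctan_bound(2)) auto
  also have "(1088 * A * \<epsilon>^2 * P) * (pi / \<epsilon>) = 1088 * pi * (A * \<epsilon> * P)"
    using p by (simp add: power2_eq_square)
  finally have n2: "norm (integral {0..T} (\<lambda>u. w' u *\<^sub>R G u)) \<le> 4 * (A * \<epsilon> * P) + 1088 * pi * (A * \<epsilon> * P)" by simp
  have "norm (integral {0..T} (\<lambda>u. w u *\<^sub>R f u)) \<le> 4 * (A * \<epsilon> * P) + (4 * (A * \<epsilon> * P) + 1088 * pi * (A * \<epsilon> * P))"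
    unfolding eq using norm_triangle_ineq4[of "w T *\<^sub>R G T" "integral {0..T} (\<lambda>u. w' u *\<^sub>R G u)"] n1 n2
    by (simp add: mult_ac)
  also have "\<dots> = (8 + 1088 * pi) * (A * \<epsilon> * P)" by (simp add: algebra_simps)
  also have "\<dots> \<le> 5000 * (A * \<epsilon> * P)"
    using pi_less_4 p P0 by (intro mult_right_mono) auto
  finally show ?thesis by (simp add: w_def k_def mult_ac)
qed

end

section \<open>From the Laplace transform to its boundary function\<close>

lemma laplace_truncation:
  fixes f :: "real \<Rightarrow> 'a::complex_banach"
  assumes fc: "continuous_on {0..} f" and fb: "\<And>u. u \<ge> 0 \<Longrightarrow> norm (f u) \<le> B"
    and z: "Re z > 0" and T: "T \<ge> 0"
  shows "norm (laplace f z - integral {0..T} (\<lambda>u. exp (- (z * complex_of_real u)) *\<^sub>C f u))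
     \<le> B * exp (- Re z * T) / Re z"
proof -
  define h where "h = (\<lambda>u. exp (- (z * complex_of_real u)) *\<^sub>C f u)"
  have hc: "continuous_on {0..} h" unfolding h_def by (intro continuous_intros fc)
  have hb: "norm (h u) \<le> B * exp (- Re z * u)" if "u \<ge> 0" for u
    using mult_left_mono[OF fb[OF that], of "exp (- Re z * u)"] by (simp add: h_def norm_scaleC mult.commute)
  have gi: "(\<lambda>u. B * exp (- Re z * u)) integrable_on {T..}" if "T \<ge> 0" for T
    using integrable_on_exp_minus_to_infinity[OF z, of T] by (intro integrable_on_mult_right) auto
  have hi: "h integrable_on {T..}" if "T \<ge> 0" for T
  proof (rule integrable_on_all_intervals_integrable_bound[OF _ _ gi[OF that]])
    fix a b :: real
    have "{T..} \<inter> cbox a b = {max T a..b}" by auto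
    moreover have "h integrable_on {max T a..b}"
      using that by (intro integrable_continuous_interval continuous_on_subset[OF hc]) auto
    ultimately show "(\<lambda>x. if x \<in> {T..} then h x else 0) integrable_on cbox a b"
      by (simp only: integrable_restrict_Int)
  qed (use that hb in auto)
  have "(h has_integral integral {0..T} h + integral {T..} h) ({0..T} \<union> {T..})"
  proof (rule has_integral_Un)
    show "(h has_integral integral {0..T} h) {0..T}"
      by (intro integrable_integral integrable_continuous_interval continuous_on_subset[OF hc]) auto
    show "(h has_integral integral {T..} h) {T..}" by (intro integrable_integral hi T)
    have "{0..T} \<inter> {T..} = {T}" using T by auto
    then show "negligible ({0..T} \<inter> {T..})" by simp
  qed
  moreover have "{0..T} \<union> {T..} = {0..}" using T by auto
  ultimately have "laplace f z - integral {0..T} h = integral {T..} h"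
    by (simp add: laplace_def h_def integral_unique)
  also have "norm \<dots> \<le> integral {T..} (\<lambda>u. B * exp (- Re z * u))"
    using hb T by (intro integral_norm_bound_integral hi gi) auto
  also have "\<dots> = B * (exp (- Re z * T) / Re z)"
    by (intro integral_unique has_integral_mult_right has_integral_exp_minus_to_infinity z)
  finally show ?thesis by (simp add: h_def)
qed

section \<open>The truncated Laplace transform against a frequency window\<close>

lemma integral_symmetric_interval:
  fixes g :: "real \<Rightarrow> 'a::banach"
  assumes g: "continuous_on {-R..R} g" and R: "R \<ge> 0"
  shows "integral {-R..R} g = integral {0..R} (\<lambda>s. g s + g (- s))"
proof -
  have g1: "continuous_on {0..R} g" and g2: "continuous_on {0..R} (\<lambda>s. g (- s))"
    using R by (auto intro!: continuous_on_compose2[OF g] continuous_intros)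
  have "integral {-R..R} g = integral {-R..0} g + integral {0..R} g"
    using R g by (intro integral_combine_interval[symmetric] integrable_continuous_interval) auto
  also have "integral {-R..0} g = integral {0..R} (\<lambda>s. g (- s))"
    using Henstock_Kurzweil_Integration.integral_reflect_real[of R 0 "\<lambda>s. g (- s)"] by simp
  finally show ?thesis
    using g1 g2 by (simp add: integral_add integrable_continuous_interval)
qed

lemma even_fourier_integral:
  fixes W :: "real \<Rightarrow> real"
  assumes W: "continuous_on {-R..R} W" and ev: "\<And>s. W (- s) = W s" and R: "R \<ge> 0"
  shows "integral {-R..R} (\<lambda>s. complex_of_real (W s) * cis (x * s)) = of_real (2 * integral {0..R} (\<lambda>s. W s * cos (s * x)))"
proof -
  have W0: "continuous_on {0..R} W" by (rule continuous_on_subset[OF W]) (use R in auto)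
  have "integral {-R..R} (\<lambda>s. complex_of_real (W s) * cis (x * s)) =
     integral {0..R} (\<lambda>s. complex_of_real (W s) * cis (x * s) + complex_of_real (W (- s)) * cis (x * (- s)))"
    by (intro integral_symmetric_interval continuous_intros W R)
  also have "\<dots> = integral {0..R} (\<lambda>s. complex_of_real (2 * (W s * cos (s * x))))"
    by (intro integral_cong) (simp add: ev complex_eq_iff mult.commute)
  also have "\<dots> = of_real (integral {0..R} (\<lambda>s. 2 * (W s * cos (s * x))))"
    using integral_linear[of "\<lambda>s. 2 * (W s * cos (s * x))" "{0..R}" complex_of_real] W0
    by (simp add: o_def bounded_linear_of_real integrable_continuous_interval continuous_intros)
  finally show ?thesis by simp
qed

text \<open>The truncation at T reduces the exchange of integrals to a continuous function on a
  rectangle; the evenness of W makes the inner integral real.\<close>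

lemma truncated_laplace_fubini:
  fixes f :: "real \<Rightarrow> 'a::complex_banach" and W :: "real \<Rightarrow> real"
  assumes fc: "continuous_on {0..T} f" and W: "continuous_on {-R..R} W" and ev: "\<And>s. W (- s) = W s" and R: "R \<ge> 0"
  shows "integral {-R..R} (\<lambda>s. (complex_of_real (W s) * cis (t * s)) *\<^sub>C
       integral {0..T} (\<lambda>u. exp (- (Complex \<alpha> s * complex_of_real u)) *\<^sub>C f u))
     = integral {0..T} (\<lambda>u. (exp (- (\<alpha> * u)) * (2 * integral {0..R} (\<lambda>s. W s * cos (s * (t - u))))) *\<^sub>R f u)"
proof -
  have e: "exp (- (Complex \<alpha> s * complex_of_real u)) = of_real (exp (- (\<alpha> * u))) * cis (- (u * s))" for s u
    by (simp add: cis_conv_exp exp_of_real[symmetric] exp_add[symmetric] complex_eq_iff Complex_eq ring_distribs mult_ac)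
  have "integral {-R..R} (\<lambda>s. (complex_of_real (W s) * cis (t * s)) *\<^sub>C
       integral {0..T} (\<lambda>u. exp (- (Complex \<alpha> s * complex_of_real u)) *\<^sub>C f u))
    = integral {-R..R} (\<lambda>s. integral {0..T} (\<lambda>u. (of_real (exp (- (\<alpha> * u))) * (complex_of_real (W s) * cis ((t - u) * s))) *\<^sub>C f u))"
  proof (intro integral_cong)
    fix s
    have "(complex_of_real (W s) * cis (t * s)) *\<^sub>C integral {0..T} (\<lambda>u. exp (- (Complex \<alpha> s * complex_of_real u)) *\<^sub>C f u)
      = integral {0..T} (\<lambda>u. (complex_of_real (W s) * cis (t * s)) *\<^sub>C (exp (- (Complex \<alpha> s * complex_of_real u)) *\<^sub>C f u))"
      by (intro integral_scaleC_right[symmetric] integrable_continuous_interval continuous_intros fc)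
    also have "\<dots> = integral {0..T} (\<lambda>u. (of_real (exp (- (\<alpha> * u))) * (complex_of_real (W s) * cis ((t - u) * s))) *\<^sub>C f u)"
    proof (intro integral_cong)
      fix u
      have "cis (t * s) * cis (- (u * s)) = cis ((t - u) * s)" by (simp add: cis_mult algebra_simps)
      then have "(complex_of_real (W s) * cis (t * s)) * exp (- (Complex \<alpha> s * complex_of_real u))
        = of_real (exp (- (\<alpha> * u))) * (complex_of_real (W s) * cis ((t - u) * s))"
        unfolding e by (metis mult.assoc mult.left_commute)
      then show "(complex_of_real (W s) * cis (t * s)) *\<^sub>C (exp (- (Complex \<alpha> s * complex_of_real u)) *\<^sub>C f u)
         = (of_real (exp (- (\<alpha> * u))) * (complex_of_real (W s) * cis ((t - u) * s))) *\<^sub>C f u"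
        by (simp only: scaleC_scaleC)
    qed
    finally show "(complex_of_real (W s) * cis (t * s)) *\<^sub>C integral {0..T} (\<lambda>u. exp (- (Complex \<alpha> s * complex_of_real u)) *\<^sub>C f u)
      = integral {0..T} (\<lambda>u. (of_real (exp (- (\<alpha> * u))) * (complex_of_real (W s) * cis ((t - u) * s))) *\<^sub>C f u)" .
  qed
  also have "\<dots> = integral {0..T} (\<lambda>u. integral {-R..R} (\<lambda>s. (of_real (exp (- (\<alpha> * u))) * (complex_of_real (W s) * cis ((t - u) * s))) *\<^sub>C f u))"
  proof -
    have "continuous_on (cbox (-R, 0) (R, T)) (\<lambda>z. W (fst z))" "continuous_on (cbox (-R, 0) (R, T)) (\<lambda>z. f (snd z))"
      by (auto intro!: continuous_on_compose2[OF W] continuous_on_compose2[OF fc] continuous_intros simp: cbox_Pair_eq)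
    then show ?thesis
      using integral_swap_continuous[of "-R" 0 R T "\<lambda>s u. (of_real (exp (- (\<alpha> * u))) * (complex_of_real (W s) * cis ((t - u) * s))) *\<^sub>C f u"]
      by (simp add: case_prod_unfold continuous_intros)
  qed
  also have "\<dots> = integral {0..T} (\<lambda>u. (exp (- (\<alpha> * u)) * (2 * integral {0..R} (\<lambda>s. W s * cos (s * (t - u))))) *\<^sub>R f u)"
  proof (intro integral_cong)
    fix u
    have "integral {-R..R} (\<lambda>s. (of_real (exp (- (\<alpha> * u))) * (complex_of_real (W s) * cis ((t - u) * s))) *\<^sub>C f u)
       = integral {-R..R} (\<lambda>s. of_real (exp (- (\<alpha> * u))) * (complex_of_real (W s) * cis ((t - u) * s))) *\<^sub>C f u"
      by (intro integral_scaleC_left integrable_continuous_interval continuous_intros W)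
    also have "integral {-R..R} (\<lambda>s. of_real (exp (- (\<alpha> * u))) * (complex_of_real (W s) * cis ((t - u) * s)))
      = of_real (exp (- (\<alpha> * u))) * of_real (2 * integral {0..R} (\<lambda>s. W s * cos (s * (t - u))))"
      unfolding integral_mult_right even_fourier_integral[OF W ev R] ..
    also have "\<dots> = of_real (exp (- (\<alpha> * u)) * (2 * integral {0..R} (\<lambda>s. W s * cos (s * (t - u)))))" by simp
    finally show "integral {-R..R} (\<lambda>s. (of_real (exp (- (\<alpha> * u))) * (complex_of_real (W s) * cis ((t - u) * s))) *\<^sub>C f u)
       = (exp (- (\<alpha> * u)) * (2 * integral {0..R} (\<lambda>s. W s * cos (s * (t - u))))) *\<^sub>R f u"
      by (simp only: scaleC_of_real)
  qed
  finally show ?thesis .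
qed

lemma truncated_laplace_tendsto:
  fixes f :: "real \<Rightarrow> 'a::complex_banach" and \<psi> :: "real \<Rightarrow> complex"
  assumes fc: "continuous_on {0..} f" and fb: "\<And>u. u \<ge> 0 \<Longrightarrow> norm (f u) \<le> B"
    and \<alpha>: "\<alpha> > 0" and \<psi>: "continuous_on {a..b} \<psi>" and ab: "a \<le> b"
  shows "((\<lambda>T. integral {a..b} (\<lambda>s. \<psi> s *\<^sub>C integral {0..T} (\<lambda>u. exp (- (Complex \<alpha> s * complex_of_real u)) *\<^sub>C f u)))
     \<longlongrightarrow> integral {a..b} (\<lambda>s. \<psi> s *\<^sub>C laplace f (Complex \<alpha> s))) at_top"
proof -
  obtain K where K: "K > 0" "\<And>s. s \<in> {a..b} \<Longrightarrow> norm (\<psi> s) \<le> K"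
    using compact_imp_bounded[OF compact_continuous_image[OF \<psi> compact_Icc]] by (auto simp: bounded_pos)
  let ?L = "\<lambda>T s. integral {0..T} (\<lambda>u. exp (- (Complex \<alpha> s * complex_of_real u)) *\<^sub>C f u)"
  have Lc: "continuous_on {a..b} (?L T)" for T
  proof -
    have "continuous_on ({a..b} \<times> cbox 0 T) (\<lambda>z. f (snd z))"
      by (auto intro!: continuous_on_compose2[OF fc] continuous_intros)
    then have "continuous_on {a..b} (\<lambda>s. integral (cbox 0 T) (\<lambda>u. exp (- (Complex \<alpha> s * complex_of_real u)) *\<^sub>C f u))"
      by (intro integral_continuous_on_param) (auto simp: case_prod_unfold Complex_eq intro!: continuous_intros)
    then show ?thesis by simp
  qed
  have Li: "(\<lambda>s. \<psi> s *\<^sub>C ?L T s) integrable_on {a..b}" for T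
    by (intro integrable_continuous_interval continuous_intros \<psi> Lc)
  define E where "E = (\<lambda>T. K * (B * exp (- \<alpha> * T) / \<alpha>))"
  have E: "norm (\<psi> s *\<^sub>C laplace f (Complex \<alpha> s) - \<psi> s *\<^sub>C ?L T s) \<le> E T" if "T \<ge> 0" "s \<in> {a..b}" for T s
  proof -
    have "norm (\<psi> s *\<^sub>C (laplace f (Complex \<alpha> s) - ?L T s)) \<le> K * (B * exp (- \<alpha> * T) / \<alpha>)"
      unfolding norm_scaleC using laplace_truncation[OF fc fb, of "Complex \<alpha> s" T] that \<alpha> K
      by (intro mult_mono) auto
    then show ?thesis by (simp add: scaleC.diff_right E_def)
  qed
  have "((\<lambda>T. exp (- (\<alpha> * T))) \<longlongrightarrow> 0) at_top"
    using \<alpha> by (intro filterlim_compose[OF exp_at_bot] filterlim_uminus_at_bot_at_top[THEN filterlim_compose]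
        filterlim_tendsto_pos_mult_at_top[OF tendsto_const _ filterlim_ident]) auto
  then have "((\<lambda>T. K * (B * exp (- (\<alpha> * T)) / \<alpha>)) \<longlongrightarrow> K * (B * 0 / \<alpha>)) at_top"
    using \<alpha> by (intro tendsto_intros) auto
  then have E0: "(E \<longlongrightarrow> 0) at_top" by (simp add: E_def)
  \<comment> \<open>Integrability comes from uniform approximation by the truncated transforms,
    without a proof that \<open>laplace f\<close> is continuous on the vertical line.\<close>
  have li: "(\<lambda>s. \<psi> s *\<^sub>C laplace f (Complex \<alpha> s)) integrable_on {a..b}"
  proof -
    have "\<exists>g. (\<forall>x\<in>cbox a b. norm (\<psi> x *\<^sub>C laplace f (Complex \<alpha> x) - g x) \<le> e) \<and> g integrable_on cbox a b" if "e > 0" for e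
    proof -
      have "eventually (\<lambda>T. E T < e \<and> T \<ge> 0) at_top"
        using order_tendstoD(2)[OF E0 that] eventually_ge_at_top[of 0] by (rule eventually_conj)
      then obtain T where "E T < e" "T \<ge> 0" by (auto simp: eventually_at_top_linorder)
      then show ?thesis using E[of T] Li[of T]
        by (intro exI[of _ "\<lambda>s. \<psi> s *\<^sub>C ?L T s"]) fastforce
    qed
    then show ?thesis using integrable_uniform_limit[of a b "\<lambda>s. \<psi> s *\<^sub>C laplace f (Complex \<alpha> s)"] by simp
  qed
  show ?thesis
  proof (rule LIM_zero_cancel, rule Lim_null_comparison)
    show "((\<lambda>T. (b - a) * E T) \<longlongrightarrow> 0) at_top" using tendsto_mult_right_zero[OF E0] .
    show "\<forall>\<^sub>F T in at_top. norm (integral {a..b} (\<lambda>s. \<psi> s *\<^sub>C ?L T s) - integral {a..b} (\<lambda>s. \<psi> s *\<^sub>C laplace f (Complex \<alpha> s)))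
       \<le> (b - a) * E T"
      using eventually_ge_at_top[of 0]
    proof eventually_elim
      case (elim T)
      have "norm (integral {a..b} (\<lambda>s. \<psi> s *\<^sub>C laplace f (Complex \<alpha> s) - \<psi> s *\<^sub>C ?L T s)) \<le> integral {a..b} (\<lambda>s. E T)"
        by (rule integral_norm_bound_integral) (use E elim in \<open>auto intro!: integrable_diff li Li\<close>)
      then have "norm (integral {a..b} (\<lambda>s. \<psi> s *\<^sub>C laplace f (Complex \<alpha> s)) - integral {a..b} (\<lambda>s. \<psi> s *\<^sub>C ?L T s)) \<le> (b - a) * E T"
        using ab by (simp add: integral_diff[OF li Li])
      then show ?case by (simp add: norm_minus_commute)
    qed
  qed
qed

section \<open>The frequency window between \<epsilon> and R, and the smoothing estimate\<close>

definition high_profile :: "real \<Rightarrow> real \<Rightarrow> (nat \<Rightarrow> real \<Rightarrow> real) \<Rightarrow> real \<Rightarrow> real \<Rightarrow> real" where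
  "high_profile \<epsilon> b c R s = (if s \<le> R then bump R 0 s * (1 - low_profile \<epsilon> b c s) else 0)"

lemma high_profile_eq:
  assumes lc: "low_cutoff A \<epsilon> b c R"
  shows "high_profile \<epsilon> b c R s = (if s \<le> R then bump R 0 s else 0) - (if s \<le> b then bump R 0 s * low_profile \<epsilon> b c s else 0)"
  using lc by (auto simp: high_profile_def low_profile_def low_cutoff_def algebra_simps)

lemma continuous_on_high_profile:
  assumes lc: "low_cutoff A \<epsilon> b c R"
  shows "continuous_on UNIV (\<lambda>s. high_profile \<epsilon> b c R \<bar>s\<bar>)"
proof -
  note p = low_cutoff_pos[OF lc]
  have "continuous_on ({0..R} \<union> {R..}) (\<lambda>s. if s \<le> R then bump R 0 s else 0)"
    using p bump_zero_end(1)[of R] by (intro continuous_on_cases continuous_intros) auto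
  moreover have "{0..R} \<union> {R..} = {0..}" using p by auto
  ultimately have 1: "continuous_on {0..} (\<lambda>s. if s \<le> R then bump R 0 s else 0)" by simp
  have z: "bump R 0 b * low_profile \<epsilon> b c b = 0"
    using lc p bump_zero_end(1)[of R] by (auto simp: low_profile_def low_cutoff_def)
  have "continuous_on ({0..b} \<union> {b..}) (\<lambda>s. if s \<le> b then bump R 0 s * low_profile \<epsilon> b c s else 0)"
    using p z by (intro continuous_on_cases continuous_intros continuous_on_low_profile[OF lc]) auto
  moreover have "{0..b} \<union> {b..} = {0..}" using p by auto
  ultimately have 2: "continuous_on {0..} (\<lambda>s. if s \<le> b then bump R 0 s * low_profile \<epsilon> b c s else 0)" by simp
  have "continuous_on {0..} (high_profile \<epsilon> b c R)"
    unfolding high_profile_eq[OF lc, abs_def] by (intro continuous_intros 1 2)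
  then show ?thesis by (rule continuous_on_compose2) (auto intro!: continuous_intros)
qed

lemma high_profile_kernel:
  assumes lc: "low_cutoff A \<epsilon> b c R"
  shows "2 * integral {0..R} (\<lambda>s. high_profile \<epsilon> b c R \<bar>s\<bar> * cos (s * x)) = bump_kernel R x - low_kernel \<epsilon> b c R x"
proof -
  note p = low_cutoff_pos[OF lc]
  have W: "continuous_on {0..R} (\<lambda>s. high_profile \<epsilon> b c R \<bar>s\<bar>)"
    by (rule continuous_on_subset[OF continuous_on_high_profile[OF lc]]) auto
  have 0: "integral {0..R} (\<lambda>s. high_profile \<epsilon> b c R \<bar>s\<bar> * cos (s * x)) =
     integral {0..b} (\<lambda>s. high_profile \<epsilon> b c R \<bar>s\<bar> * cos (s * x)) + integral {b..R} (\<lambda>s. high_profile \<epsilon> b c R \<bar>s\<bar> * cos (s * x))"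
    using p by (intro integral_combine_interval[symmetric] integrable_continuous_interval continuous_intros W) auto
  have 1: "integral {b..R} (\<lambda>s. high_profile \<epsilon> b c R \<bar>s\<bar> * cos (s * x)) = integral {b..R} (\<lambda>s. bump R 0 s * cos (s * x))"
  proof (rule integral_spike[of "{b}"])
    fix s assume "s \<in> {b..R} - {b}"
    then show "bump R 0 s * cos (s * x) = high_profile \<epsilon> b c R \<bar>s\<bar> * cos (s * x)"
      using p by (simp add: high_profile_def low_profile_def)
  qed simp
  have 2: "integral {0..b} (\<lambda>s. high_profile \<epsilon> b c R \<bar>s\<bar> * cos (s * x)) =
     integral {0..b} (\<lambda>s. bump R 0 s * cos (s * x)) - integral {0..b} (\<lambda>s. bump R 0 s * low_profile \<epsilon> b c s * cos (s * x))"
  proof -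
    have "integral {0..b} (\<lambda>s. high_profile \<epsilon> b c R \<bar>s\<bar> * cos (s * x)) =
      integral {0..b} (\<lambda>s. bump R 0 s * cos (s * x) - bump R 0 s * low_profile \<epsilon> b c s * cos (s * x))"
      using p by (intro integral_cong) (simp add: high_profile_def algebra_simps)
    also have "\<dots> = integral {0..b} (\<lambda>s. bump R 0 s * cos (s * x)) - integral {0..b} (\<lambda>s. bump R 0 s * low_profile \<epsilon> b c s * cos (s * x))"
      using p by (intro integral_diff integrable_continuous_interval continuous_intros continuous_on_low_profile[OF lc]) auto
    finally show ?thesis .
  qed
  have 3: "integral {0..R} (\<lambda>s. bump R 0 s * cos (s * x)) = integral {0..b} (\<lambda>s. bump R 0 s * cos (s * x)) + integral {b..R} (\<lambda>s. bump R 0 s * cos (s * x))"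
    using p by (intro integral_combine_interval[symmetric] integrable_continuous_interval continuous_intros) auto
  show ?thesis unfolding bump_kernel_def low_kernel_def 0 1 2 3 by simp
qed

lemma exp_uminus_lipschitz:
  fixes x y :: real
  assumes "0 \<le> x" "0 \<le> y"
  shows "\<bar>exp (- x) - exp (- y)\<bar> \<le> \<bar>x - y\<bar>"
proof -
  have *: "\<bar>exp (- x) - exp (- y)\<bar> \<le> \<bar>x - y\<bar>" if "0 \<le> x" "x \<le> y" for x y :: real
  proof -
    have "exp (- x) - exp (- y) = exp (- x) * (1 - exp (- (y - x)))"
      by (simp add: right_diff_distrib exp_add[symmetric])
    also have "\<dots> \<le> 1 * (y - x)"
    proof (rule mult_mono)
      show "1 - exp (- (y - x)) \<le> y - x" using exp_ge_add_one_self[of "- (y - x)"] by linarith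
    qed (use that in auto)
    finally show ?thesis using that by simp
  qed
  show ?thesis
    using *[of x y] *[of y x] assms by (cases "x \<le> y") auto
qed

text \<open>With \<alpha> at most 1 the constant does not involve \<alpha>, so the approximation
  error survives the limit in which the damping disappears.\<close>

lemma damped_lipschitz:
  fixes f :: "real \<Rightarrow> 'a::real_normed_vector"
  assumes fb: "\<And>u. u \<ge> 0 \<Longrightarrow> norm (f u) \<le> B" and L: "\<And>u v. u \<ge> 0 \<Longrightarrow> v \<ge> 0 \<Longrightarrow> norm (f u - f v) \<le> L * \<bar>u - v\<bar>"
    and \<alpha>: "0 < \<alpha>" "\<alpha> \<le> 1" and uv: "u \<ge> 0" "v \<ge> 0"
  shows "norm (exp (- (\<alpha> * u)) *\<^sub>R f u - exp (- (\<alpha> * v)) *\<^sub>R f v) \<le> (L + B) * \<bar>u - v\<bar>"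
proof -
  have "exp (- (\<alpha> * u)) *\<^sub>R f u - exp (- (\<alpha> * v)) *\<^sub>R f v
     = exp (- (\<alpha> * u)) *\<^sub>R (f u - f v) + (exp (- (\<alpha> * u)) - exp (- (\<alpha> * v))) *\<^sub>R f v"
    by (simp add: algebra_simps)
  also have "norm \<dots> \<le> 1 * (L * \<bar>u - v\<bar>) + \<bar>u - v\<bar> * B"
  proof (rule norm_triangle_mono)
    show "norm (exp (- (\<alpha> * u)) *\<^sub>R (f u - f v)) \<le> 1 * (L * \<bar>u - v\<bar>)"
      unfolding norm_scaleR using L[OF uv] \<alpha> uv by (intro mult_mono) auto
    have "\<bar>exp (- (\<alpha> * u)) - exp (- (\<alpha> * v))\<bar> \<le> \<bar>\<alpha> * u - \<alpha> * v\<bar>"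
      using \<alpha> uv by (intro exp_uminus_lipschitz) auto
    also have "\<dots> = \<alpha> * \<bar>u - v\<bar>" using \<alpha> by (simp add: right_diff_distrib[symmetric] abs_mult)
    also have "\<dots> \<le> 1 * \<bar>u - v\<bar>" using \<alpha> by (intro mult_right_mono) auto
    finally show "norm ((exp (- (\<alpha> * u)) - exp (- (\<alpha> * v))) *\<^sub>R f v) \<le> \<bar>u - v\<bar> * B"
      unfolding norm_scaleR using fb[OF uv(2)] by (intro mult_mono) auto
  qed
  finally show ?thesis by (simp add: algebra_simps)
qed

text \<open>For fixed \<alpha>, letting T grow turns the truncated transform into
  \<open>laplace f\<close>; then \<alpha> tends to 0 and the boundary function appears. X and K are
  fixed before the cutoff, \<epsilon> and R, which may therefore be chosen as functions of t later
  on.\<close>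

lemma smoothing_estimate:
  fixes f F :: "real \<Rightarrow> 'a::complex_banach"
  assumes f_bdd: "bounded (f ` {0..})"
    and fc: "continuous_on {0..} f"
    and f_lip: "\<exists>L. L-lipschitz_on {0..} f"
    and f_int_bdd: "bounded ((\<lambda>t. integral {0..t} f) ` {0..})"
    and F_bdry: "\<And>\<psi> :: real \<Rightarrow> complex. continuous_on UNIV \<psi> \<Longrightarrow>
          compact (closure {s. \<psi> s \<noteq> 0}) \<Longrightarrow> 0 \<notin> closure {s. \<psi> s \<noteq> 0} \<Longrightarrow>
          ((\<lambda>\<alpha>. integral UNIV (\<lambda>s. \<psi> s *\<^sub>C laplace f (Complex \<alpha> s)))
             \<longlongrightarrow> integral UNIV (\<lambda>s. \<psi> s *\<^sub>C F s)) (at_right 0)"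
  obtains X K where "X > 0" "K > 0"
    "\<And>A \<epsilon> b c R t. low_cutoff A \<epsilon> b c R \<Longrightarrow> t \<ge> X \<Longrightarrow>
       norm (f t) \<le> K * A * (\<epsilon> + 1 / R) + norm (integral UNIV (\<lambda>s. (of_real (high_profile \<epsilon> b c R \<bar>s\<bar>) * cis (t * s)) *\<^sub>C F s))"
proof -
  obtain B where B: "B > 0" "\<And>u. u \<ge> 0 \<Longrightarrow> norm (f u) \<le> B"
    using f_bdd by (auto simp: bounded_pos)
  obtain P where P: "P > 0" "\<And>u. u \<ge> 0 \<Longrightarrow> norm (integral {0..u} f) \<le> P"
    using f_int_bdd by (auto simp: bounded_pos)
  obtain L where L: "L-lipschitz_on {0..} f" using f_lip by blast
  have L0: "L \<ge> 0" using L by (rule lipschitz_on_nonneg)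
  have fl: "norm (f u - f v) \<le> L * \<bar>u - v\<bar>" if "u \<ge> 0" "v \<ge> 0" for u v
    using lipschitz_onD[OF L, of u v] that by (simp add: dist_norm)
  obtain X where X: "X > 0"
    "\<And>(R::real) t T L (g :: real \<Rightarrow> 'a). R \<ge> 1 \<Longrightarrow> t \<ge> X \<Longrightarrow> T \<ge> t + X \<Longrightarrow> L \<ge> 0 \<Longrightarrow> continuous_on {0..} g \<Longrightarrow>
      (\<And>u v. 0 \<le> u \<Longrightarrow> 0 \<le> v \<Longrightarrow> norm (g u - g v) \<le> L * \<bar>u - v\<bar>) \<Longrightarrow>
      norm (g t) \<le> norm (integral {0..T} (\<lambda>u. bump_kernel R (t - u) *\<^sub>R g u)) + 80 * pi * L / R"
    using bump_kernel_approximation by blast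
  define K where "K = 5000 * P + 80 * pi * (L + B)"
  have K0: "K > 0" using P B L0 by (simp add: K_def add_pos_nonneg)
  have main: "norm (f t) \<le> K * A * (\<epsilon> + 1 / R) + norm (integral UNIV (\<lambda>s. (of_real (high_profile \<epsilon> b c R \<bar>s\<bar>) * cis (t * s)) *\<^sub>C F s))"
    if lc: "low_cutoff A \<epsilon> b c R" and t: "t \<ge> X" for A \<epsilon> b c R t
  proof -
    note p = low_cutoff_pos[OF lc]
    have t0: "t \<ge> 0" using t X(1) by simp
    define W where "W = (\<lambda>s. high_profile \<epsilon> b c R \<bar>s\<bar>)"
    define \<psi> where "\<psi> = (\<lambda>s. of_real (W s) * cis (t * s))"
    have Wc: "continuous_on UNIV W" unfolding W_def by (rule continuous_on_high_profile[OF lc])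
    have Wc': "continuous_on {-R..R} W" using Wc by (rule continuous_on_subset) auto
    have Wout: "W s = 0" if "s \<notin> {-R..R}" for s using that by (auto simp: W_def high_profile_def abs_if split: if_splits)
    have Win: "W s = 0" if "\<bar>s\<bar> \<le> \<epsilon>" for s using that by (auto simp: W_def high_profile_def low_profile_def)
    have \<psi>c: "continuous_on S \<psi>" for S
      unfolding \<psi>_def using continuous_on_subset[OF Wc, of S] by (intro continuous_intros) auto
    have restr: "integral UNIV (\<lambda>s. \<psi> s *\<^sub>C G s) = integral {-R..R} (\<lambda>s. \<psi> s *\<^sub>C G s)" for G :: "real \<Rightarrow> 'a"
    proof -
      have "(\<lambda>s. \<psi> s *\<^sub>C G s) = (\<lambda>s. if s \<in> {-R..R} then \<psi> s *\<^sub>C G s else 0)"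
        by (auto simp: fun_eq_iff \<psi>_def Wout scaleC.zero_left)
      then show ?thesis by (metis integral_restrict_UNIV)
    qed
    have supp: "{s. \<psi> s \<noteq> 0} \<subseteq> {-R..-\<epsilon>} \<union> {\<epsilon>..R}"
    proof
      fix s assume "s \<in> {s. \<psi> s \<noteq> 0}"
      then have "W s \<noteq> 0" by (auto simp: \<psi>_def)
      then show "s \<in> {-R..-\<epsilon>} \<union> {\<epsilon>..R}" using Wout[of s] Win[of s] by force
    qed
    have csupp: "closure {s. \<psi> s \<noteq> 0} \<subseteq> {-R..-\<epsilon>} \<union> {\<epsilon>..R}"
      by (rule closure_minimal[OF supp]) (intro closed_Un closed_atLeastAtMost)
    have lim: "((\<lambda>\<alpha>. integral UNIV (\<lambda>s. \<psi> s *\<^sub>C laplace f (Complex \<alpha> s)))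
             \<longlongrightarrow> integral UNIV (\<lambda>s. \<psi> s *\<^sub>C F s)) (at_right 0)"
    proof (rule F_bdry[OF \<psi>c])
      show "compact (closure {s. \<psi> s \<noteq> 0})"
        using bounded_subset[OF _ csupp] by (simp add: compact_eq_bounded_closed)
      show "0 \<notin> closure {s. \<psi> s \<noteq> 0}" using csupp p by auto
    qed
    have est: "norm (exp (- (\<alpha> * t)) *\<^sub>R f t) \<le> K * A * (\<epsilon> + 1 / R) + norm (integral UNIV (\<lambda>s. \<psi> s *\<^sub>C laplace f (Complex \<alpha> s)))"
      if \<alpha>: "0 < \<alpha>" "\<alpha> \<le> 1" for \<alpha>
    proof -
      define I where "I = (\<lambda>T. integral {-R..R} (\<lambda>s. \<psi> s *\<^sub>C integral {0..T} (\<lambda>u. exp (- (Complex \<alpha> s * complex_of_real u)) *\<^sub>C f u)))"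
      have "norm (exp (- (\<alpha> * t)) *\<^sub>R f t) \<le> K * A * (\<epsilon> + 1 / R) + norm (I T)" if T: "T \<ge> t + X" for T
      proof -
        have T0: "T \<ge> 0" using T t0 X(1) by simp
        have fT: "continuous_on {0..T} f" using fc by (rule continuous_on_subset) auto
        let ?g = "\<lambda>u. exp (- (\<alpha> * u)) *\<^sub>R f u"
        let ?k = "\<lambda>u. exp (- (\<alpha> * u)) * low_kernel \<epsilon> b c R (t - u)"
        have lkc: "continuous_on S (\<lambda>u. low_kernel \<epsilon> b c R (t - u))" for S
          unfolding low_kernel_def using p
          by (intro continuous_intros continuous_on_transform_comp(1) continuous_on_low_profile[OF lc]) auto
        have bkc: "continuous_on S (\<lambda>u. bump_kernel R (t - u))" for S
          using p by (intro continuous_on_bump_kernel_comp continuous_intros) auto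
        have "norm (?g t) \<le> norm (integral {0..T} (\<lambda>u. bump_kernel R (t - u) *\<^sub>R ?g u)) + 80 * pi * (L + B) / R"
          using p t T L0 B \<alpha> by (intro X(2) damped_lipschitz[OF B(2) fl] continuous_intros fc) auto
        \<comment> \<open>An exact splitting: the first part is controlled by the bounded primitive
          of f, the second is the window \<open>W\<close>, to which Fubini applies.\<close>
        also have "integral {0..T} (\<lambda>u. bump_kernel R (t - u) *\<^sub>R ?g u) =
           integral {0..T} (\<lambda>u. ?k u *\<^sub>R f u) + integral {0..T} (\<lambda>u. (exp (- (\<alpha> * u)) * (bump_kernel R (t - u) - low_kernel \<epsilon> b c R (t - u))) *\<^sub>R f u)"
          by (subst integral_add[symmetric])
             (auto intro!: integrable_continuous_interval continuous_intros fT lkc bkc integral_cong simp: algebra_simps)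
        also have "integral {0..T} (\<lambda>u. (exp (- (\<alpha> * u)) * (bump_kernel R (t - u) - low_kernel \<epsilon> b c R (t - u))) *\<^sub>R f u) = I T"
          unfolding I_def \<psi>_def using p
          by (subst truncated_laplace_fubini[OF fT Wc']) (auto simp: W_def high_profile_kernel[OF lc])
        also have "norm (integral {0..T} (\<lambda>u. ?k u *\<^sub>R f u) + I T) \<le> norm (integral {0..T} (\<lambda>u. ?k u *\<^sub>R f u)) + norm (I T)"
          by (rule norm_triangle_ineq)
        also have "norm (integral {0..T} (\<lambda>u. ?k u *\<^sub>R f u)) \<le> 5000 * P * A * \<epsilon>"
          by (rule low_kernel_integral_bound[OF lc fc P(2) \<alpha>(1) T0])
        also have "5000 * P * A * \<epsilon> + norm (I T) + 80 * pi * (L + B) / R \<le> K * A * (\<epsilon> + 1 / R) + norm (I T)"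
        proof -
          have "5000 * P * A * \<epsilon> \<le> K * A * \<epsilon>" using p P B L0 by (intro mult_right_mono) (auto simp: K_def)
          moreover have "80 * pi * (L + B) * 1 * (1 / R) \<le> K * A * (1 / R)" using p P B L0 by (intro mult_mono) (auto simp: K_def)
          ultimately show ?thesis by (simp add: algebra_simps add_divide_distrib)
        qed
        finally show ?thesis by simp
      qed
      then have "eventually (\<lambda>T. norm (exp (- (\<alpha> * t)) *\<^sub>R f t) \<le> K * A * (\<epsilon> + 1 / R) + norm (I T)) at_top"
        by (auto simp: eventually_at_top_linorder)
      moreover have "(I \<longlongrightarrow> integral {-R..R} (\<lambda>s. \<psi> s *\<^sub>C laplace f (Complex \<alpha> s))) at_top"
        unfolding I_def using p by (intro truncated_laplace_tendsto[OF fc B(2) \<alpha>(1) \<psi>c]) auto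
      ultimately show ?thesis unfolding restr
        by (intro tendsto_lowerbound[OF tendsto_add[OF tendsto_const tendsto_norm]]) auto
    qed
    have "eventually (\<lambda>\<alpha>. norm (exp (- (\<alpha> * t)) *\<^sub>R f t) \<le> K * A * (\<epsilon> + 1 / R) + norm (integral UNIV (\<lambda>s. \<psi> s *\<^sub>C laplace f (Complex \<alpha> s)))) (at_right 0)"
      using eventually_at_right_real[of 0 1, OF zero_less_one]
      by (rule eventually_mono) (rule est; simp)
    moreover have "((\<lambda>\<alpha>. norm (exp (- (\<alpha> * t)) *\<^sub>R f t)) \<longlongrightarrow> norm (exp (- (0 * t)) *\<^sub>R f t)) (at_right 0)"
      by (intro tendsto_intros)
    ultimately have "norm (exp (- (0 * t)) *\<^sub>R f t) \<le> K * A * (\<epsilon> + 1 / R) + norm (integral UNIV (\<lambda>s. \<psi> s *\<^sub>C F s))"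
      by (intro tendsto_le[OF _ tendsto_add[OF tendsto_const tendsto_norm[OF lim]]]) auto
    then show ?thesis by (simp add: \<psi>_def W_def)
  qed
  show thesis using that[OF X(1) K0 main] .
qed

section \<open>A Riemann--Lebesgue lemma for Henstock--Kurzweil integrals\<close>

text \<open>The sum is affine in each weight, so its norm is largest at weights 0 or 1, that is, at
  a subset sum. The offset u carries the weights already fixed in the induction.\<close>

lemma norm_convex_weighted_sum_le:
  fixes v :: "'i \<Rightarrow> 'a::real_normed_vector"
  assumes "finite A" "\<And>B. B \<subseteq> A \<Longrightarrow> norm (u + sum v B) \<le> e" "\<And>i. i \<in> A \<Longrightarrow> 0 \<le> c i \<and> c i \<le> (1::real)"
  shows "norm (u + (\<Sum>i\<in>A. c i *\<^sub>R v i)) \<le> e"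
  using assms
proof (induction A arbitrary: u rule: finite_induct)
  case empty
  then show ?case by auto
next
  case (insert i A)
  have "norm ((u + c i *\<^sub>R v i) + (\<Sum>i\<in>A. c i *\<^sub>R v i)) \<le> e"
  proof (rule insert.IH)
    fix B assume B: "B \<subseteq> A"
    then have iB: "i \<notin> B" "finite B" using insert.hyps finite_subset by auto
    have 1: "norm (u + sum v B) \<le> e" using insert.prems(1)[of B] B by auto
    have 2: "norm (u + sum v (insert i B)) \<le> e" using insert.prems(1)[of "insert i B"] B by auto
    have c: "0 \<le> c i" "c i \<le> 1" using insert.prems(2)[of i] by auto
    have "u + c i *\<^sub>R v i + sum v B = (1 - c i) *\<^sub>R (u + sum v B) + c i *\<^sub>R (u + sum v (insert i B))"
      using iB by (simp add: algebra_simps)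
    also have "norm \<dots> \<le> (1 - c i) * e + c i * e"
      by (rule norm_triangle_mono) (use 1 2 c in \<open>auto intro!: mult_left_mono\<close>)
    finally show "norm (u + c i *\<^sub>R v i + sum v B) \<le> e" by (simp add: algebra_simps)
  qed (use insert.prems in auto)
  then show ?case using insert.hyps by (simp add: add.assoc)
qed

text \<open>Henstock's lemma controls the norms of sums over all subfamilies, but not sums of norms.
  This is the form in which bounded complex weights can still be attached to such a family. The
  factor 4 counts positive and negative parts of real and imaginary parts.\<close>

lemma norm_complex_weighted_sum_le:
  fixes v :: "'i \<Rightarrow> 'a::complex_banach"
  assumes A: "finite A" and e: "\<And>B. B \<subseteq> A \<Longrightarrow> norm (sum v B) \<le> e" and z: "\<And>i. i \<in> A \<Longrightarrow> cmod (z i) \<le> W" and W: "W > 0"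
  shows "norm (\<Sum>i\<in>A. z i *\<^sub>C v i) \<le> 4 * W * e"
proof -
  have pos: "norm (\<Sum>i\<in>A. c i *\<^sub>R v i) \<le> e" if "\<And>i. i \<in> A \<Longrightarrow> 0 \<le> c i \<and> c i \<le> (1::real)" for c
    using norm_convex_weighted_sum_le[of A 0 v e c] A e that by simp
  have real: "norm (\<Sum>i\<in>A. r i *\<^sub>R v i) \<le> 2 * e" if "\<And>i. i \<in> A \<Longrightarrow> \<bar>r i\<bar> \<le> (1::real)" for r
  proof -
    have "(\<Sum>i\<in>A. r i *\<^sub>R v i) = (\<Sum>i\<in>A. max (r i) 0 *\<^sub>R v i) - (\<Sum>i\<in>A. max (- r i) 0 *\<^sub>R v i)"
      unfolding sum_subtractf[symmetric] by (intro sum.cong) (auto simp: max_def)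
    also have "norm \<dots> \<le> e + e"
    proof (rule order_trans[OF norm_triangle_ineq4], intro add_mono pos)
      fix i assume "i \<in> A"
      from that[OF this] show "0 \<le> max (r i) 0 \<and> max (r i) 0 \<le> 1" "0 \<le> max (- r i) 0 \<and> max (- r i) 0 \<le> 1"
        by (auto simp: abs_le_iff)
    qed
    finally show ?thesis by simp
  qed
  have split: "z i *\<^sub>C v i = W *\<^sub>R ((Re (z i) / W) *\<^sub>R v i + \<i> *\<^sub>C ((Im (z i) / W) *\<^sub>R v i))" for i
  proof -
    have "z i = of_real W * (of_real (Re (z i) / W) + \<i> * of_real (Im (z i) / W))"
      using W by (simp add: complex_eq_iff)
    then have "z i *\<^sub>C v i = (of_real W * (of_real (Re (z i) / W) + \<i> * of_real (Im (z i) / W))) *\<^sub>C v i" by simp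
    then show ?thesis by (simp only: scaleC_scaleC[symmetric] scaleC_add_left scaleC_of_real)
  qed
  have "(\<Sum>i\<in>A. z i *\<^sub>C v i) = W *\<^sub>R ((\<Sum>i\<in>A. (Re (z i) / W) *\<^sub>R v i) + \<i> *\<^sub>C (\<Sum>i\<in>A. (Im (z i) / W) *\<^sub>R v i))"
    by (subst sum.cong[OF refl split]) (simp add: scaleR_sum_right[symmetric] sum.distrib scaleC.sum_right)
  also have "norm \<dots> \<le> W * (2 * e + 2 * e)"
    unfolding norm_scaleR abs_of_pos[OF W]
  proof (intro mult_left_mono norm_triangle_mono)
    have "\<bar>Re (z i) / W\<bar> \<le> 1" "\<bar>Im (z i) / W\<bar> \<le> 1" if "i \<in> A" for i
      using z[OF that] abs_Re_le_cmod[of "z i"] abs_Im_le_cmod[of "z i"] W by auto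
    then show "norm (\<Sum>i\<in>A. (Re (z i) / W) *\<^sub>R v i) \<le> 2 * e" "norm (\<i> *\<^sub>C (\<Sum>i\<in>A. (Im (z i) / W) *\<^sub>R v i)) \<le> 2 * e"
      using real[of "\<lambda>i. Re (z i) / W"] real[of "\<lambda>i. Im (z i) / W"] by (auto simp: norm_scaleC)
  qed (use W in auto)
  finally show ?thesis by simp
qed

section \<open>Riemann sums over separated cells\<close>

lemma sum_integral_disjoint_le:
  fixes r :: "real \<Rightarrow> real"
  assumes r: "r integrable_on {a..b}" "\<And>s. r s \<ge> 0" and Y: "finite Y"
    and sub: "\<And>y. y \<in> Y \<Longrightarrow> a \<le> y - h \<and> y + h \<le> b" and sep: "\<And>y y'. y \<in> Y \<Longrightarrow> y' \<in> Y \<Longrightarrow> y \<noteq> y' \<Longrightarrow> 2 * h < \<bar>y - y'\<bar>"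
  shows "(\<Sum>y\<in>Y. integral {y - h..y + h} r) \<le> integral {a..b} r"
proof -
  have ri: "r integrable_on {y - h..y + h}" if "y \<in> Y" for y
    using sub[OF that] by (intro integrable_subinterval_real[OF r(1)]) auto
  have U: "(r has_integral (\<Sum>y\<in>Y. integral {y - h..y + h} r)) (\<Union>y\<in>Y. {y - h..y + h})"
  proof (rule has_integral_UN[OF Y])
    show "(r has_integral integral {y - h..y + h} r) {y - h..y + h}" if "y \<in> Y" for y
      using ri[OF that] by (rule integrable_integral)
    have "{y - h..y + h} \<inter> {y' - h..y' + h} = {}" if "y \<in> Y" "y' \<in> Y" "y \<noteq> y'" for y y'
      using sep[OF that] by (auto simp: abs_if split: if_splits)
    then show "pairwise (\<lambda>y y'. negligible ({y - h..y + h} \<inter> {y' - h..y' + h})) Y"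
      by (auto simp: pairwise_def)
  qed
  have "(\<Sum>y\<in>Y. integral {y - h..y + h} r) = integral (\<Union>y\<in>Y. {y - h..y + h}) r"
    using U by (simp add: integral_unique)
  also have "\<dots> \<le> integral {a..b} r"
  proof (rule integral_subset_le)
    show "(\<Union>y\<in>Y. {y - h..y + h}) \<subseteq> {a..b}" using sub by fastforce
    show "r integrable_on (\<Union>y\<in>Y. {y - h..y + h})" using U by blast
  qed (use r in auto)
  finally show ?thesis .
qed

text \<open>Up to a part of small integral, the norm of F is bounded by a level K; for the bounded
  part only the lengths of intervals matter.\<close>

lemma integrable_truncation:
  fixes g :: "real \<Rightarrow> real"
  assumes g: "g integrable_on {a..b}" "\<And>s. g s \<ge> 0" and e: "e > 0"
  obtains K where "K > 0" "(\<lambda>s. max (g s - K) 0) integrable_on {a..b}" "integral {a..b} (\<lambda>s. max (g s - K) 0) \<le> e"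
proof -
  have ga: "g absolutely_integrable_on {a..b}"
    using g by (intro nonnegative_absolutely_integrable_1) auto
  have ca: "(\<lambda>s. K) absolutely_integrable_on {a..b}" for K :: real
    by (intro absolutely_integrable_continuous_real continuous_intros)
  have "(\<lambda>s. max (g s - K) 0) absolutely_integrable_on {a..b}" for K
    by (intro absolutely_integrable_max_1 set_integral_diff ga ca)
  then have mi: "(\<lambda>s. max (g s - K) 0) integrable_on {a..b}" for K
    by (rule set_lebesgue_integral_eq_integral)
  have "(\<lambda>k. integral {a..b} (\<lambda>s. max (g s - real k) 0)) \<longlonglongrightarrow> integral {a..b} (\<lambda>s. 0)"
  proof (rule dominated_convergence(2))
    show "g integrable_on {a..b}" by (rule g)
    show "norm (max (g s - real k) 0) \<le> g s" for s k using g(2)[of s] by auto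
    show "(\<lambda>k. max (g s - real k) 0) \<longlonglongrightarrow> 0" for s
    proof (rule tendsto_eventually)
      obtain n where n: "g s \<le> real n" using real_arch_simple by blast
      show "\<forall>\<^sub>F k in sequentially. max (g s - real k) 0 = 0"
        using eventually_ge_at_top[of n] by eventually_elim (use n in auto)
    qed
  qed (rule mi)
  then have "eventually (\<lambda>k. integral {a..b} (\<lambda>s. max (g s - real k) 0) < e) sequentially"
    using order_tendstoD(2) e by fastforce
  then obtain k where k: "\<And>j. j \<ge> k \<Longrightarrow> integral {a..b} (\<lambda>s. max (g s - real j) 0) < e"
    by (auto simp: eventually_sequentially)
  show thesis using that[of "real (Suc k)"] k[of "Suc k"] mi by (auto intro: less_imp_le)
qed

text \<open>A gauge need not be measurable, so \<^term>\<open>{x. ball x (1 / Suc n) \<subseteq> \<gamma> x}\<close> is replaced by its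
  closure; the open complements still decrease to the empty set.\<close>

lemma gauge_uniform_on_most:
  fixes a b :: real
  assumes \<gamma>: "gauge \<gamma>" and \<rho>: "\<rho> > 0"
  obtains n where "measure lborel ({a<..<b} - closure {x\<in>{a..b}. ball x (inverse (real (Suc n))) \<subseteq> \<gamma> x}) < \<rho>"
proof -
  define E where "E = (\<lambda>n. {x\<in>{a..b}. ball x (inverse (real (Suc n))) \<subseteq> \<gamma> x})"
  define U where "U = (\<lambda>n. {a<..<b} - closure (E n))"
  have "(\<lambda>n. measure lborel (U n)) \<longlonglongrightarrow> measure lborel (\<Inter>n. U n)"
  proof (rule Lim_measure_decseq)
    show "range U \<subseteq> sets lborel" by (auto simp: U_def)
    show "decseq U"
    proof (rule decseq_SucI)
      fix n
      have "inverse (real (Suc (Suc n))) \<le> inverse (real (Suc n))" by (intro le_imp_inverse_le) auto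
      then have "E n \<subseteq> E (Suc n)" unfolding E_def using subset_ball by blast
      then show "U (Suc n) \<subseteq> U n" unfolding U_def using closure_mono by blast
    qed
    fix n
    have "emeasure lborel (U n) \<le> emeasure lborel {a..b}"
      by (rule emeasure_mono) (auto simp: U_def)
    also have "\<dots> < \<infinity>" by (cases "a \<le> b") auto
    finally show "emeasure lborel (U n) \<noteq> \<infinity>" by simp
  qed
  moreover have "(\<Inter>n. U n) = {}"
  proof -
    have "\<exists>n. x \<in> closure (E n)" if x: "x \<in> {a<..<b}" for x
    proof -
      obtain d where d: "d > 0" "ball x d \<subseteq> \<gamma> x"
        using \<gamma> by (metis gauge_def open_contains_ball)
      obtain n where "inverse (real (Suc n)) < d" using reals_Archimedean d(1) by blast
      then have "x \<in> E n" using d x subset_ball[of "inverse (real (Suc n))" d x] by (auto simp: E_def)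
      then show ?thesis using closure_subset by blast
    qed
    then show ?thesis by (fastforce simp: U_def)
  qed
  ultimately have "(\<lambda>n. measure lborel (U n)) \<longlonglongrightarrow> 0" by simp
  then have "eventually (\<lambda>n. measure lborel (U n) < \<rho>) sequentially"
    using order_tendstoD(2) \<rho> by blast
  then show thesis using that by (auto simp: eventually_sequentially U_def E_def)
qed

text \<open>The tag may lie anywhere in its cell, ends included, so that one tag can serve both the
  cell that ends at it and the cell that begins at it.\<close>

lemma Henstock_tagged_family:
  fixes F :: "real \<Rightarrow> 'a::banach"
  assumes Fi: "F integrable_on {a..b}" and e: "e > 0" and \<gamma>: "gauge \<gamma>"
    and fine: "\<And>p. p tagged_division_of cbox a b \<Longrightarrow> \<gamma> fine p \<Longrightarrow> norm ((\<Sum>(x,K)\<in>p. measure lborel K *\<^sub>R F x) - integral (cbox a b) F) < e"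
    and Y: "finite Y" and h': "h' > 0"
    and x: "\<And>y. y \<in> Y \<Longrightarrow> l y \<le> x y \<and> x y \<le> l y + h' \<and> a \<le> l y \<and> l y + h' \<le> b \<and> {l y..l y + h'} \<subseteq> \<gamma> (x y)"
    and sep: "\<And>y y'. y \<in> Y \<Longrightarrow> y' \<in> Y \<Longrightarrow> y \<noteq> y' \<Longrightarrow> h' < \<bar>l y - l y'\<bar>"
  shows "norm (\<Sum>y\<in>Y. h' *\<^sub>R F (x y) - integral {l y..l y + h'} F) \<le> e"
proof -
  let ?\<phi> = "\<lambda>y. (x y, {l y..l y + h'})"
  have inj: "inj_on ?\<phi> Y"
  proof (rule inj_onI)
    fix y y' assume yy: "y \<in> Y" "y' \<in> Y" "?\<phi> y = ?\<phi> y'"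
    then have "l y = l y'" using h' by (auto simp: Icc_eq_Icc)
    then show "y = y'" using sep[OF yy(1,2)] h' by auto
  qed
  have pd: "?\<phi> ` Y tagged_partial_division_of cbox a b"
    unfolding tagged_partial_division_of_def
  proof (intro conjI allI impI)
    show "finite (?\<phi> ` Y)" using Y by simp
    fix z K assume "(z, K) \<in> ?\<phi> ` Y"
    then obtain y where y: "y \<in> Y" "z = x y" "K = {l y..l y + h'}" by auto
    show "z \<in> K" "K \<subseteq> cbox a b" using x[OF y(1)] y by auto
    show "\<exists>a b. K = cbox a b" unfolding y(3) box_real[symmetric] by blast
  next
    show "interior K \<inter> interior K' = {}" if "(z, K) \<in> ?\<phi> ` Y \<and> (z', K') \<in> ?\<phi> ` Y \<and> (z, K) \<noteq> (z', K')" for z K z' K'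
    proof -
      from that obtain y y' where yy: "y \<in> Y" "y' \<in> Y" "K = {l y..l y + h'}" "K' = {l y'..l y' + h'}" "y \<noteq> y'" by auto
      then show ?thesis using sep[OF yy(1,2,5)] by (auto simp: abs_if split: if_splits)
    qed
  qed
  have "\<gamma> fine ?\<phi> ` Y" using x by (auto simp: fine_def)
  from Henstock_lemma_part1[OF Fi[folded box_real] e \<gamma> fine pd this]
  have "norm (\<Sum>(x,K)\<in>?\<phi> ` Y. measure lborel K *\<^sub>R F x - integral K F) \<le> e" by simp
  also have "(\<Sum>(x,K)\<in>?\<phi> ` Y. measure lborel K *\<^sub>R F x - integral K F) = (\<Sum>y\<in>Y. h' *\<^sub>R F (x y) - integral {l y..l y + h'} F)"
    using h' by (subst sum.reindex[OF inj]) simp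
  finally show ?thesis .
qed

text \<open>As the space need not be separable, \<open>F\<close> need not be approximable by step functions in \<open>L\<^sup>1\<close>, and the
  norm form of Henstock's lemma fails in infinite dimensions. So cells are compared in pairs:
  two adjacent cells of equal length that share a tag have nearly the same integral, and for most
  pairs a common tag at which the gauge is not too small exists near the common endpoint.\<close>

lemma adjacent_cells_integral_difference:
  fixes F :: "real \<Rightarrow> 'a::banach"
  assumes Fi: "F integrable_on {a..b}" and Fn: "(\<lambda>s. norm (F s)) integrable_on {a..b}" and \<eta>: "\<eta> > 0"
  obtains h0 where "h0 > 0"
    "\<And>h Y. 0 < h \<Longrightarrow> h < h0 \<Longrightarrow> finite Y \<Longrightarrow> (\<And>y. y \<in> Y \<Longrightarrow> a \<le> y - h \<and> y + h \<le> b) \<Longrightarrow>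
       (\<And>y y'. y \<in> Y \<Longrightarrow> y' \<in> Y \<Longrightarrow> y \<noteq> y' \<Longrightarrow> 2 * h < \<bar>y - y'\<bar>) \<Longrightarrow>
       norm (\<Sum>y\<in>Y. integral {y - h..y} F - integral {y..y + h} F) \<le> \<eta>"
proof (cases "a < b")
  case False
  show thesis
  proof (rule that[of 1])
    fix h :: real and Y assume "0 < h" "\<And>y. y \<in> Y \<Longrightarrow> a \<le> y - h \<and> y + h \<le> b"
    then have "Y = {}" using False by force
    then show "norm (\<Sum>y\<in>Y. integral {y - h..y} F - integral {y..y + h} F) \<le> \<eta>" using \<eta> by simp
  qed simp
next
  case ab: True
  obtain K where K: "K > 0" "(\<lambda>s. max (norm (F s) - K) 0) integrable_on {a..b}" "integral {a..b} (\<lambda>s. max (norm (F s) - K) 0) \<le> \<eta> / 16"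
    using integrable_truncation[OF Fn, of "\<eta> / 16"] \<eta> by auto
  define r where "r = (\<lambda>s. max (norm (F s) - K) 0)"
  have r: "r integrable_on {a..b}" "\<And>s. r s \<ge> 0" "integral {a..b} r \<le> \<eta> / 16"
    using K by (auto simp: r_def)
  \<comment> \<open>A tag is accepted within \<kappa> h of the common endpoint y. Moving both cells
    to it costs at most 5 K \<kappa> h per pair besides the truncated part, and there are at most (b
    - a) / (2 h) pairs, which makes at most \<eta> / 4.\<close>
  define \<kappa> where "\<kappa> = min (1 / 2) (\<eta> / (10 * K * (b - a)))"
  have \<kappa>: "0 < \<kappa>" "\<kappa> \<le> 1 / 2" using \<eta> K ab by (auto simp: \<kappa>_def)
  have "\<kappa> \<le> \<eta> / (10 * K * (b - a))" by (simp add: \<kappa>_def)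
  then have \<kappa>2: "10 * K * \<kappa> * (b - a) \<le> \<eta>" using K ab by (simp add: pos_le_divide_eq mult_ac)
  \<comment> \<open>At most \<rho> / (\<kappa> h) pairs have no acceptable tag. They cost 2 K h each
    besides the truncated part, together at most 2 K \<rho> / \<kappa> = \<eta> / 4.\<close>
  define \<rho> where "\<rho> = \<kappa> * \<eta> / (8 * K)"
  have \<rho>: "\<rho> > 0" using \<kappa> \<eta> K by (simp add: \<rho>_def)
  have "(F has_integral integral (cbox a b) F) (cbox a b)"
    using Fi by (simp add: integrable_integral)
  then obtain \<gamma> where \<gamma>: "gauge \<gamma>"
    and fine: "\<And>p. p tagged_division_of cbox a b \<Longrightarrow> \<gamma> fine p \<Longrightarrow> norm ((\<Sum>(x,K)\<in>p. measure lborel K *\<^sub>R F x) - integral (cbox a b) F) < \<eta> / 8"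
    unfolding has_integral using \<eta> by (metis (no_types, lifting) divide_pos_pos zero_less_numeral)
  obtain n where n: "measure lborel ({a<..<b} - closure {x\<in>{a..b}. ball x (inverse (real (Suc n))) \<subseteq> \<gamma> x}) < \<rho>"
    using gauge_uniform_on_most[OF \<gamma> \<rho>] by blast
  define E where "E = {x\<in>{a..b}. ball x (inverse (real (Suc n))) \<subseteq> \<gamma> x}"
  define U where "U = {a<..<b} - closure E"
  have U: "measure lborel U < \<rho>" using n by (simp add: U_def E_def)
  show thesis
  proof (rule that[of "inverse (real (Suc n))"])
    fix h :: real and Y
    assume h: "0 < h" "h < inverse (real (Suc n))" and Y: "finite Y"
      and sub: "\<And>y. y \<in> Y \<Longrightarrow> a \<le> y - h \<and> y + h \<le> b"
      and sep: "\<And>y y'. y \<in> Y \<Longrightarrow> y' \<in> Y \<Longrightarrow> y \<noteq> y' \<Longrightarrow> 2 * h < \<bar>y - y'\<bar>"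
    define P where "P = (\<lambda>s. integral {a..s} F)"
    have Pd: "integral {u..v} F = P v - P u" if "a \<le> u" "u \<le> v" "v \<le> b" for u v
    proof -
      have "integral {a..u} F + integral {u..v} F = integral {a..v} F"
        using that by (intro integral_combine_interval integrable_subinterval_real[OF Fi]) auto
      then show ?thesis by (simp add: P_def algebra_simps)
    qed
    define \<sigma> where "\<sigma> = (\<lambda>y. integral {y - h..y + h} r)"
    have Pb: "norm (P v - P u) \<le> K * (v - u) + \<sigma> y" if y: "y \<in> Y" and uv: "y - h \<le> u" "u \<le> v" "v \<le> y + h" for y u v
    proof -
      have ineq: "a \<le> u" "v \<le> b" using sub[OF y] uv by auto
      have ru: "r integrable_on {u..v}" using ineq by (intro integrable_subinterval_real[OF r(1)]) auto
      have ry: "r integrable_on {y-h..y+h}" using sub[OF y] by (intro integrable_subinterval_real[OF r(1)]) auto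
      have "norm (integral {u..v} F) \<le> integral {u..v} (\<lambda>s. K + r s)"
        using ineq by (intro integral_norm_bound_integral integrable_subinterval_real[OF Fi] integrable_add ru) (auto simp: r_def)
      also have "\<dots> = K * (v - u) + integral {u..v} r"
        using uv by (subst integral_add[OF _ ru]) auto
      also have "integral {u..v} r \<le> \<sigma> y"
        unfolding \<sigma>_def using uv r ru ry by (intro integral_subset_le) auto
      finally show ?thesis using Pd[of u v] ineq uv by simp
    qed
    have \<sigma>0: "\<sigma> y \<ge> 0" if "y \<in> Y" for y unfolding \<sigma>_def by (rule Henstock_Kurzweil_Integration.integral_nonneg)
       (use sub[OF that] in \<open>auto intro!: integrable_subinterval_real[OF r(1)] r(2)\<close>)
    have \<sigma>sum: "(\<Sum>y\<in>Y. \<sigma> y) \<le> \<eta> / 16"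
      using sum_integral_disjoint_le[OF r(1,2) Y sub sep] r(3) unfolding \<sigma>_def by linarith
    have cardY: "real (card Y) * (2 * h) \<le> b - a"
    proof -
      have "(\<lambda>_. 1 :: real) integrable_on {a..b}" by (intro integrable_continuous_interval continuous_intros)
      from sum_integral_disjoint_le[OF this _ Y sub sep] h ab show ?thesis by (simp add: mult.commute)
    qed
    define G where "G = {y\<in>Y. \<exists>x\<in>E. y - \<kappa> * h < x \<and> x < y}"
    define N where "N = Y - G"
    have fin: "finite G" "finite N" using Y by (auto simp: G_def N_def)
    have GN: "Y = G \<union> N" "G \<inter> N = {}" "G \<subseteq> Y" "N \<subseteq> Y" by (auto simp: G_def N_def)
    define x where "x = (\<lambda>y. SOME x. x \<in> E \<and> y - \<kappa> * h < x \<and> x < y)"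
    have x: "x y \<in> E" "y - \<kappa> * h < x y" "x y < y" if "y \<in> G" for y
    proof -
      have "\<exists>x. x \<in> E \<and> y - \<kappa> * h < x \<and> x < y" using that by (auto simp: G_def)
      from someI_ex[OF this] show "x y \<in> E" "y - \<kappa> * h < x y" "x y < y" by (auto simp: x_def)
    qed
    \<comment> \<open>The cells are shortened so that [x - h', x] and [x, x + h'] both stay inside
      [y - h, y + h], although the tag x lies to the left of y.\<close>
    define h' where "h' = h * (1 - \<kappa>)"
    have kh: "0 < \<kappa> * h" "\<kappa> * h \<le> h / 2" using \<kappa> h mult_right_mono[OF \<kappa>(2), of h] by auto
    have h'eq: "h' = h - \<kappa> * h" by (simp add: h'_def algebra_simps)
    have h': "h' > 0" "h' < h" using kh h unfolding h'eq by auto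
    have tag\<gamma>: "{x y - h'..x y} \<subseteq> \<gamma> (x y)" "{x y..x y + h'} \<subseteq> \<gamma> (x y)" if "y \<in> G" for y
      using x(1)[OF that] h' h by (auto simp: E_def dist_real_def subset_eq)
    have xsep: "h' < \<bar>x y - x y'\<bar>" if "y \<in> G" "y' \<in> G" "y \<noteq> y'" for y y'
      using sep[of y y'] that GN x[OF that(1)] x[OF that(2)] kh h'(2) by (auto simp: abs_if split: if_splits)
    have H1: "norm (\<Sum>y\<in>G. h' *\<^sub>R F (x y) - integral {(x y - h')..(x y - h') + h'} F) \<le> \<eta> / 8"
    proof (rule Henstock_tagged_family[OF Fi _ \<gamma> fine fin(1) h'(1)])
      fix y assume y: "y \<in> G"
      show "x y - h' \<le> x y \<and> x y \<le> x y - h' + h' \<and> a \<le> x y - h' \<and> x y - h' + h' \<le> b \<and> {x y - h'..x y - h' + h'} \<subseteq> \<gamma> (x y)"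
        using tag\<gamma>[OF y] x[OF y] sub[of y] y GN h' h kh unfolding h'eq by auto
    qed (use xsep \<eta> in auto)
    have H2: "norm (\<Sum>y\<in>G. h' *\<^sub>R F (x y) - integral {x y..x y + h'} F) \<le> \<eta> / 8"
    proof (rule Henstock_tagged_family[OF Fi _ \<gamma> fine fin(1) h'(1)])
      fix y assume y: "y \<in> G"
      show "x y \<le> x y \<and> x y \<le> x y + h' \<and> a \<le> x y \<and> x y + h' \<le> b \<and> {x y..x y + h'} \<subseteq> \<gamma> (x y)"
        using tag\<gamma>[OF y] x[OF y] sub[of y] y GN h' h kh unfolding h'eq by auto
    qed (use xsep \<eta> in auto)
    define D where "D = (\<lambda>y. integral {y - h..y} F - integral {y..y + h} F)"
    define D' where "D' = (\<lambda>y. integral {x y - h'..x y} F - integral {x y..x y + h'} F)"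
    have HD: "norm (sum D' G) \<le> \<eta> / 4"
    proof -
      have "sum D' G = (\<Sum>y\<in>G. h' *\<^sub>R F (x y) - integral {x y..x y + h'} F) - (\<Sum>y\<in>G. h' *\<^sub>R F (x y) - integral {(x y - h')..(x y - h') + h'} F)"
        unfolding sum_subtractf[symmetric] by (intro sum.cong) (auto simp: D'_def)
      also have "norm \<dots> \<le> \<eta> / 8 + \<eta> / 8"
        by (rule order_trans[OF norm_triangle_ineq4 add_mono[OF H2 H1]])
      finally show ?thesis by simp
    qed
    have Dgood: "norm (D y - D' y) \<le> 5 * K * \<kappa> * h + 4 * \<sigma> y" if y: "y \<in> G" for y
    proof -
      have yY: "y \<in> Y" using y GN by auto
      note xy = x[OF y]
      have "D y - D' y = (P y - P (x y)) + (P y - P (x y)) + (P (x y - h') - P (y - h)) - (P (y + h) - P (x y + h'))"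
      proof -
        have "integral {y - h..y} F = P y - P (y - h)" "integral {y..y + h} F = P (y + h) - P y"
          using sub[OF yY] h by (auto intro!: Pd)
        moreover have "integral {x y - h'..x y} F = P (x y) - P (x y - h')" "integral {x y..x y + h'} F = P (x y + h') - P (x y)"
          using sub[OF yY] xy kh h h'(1) h'eq by (auto intro!: Pd)
        ultimately show ?thesis by (simp add: D_def D'_def)
      qed
      also have "norm \<dots> \<le> (K * (y - x y) + \<sigma> y) + (K * (y - x y) + \<sigma> y) + (K * (x y - h' - (y - h)) + \<sigma> y) + (K * (y + h - (x y + h')) + \<sigma> y)"
      proof -
        have b1: "norm (P y - P (x y)) \<le> K * (y - x y) + \<sigma> y"
          by (rule Pb[OF yY]) (use xy kh h h'eq in linarith)+
        have b2: "norm (P (x y - h') - P (y - h)) \<le> K * (x y - h' - (y - h)) + \<sigma> y"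
          by (rule Pb[OF yY]) (use xy kh h h'eq in linarith)+
        have b3: "norm (P (y + h) - P (x y + h')) \<le> K * (y + h - (x y + h')) + \<sigma> y"
          by (rule Pb[OF yY]) (use xy kh h h'eq in linarith)+
        have "norm (A + A + C - D) \<le> norm A + norm A + norm C + norm D" for A C D :: 'a
          using norm_triangle_ineq4[of "A + A + C" D] norm_triangle_ineq[of "A + A" C] norm_triangle_ineq[of A A] by linarith
        from order_trans[OF this] b1 b2 b3 show ?thesis by (meson add_mono)
      qed
      also have "\<dots> = K * (2 * (y - x y) + 2 * (h - h')) + 4 * \<sigma> y" by (simp add: algebra_simps)
      also have "\<dots> \<le> K * (5 * (\<kappa> * h)) + 4 * \<sigma> y"
        using xy K kh unfolding h'eq by (intro add_mono mult_left_mono) auto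
      finally show ?thesis by (simp add: mult_ac)
    qed
    have Dbad: "norm (D y) \<le> 2 * K * h + 2 * \<sigma> y" if y: "y \<in> N" for y
    proof -
      have yY: "y \<in> Y" using y GN by auto
      have "D y = (P y - P (y - h)) - (P (y + h) - P y)"
        unfolding D_def using sub[OF yY] h by (simp add: Pd)
      also have "norm \<dots> \<le> (K * (y - (y - h)) + \<sigma> y) + (K * (y + h - y) + \<sigma> y)"
        by (intro order_trans[OF norm_triangle_ineq4] add_mono Pb[OF yY]) (use h in auto)
      finally show ?thesis by simp
    qed
    have cardN: "real (card N) * (\<kappa> * h) \<le> \<rho>"
    proof -
      have NU: "{y - \<kappa> * h<..<y} \<subseteq> U" if y: "y \<in> N" for y
      proof -
        \<comment> \<open>An open interval that misses \<open>E\<close> misses its closure. It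
          therefore lies in the open set \<open>U\<close>, and disjoint intervals of this kind are
          counted by the measure of \<open>U\<close>.\<close>
        have "{y - \<kappa> * h<..<y} \<inter> E = {}" using y by (auto simp: N_def G_def)
        then have "{y - \<kappa> * h<..<y} \<inter> closure E = {}" by (simp add: open_Int_closure_eq_empty)
        moreover have "a \<le> y - \<kappa> * h" "y \<le> b" using sub[OF subsetD[OF GN(4) y]] kh h(1) by linarith+
        then have "{y - \<kappa> * h<..<y} \<subseteq> {a<..<b}" by auto
        ultimately show ?thesis by (auto simp: U_def)
      qed
      have "(\<Sum>y\<in>N. measure lborel {y - \<kappa> * h<..<y}) = measure lborel (\<Union>y\<in>N. {y - \<kappa> * h<..<y})"
      proof (rule measure_finite_Union[symmetric, OF fin(2)])
        have "{y - \<kappa> * h<..<y} \<inter> {y' - \<kappa> * h<..<y'} = {}" if "y \<in> N" "y' \<in> N" "y \<noteq> y'" for y y'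
          using sep[of y y'] that GN kh by (auto simp: abs_if split: if_splits)
        then show "disjoint_family_on (\<lambda>y. {y - \<kappa> * h<..<y}) N" by (auto simp: disjoint_family_on_def)
      qed (use kh in auto)
      also have "\<dots> \<le> measure lborel U"
      proof (rule measure_mono_fmeasurable)
        show "(\<Union>y\<in>N. {y - \<kappa> * h<..<y}) \<subseteq> U" using NU by blast
        have "emeasure lborel U \<le> emeasure lborel {a..b}" by (rule emeasure_mono) (auto simp: U_def)
        also have "\<dots> < \<infinity>" using ab by simp
        finally show "U \<in> fmeasurable lborel" by (auto simp: fmeasurable_def U_def)
      qed (auto intro!: borel_open)
      also have "\<dots> \<le> \<rho>" using U by simp
      finally show ?thesis using kh by simp
    qed
    have "sum D Y = (sum D' G + (\<Sum>y\<in>G. D y - D' y)) + sum D N"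
      using fin GN by (simp add: sum_subtractf sum.union_disjoint)
    also have "norm \<dots> \<le> (\<eta> / 4 + (\<Sum>y\<in>G. 5 * K * \<kappa> * h + 4 * \<sigma> y)) + (\<Sum>y\<in>N. 2 * K * h + 2 * \<sigma> y)"
      by (intro norm_triangle_mono HD sum_norm_le Dgood Dbad)
    also have "\<dots> \<le> \<eta> / 4 + \<eta> / 4 + \<eta> / 4 + \<eta> / 4"
    proof -
      have "(\<Sum>y\<in>G. 5 * K * \<kappa> * h + 4 * \<sigma> y) + (\<Sum>y\<in>N. 2 * K * h + 2 * \<sigma> y)
         \<le> (\<Sum>y\<in>G. 5 * K * \<kappa> * h + 4 * \<sigma> y) + (\<Sum>y\<in>N. 2 * K * h + 4 * \<sigma> y)"
        using \<sigma>0 GN by (intro add_left_mono sum_mono) auto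
      also have "\<dots> = real (card G) * (5 * K * \<kappa> * h) + real (card N) * (2 * K * h) + 4 * (\<Sum>y\<in>Y. \<sigma> y)"
        using fin GN by (simp add: sum.distrib sum_distrib_left[symmetric] sum_distrib_right[symmetric] sum.union_disjoint algebra_simps)
      also have "real (card G) * (5 * K * \<kappa> * h) \<le> real (card Y) * (5 * K * \<kappa> * h)"
        using K kh GN card_mono[OF Y GN(3)] h \<kappa> by (intro mult_right_mono) auto
      also have "real (card Y) * (5 * K * \<kappa> * h) = (real (card Y) * (2 * h)) * (5 * K * \<kappa> / 2)" by simp
      also have "\<dots> \<le> (b - a) * (5 * K * \<kappa> / 2)" using cardY K \<kappa> by (intro mult_right_mono) auto
      also have "\<dots> \<le> \<eta> / 4" using \<kappa>2 by (simp add: algebra_simps)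
      also have "real (card N) * (2 * K * h) = (real (card N) * (\<kappa> * h)) * (2 * K / \<kappa>)" using \<kappa> by simp
      also have "\<dots> \<le> \<rho> * (2 * K / \<kappa>)" using cardN K \<kappa> by (intro mult_right_mono) auto
      also have "\<dots> = \<eta> / 4" using K \<kappa> by (simp add: \<rho>_def)
      also have "4 * (\<Sum>y\<in>Y. \<sigma> y) \<le> \<eta> / 4" using \<sigma>sum by simp
      finally show ?thesis by simp
    qed
    finally show "norm (\<Sum>y\<in>Y. integral {y - h..y} F - integral {y..y + h} F) \<le> \<eta>" by (simp add: D_def)
  qed simp
qed

section \<open>Cancellation over full periods\<close>

lemma cmod_cis_diff_le: "cmod (cis x - cis y) \<le> \<bar>x - y\<bar>"
proof -
  have "cis x - cis y = cis y * (exp (\<i> * of_real (x - y)) - 1)"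
    by (simp add: cis_conv_exp exp_add[symmetric] right_diff_distrib algebra_simps)
  also have "cmod \<dots> = cmod (exp (\<i> * of_real (x - y)) - 1)" by (simp add: norm_mult)
  also have "\<dots> = cmod (cis (x - y) - 1)" by (simp add: cis_conv_exp)
  also have "\<dots> = 2 * \<bar>sin ((x - y) / 2)\<bar>"
  proof -
    have "(cmod (cis (x - y) - 1))^2 = (cos (x - y) - 1)^2 + (sin (x - y))^2" by (simp add: cmod_power2)
    also have "\<dots> = 2 - 2 * cos (x - y)"
      using sin_cos_squared_add[of "x - y"] by (simp add: power2_eq_square algebra_simps)
    also have "\<dots> = (2 * \<bar>sin ((x - y) / 2)\<bar>)^2"
    proof -
      define u where "u = (x - y) / 2"
      have "x - y = 2 * u" by (simp add: u_def)
      then have "cos (x - y) = 1 - 2 * (sin u)^2" by (simp only: cos_double_sin)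
      then show ?thesis by (simp add: u_def[symmetric] power_mult_distrib)
    qed
    finally show ?thesis by (rule power2_eq_imp_eq) auto
  qed
  also have "\<dots> \<le> 2 * \<bar>(x - y) / 2\<bar>" by (intro mult_left_mono abs_sin_x_le_abs_x) auto
  finally show ?thesis by simp
qed

lemma integral_equal_cells:
  fixes g :: "real \<Rightarrow> 'a::banach"
  assumes "g integrable_on {p..p + real m * d}" "d \<ge> 0"
  shows "integral {p..p + real m * d} g = (\<Sum>i<m. integral {p + real i * d..p + real i * d + d} g)"
  using assms(1)
proof (induction m)
  case (Suc m)
  have e: "p + real (Suc m) * d = p + real m * d + d" by (simp add: algebra_simps)
  have i: "g integrable_on {p..p + real m * d + d}" using Suc.prems unfolding e .
  have "integral {p..p + real m * d} g + integral {p + real m * d..p + real m * d + d} g = integral {p..p + real m * d + d} g"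
    using assms(2) by (intro integral_combine_interval i) auto
  moreover have "integral {p..p + real m * d} g = (\<Sum>i<m. integral {p + real i * d..p + real i * d + d} g)"
    using assms(2) by (intro Suc.IH integrable_subinterval_real[OF i]) auto
  ultimately show ?case unfolding e by simp
qed simp

lemma Abel_partial_sums:
  fixes v :: "nat \<Rightarrow> 'a::complex_banach"
  shows "(\<Sum>j<Suc m. z j *\<^sub>C v j) = (\<Sum>j<m. (\<Sum>i\<le>j. z i) *\<^sub>C (v j - v (Suc j))) + (\<Sum>i\<le>m. z i) *\<^sub>C v m"
  by (induction m) (simp_all add: scaleC_add_left scaleC.diff_right algebra_simps)

lemma sum_roots_of_unity_period:
  assumes "N \<ge> 2"
  shows "(\<Sum>j<N. cis (real j * (2 * pi / real N))) = 0"
proof -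
  let ?w = "cis (2 * pi / real N)"
  have "?w \<noteq> 1"
  proof
    assume "?w = 1"
    then have "cos (2 * pi / real N) = 1" by (metis Re_complex_of_real cis.sel(1) of_real_1)
    then obtain k :: int where "2 * pi / real N = of_int k * 2 * pi" by (auto simp: cos_one_2pi_int)
    then have "1 = of_int k * real N" using assms by (simp add: field_simps)
    then have "1 = k * int N" by (metis of_int_1 of_int_eq_iff of_int_mult of_int_of_nat_eq)
    then have "int N dvd 1" by (metis dvd_triv_right)
    then show False using assms by simp
  qed
  moreover have "?w ^ N = 1"
  proof -
    have "?w ^ N = cis (real N * (2 * pi / real N))" by (rule Complex.DeMoivre)
    also have "real N * (2 * pi / real N) = 2 * pi" using assms by simp
    finally show ?thesis by simp
  qed
  moreover have "(\<Sum>j<N. cis (real j * (2 * pi / real N))) = (\<Sum>j<N. ?w ^ j)" by (simp add: Complex.DeMoivre)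
  ultimately show ?thesis using geometric_sum[of ?w N] by simp
qed

lemma Riemann_Lebesgue_interval:
  fixes F :: "real \<Rightarrow> 'a::complex_banach" and w :: "real \<Rightarrow> real"
  assumes Fi: "F integrable_on {a..b}" and Fn: "(\<lambda>s. norm (F s)) integrable_on {a..b}"
    and w: "continuous_on {a..b} w" and ab: "a < b"
  shows "((\<lambda>t. integral {a..b} (\<lambda>s. (of_real (w s) * cis (t * s)) *\<^sub>C F s)) \<longlongrightarrow> 0) at_top"
proof (rule tendstoI)
  fix e :: real assume e: "e > 0"
  obtain W where W: "W > 0" "\<And>s. s \<in> {a..b} \<Longrightarrow> \<bar>w s\<bar> \<le> W"
    using compact_imp_bounded[OF compact_continuous_image[OF w compact_Icc]] by (auto simp: bounded_pos)
  define Z where "Z = integral {a..b} (\<lambda>s. norm (F s)) + 1"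
  have Z0: "integral {a..b} (\<lambda>s. norm (F s)) \<ge> 0" by (intro Henstock_Kurzweil_Integration.integral_nonneg Fn) auto
  then have Z: "Z > 0" "integral {a..b} (\<lambda>s. norm (F s)) \<le> Z" by (auto simp: Z_def)
  obtain N0 :: nat where N0: "2 * pi * W / (e / (5 * Z)) \<le> real N0" using real_arch_simple by blast
  \<comment> \<open>With N >= 3, pairs of cells from different periods are separated, since 2 h < N
    h.\<close>
  define N where "N = N0 + 3"
  have N: "N \<ge> 3" and NW: "W * (2 * pi / real N) \<le> e / (5 * Z)"
  proof -
    have eZ: "e / (5 * Z) > 0" using e Z by simp
    have "2 * pi * W \<le> real N0 * (e / (5 * Z))" using N0 by (simp only: pos_divide_le_eq[OF eZ])
    also have "\<dots> \<le> real N * (e / (5 * Z))" using eZ by (intro mult_right_mono) (auto simp: N_def)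
    finally have "2 * pi * W \<le> e / (5 * Z) * real N" by (simp only: mult.commute)
    then have "2 * pi * W / real N \<le> e / (5 * Z)" by (simp only: pos_divide_le_eq N_def of_nat_0_less_iff zero_less_numeral add_pos_pos add_nonneg_pos zero_le)
    then show "W * (2 * pi / real N) \<le> e / (5 * Z)" by (simp only: times_divide_eq_right mult.commute mult.left_commute)
  qed (simp add: N_def)
  have "uniformly_continuous_on {a..b} w" by (rule compact_uniformly_continuous[OF w compact_Icc])
  then obtain \<delta> where \<delta>: "\<delta> > 0" "\<And>s s'. s \<in> {a..b} \<Longrightarrow> s' \<in> {a..b} \<Longrightarrow> \<bar>s' - s\<bar> < \<delta> \<Longrightarrow> \<bar>w s' - w s\<bar> < e / (5 * Z)"
    using e Z unfolding uniformly_continuous_on_def dist_real_def by (metis divide_pos_pos mult_pos_pos zero_less_numeral)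
  \<comment> \<open>Abel summation produces N - 1 differences with partial sums of modulus at most
    N, and the weights contribute 4 W. This choice of \<eta> makes the total at most e / 5.\<close>
  define \<eta> where "\<eta> = e / (20 * W * real N ^ 2)"
  have \<eta>: "\<eta> > 0" using e W N by (simp add: \<eta>_def)
  obtain h0 where h0: "h0 > 0"
    "\<And>h Y. 0 < h \<Longrightarrow> h < h0 \<Longrightarrow> finite Y \<Longrightarrow> (\<And>y. y \<in> Y \<Longrightarrow> a \<le> y - h \<and> y + h \<le> b) \<Longrightarrow>
       (\<And>y y'. y \<in> Y \<Longrightarrow> y' \<in> Y \<Longrightarrow> y \<noteq> y' \<Longrightarrow> 2 * h < \<bar>y - y'\<bar>) \<Longrightarrow>
       norm (\<Sum>y\<in>Y. integral {y - h..y} F - integral {y..y + h} F) \<le> \<eta>"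
    using adjacent_cells_integral_difference[OF Fi Fn \<eta>] by blast
  obtain \<delta>2 where \<delta>2: "\<delta>2 > 0" "\<And>c. c \<in> {a..b} \<Longrightarrow> b - c < \<delta>2 \<Longrightarrow> W * integral {c..b} (\<lambda>s. norm (F s)) \<le> e / 5"
  proof -
    have "continuous_on {a..b} (\<lambda>x. integral {a..x} (\<lambda>s. norm (F s)))" by (rule indefinite_integral_continuous_1[OF Fn])
    then have "\<exists>d>0. \<forall>c\<in>{a..b}. dist c b < d \<longrightarrow> dist (integral {a..c} (\<lambda>s. norm (F s))) (integral {a..b} (\<lambda>s. norm (F s))) < e / (5 * W)"
      using ab e W unfolding continuous_on_iff by (metis atLeastAtMost_iff divide_pos_pos less_imp_le mult_pos_pos order_refl zero_less_numeral)
    then obtain d where d: "d > 0" "\<And>c. c \<in> {a..b} \<Longrightarrow> dist c b < d \<Longrightarrow> dist (integral {a..c} (\<lambda>s. norm (F s))) (integral {a..b} (\<lambda>s. norm (F s))) < e / (5 * W)" by blast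
    have "W * integral {c..b} (\<lambda>s. norm (F s)) \<le> e / 5" if c: "c \<in> {a..b}" "b - c < d" for c
    proof -
      have "integral {a..c} (\<lambda>s. norm (F s)) + integral {c..b} (\<lambda>s. norm (F s)) = integral {a..b} (\<lambda>s. norm (F s))"
        using c by (intro integral_combine_interval Fn) auto
      then have "integral {c..b} (\<lambda>s. norm (F s)) < e / (5 * W)"
        using d(2)[of c] c by (auto simp: dist_real_def)
      then show ?thesis using W by (simp add: field_simps)
    qed
    then show thesis using that[of d] d(1) by blast
  qed
  define t0 where "t0 = max (2 * pi / (real N * h0)) (max (2 * pi / \<delta>) (2 * pi / \<delta>2)) + 1"
  have "dist (integral {a..b} (\<lambda>s. (of_real (w s) * cis (t * s)) *\<^sub>C F s)) 0 < e" if t: "t \<ge> t0" for t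
  proof (cases "(\<lambda>s. (of_real (w s) * cis (t * s)) *\<^sub>C F s) integrable_on {a..b}")
    \<comment> \<open>In this case the integral is 0 by convention.\<close>
    case False
    then show ?thesis using e by (simp add: not_integrable_integral)
  next
    case int: True
    have t1: "2 * pi / (real N * h0) < t" "2 * pi / \<delta> < t" "2 * pi / \<delta>2 < t" using t by (auto simp: t0_def)
    have "0 < 2 * pi / \<delta>" using \<delta> by simp
    then have tpos: "t > 0" using t1(2) by linarith
    define d where "d = 2 * pi / t"
    define h where "h = d / real N"
    have d: "d > 0" "d < \<delta>" "d < \<delta>2" using t1 tpos \<delta> \<delta>2 by (auto simp: d_def field_simps)
    have h: "h > 0" "h < h0" "d = real N * h" using t1(1) tpos d N h0 by (auto simp: h_def d_def field_simps)
    have th: "t * h = 2 * pi / real N" "t * d = 2 * pi" using tpos by (auto simp: h_def d_def)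
    define n where "n = nat \<lfloor>(b - a) / d\<rfloor>"
    have n: "real n \<le> (b - a) / d" "(b - a) / d < real n + 1"
      using ab d by (auto simp: n_def)
    \<comment> \<open>Whole periods fill [a, c]. The incomplete one, [c, b], is shorter than d and
      is handled by continuity of the indefinite integral of the norm.\<close>
    define c where "c = a + real n * d"
    have c: "a \<le> c" "c \<le> b" "b - c < d" using n d by (auto simp: c_def field_simps)
    define \<psi> where "\<psi> = (\<lambda>s. of_real (w s) * cis (t * s))"
    define p where "p = (\<lambda>l. a + real l * d)"
    define q where "q = (\<lambda>l j. p l + real j * h)"
    have pb: "a \<le> p l" "p l + d \<le> c" if "l < n" for l
    proof -
      show "a \<le> p l" using d by (simp add: p_def)
      have "(real l + 1) * d \<le> real n * d" using that d by (intro mult_right_mono) auto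
      then show "p l + d \<le> c" by (simp add: p_def c_def algebra_simps)
    qed
    have qb: "p l \<le> q l j" "q l j + h \<le> p l + d" if "j < N" for l j
    proof -
      show "p l \<le> q l j" using h by (simp add: q_def)
      have "(real j + 1) * h \<le> real N * h" using that h by (intro mult_right_mono) auto
      then show "q l j + h \<le> p l + d" by (simp add: q_def h(3) algebra_simps)
    qed
    have int': "(\<lambda>s. \<psi> s *\<^sub>C F s) integrable_on {u..v}" if "a \<le> u" "v \<le> b" for u v
      using int that unfolding \<psi>_def by (intro integrable_subinterval_real[OF int]) auto
    have Fi': "F integrable_on {u..v}" and Fn': "(\<lambda>s. norm (F s)) integrable_on {u..v}" if "a \<le> u" "v \<le> b" for u v
      using that by (auto intro: integrable_subinterval_real[OF Fi] integrable_subinterval_real[OF Fn])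
    have decomp: "integral {a..c} g = (\<Sum>l<n. \<Sum>j<N. integral {q l j..q l j + h} g)"
      if g: "\<And>u v. a \<le> u \<Longrightarrow> v \<le> b \<Longrightarrow> g integrable_on {u..v}" for g :: "real \<Rightarrow> 'b::banach"
    proof -
      have "integral {a..c} g = (\<Sum>l<n. integral {p l..p l + d} g)"
        unfolding c_def p_def using d c by (intro integral_equal_cells g) (auto simp: c_def)
      also have "\<dots> = (\<Sum>l<n. \<Sum>j<N. integral {q l j..q l j + h} g)"
      proof (intro sum.cong refl)
        fix l assume "l \<in> {..<n}"
        then show "integral {p l..p l + d} g = (\<Sum>j<N. integral {q l j..q l j + h} g)"
          unfolding q_def h(3) using h pb[of l] c by (intro integral_equal_cells g) (auto simp: h(3))
      qed
      finally show ?thesis .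
    qed
    define z where "z = (\<lambda>l j. of_real (w (p l)) * cis (t * q l j))"
    define \<Phi> where "\<Phi> = (\<lambda>l j. integral {q l j..q l j + h} F)"
    have cell: "norm (integral {q l j..q l j + h} (\<lambda>s. \<psi> s *\<^sub>C F s) - z l j *\<^sub>C \<Phi> l j) \<le> 2 * e / (5 * Z) * integral {q l j..q l j + h} (\<lambda>s. norm (F s))"
      if l: "l < n" and j: "j < N" for l j
    proof -
      have I: "a \<le> q l j" "q l j + h \<le> b" using pb[OF l] qb[OF j, of l] c by auto
      have "integral {q l j..q l j + h} (\<lambda>s. \<psi> s *\<^sub>C F s) - z l j *\<^sub>C \<Phi> l j = integral {q l j..q l j + h} (\<lambda>s. \<psi> s *\<^sub>C F s - z l j *\<^sub>C F s)"
        unfolding \<Phi>_def integral_scaleC_right[OF Fi'[OF I], symmetric]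
        using I int' integrable_linear[OF Fi'[OF I] scaleC.bounded_linear_right[of "z l j"]]
        by (intro integral_diff[symmetric]) (auto simp: o_def)
      also have "norm \<dots> \<le> integral {q l j..q l j + h} (\<lambda>s. 2 * e / (5 * Z) * norm (F s))"
      proof (rule integral_norm_bound_integral)
        show "(\<lambda>s. \<psi> s *\<^sub>C F s - z l j *\<^sub>C F s) integrable_on {q l j..q l j + h}"
          using I int' integrable_linear[OF Fi'[OF I] scaleC.bounded_linear_right[of "z l j"]]
          by (intro integrable_diff) (auto simp: o_def)
        show "(\<lambda>s. 2 * e / (5 * Z) * norm (F s)) integrable_on {q l j..q l j + h}"
          by (intro integrable_on_mult_right Fn' I)
        fix s assume s: "s \<in> {q l j..q l j + h}"
        have sab: "s \<in> {a..b}" "p l \<in> {a..b}" using s I pb[OF l] qb[OF j, of l] c d by auto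
        have "\<psi> s - z l j = of_real (w s - w (p l)) * cis (t * s) + of_real (w (p l)) * (cis (t * s) - cis (t * q l j))"
          by (simp add: \<psi>_def z_def algebra_simps)
        also have "cmod \<dots> \<le> e / (5 * Z) * 1 + W * (2 * pi / real N)"
        proof (rule norm_triangle_mono)
          have "\<bar>s - p l\<bar> < \<delta>" using s qb[OF j, of l] d h by auto
          then have "\<bar>w s - w (p l)\<bar> < e / (5 * Z)" using sab \<delta>(2) by blast
          then show "cmod (of_real (w s - w (p l)) * cis (t * s)) \<le> e / (5 * Z) * 1"
            by (simp add: norm_mult del: of_real_diff)
          have "cmod (cis (t * s) - cis (t * q l j)) \<le> \<bar>t * s - t * q l j\<bar>" by (rule cmod_cis_diff_le)
          also have "\<dots> = t * (s - q l j)" using s tpos by (simp add: right_diff_distrib[symmetric])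
          also have "\<dots> \<le> t * h" using s tpos by (intro mult_left_mono) auto
          finally show "cmod (of_real (w (p l)) * (cis (t * s) - cis (t * q l j))) \<le> W * (2 * pi / real N)"
            unfolding norm_mult th using W sab by (intro mult_mono) auto
        qed
        also have "\<dots> \<le> 2 * e / (5 * Z)" using NW by simp
        finally have "cmod (\<psi> s - z l j) \<le> 2 * e / (5 * Z)" .
        then have "norm ((\<psi> s - z l j) *\<^sub>C F s) \<le> 2 * e / (5 * Z) * norm (F s)"
          unfolding norm_scaleC by (intro mult_right_mono) auto
        then show "norm (\<psi> s *\<^sub>C F s - z l j *\<^sub>C F s) \<le> 2 * e / (5 * Z) * norm (F s)"
          by (simp add: scaleC.diff_left)
      qed
      also have "\<dots> = 2 * e / (5 * Z) * integral {q l j..q l j + h} (\<lambda>s. norm (F s))" by (rule integral_mult_right)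
      finally show ?thesis .
    qed
    have main: "norm (\<Sum>l<n. \<Sum>j<N. z l j *\<^sub>C \<Phi> l j) \<le> e / 5"
    proof -
      obtain m where m: "N = Suc m" using N by (cases N) auto
      define S where "S = (\<lambda>j. \<Sum>i\<le>j. cis (real i * (2 * pi / real N)))"
      have Sm: "S m = 0" using sum_roots_of_unity_period[of N] N unfolding S_def m lessThan_Suc_atMost by simp
      have Sb: "cmod (S j) \<le> real N" if "j < m" for j
      proof -
        have "cmod (S j) \<le> (\<Sum>i\<le>j. 1)" unfolding S_def by (intro sum_norm_le) simp
        then show ?thesis using that m by simp
      qed
      have inner: "(\<Sum>j<N. z l j *\<^sub>C \<Phi> l j) = (\<Sum>j<m. S j *\<^sub>C ((of_real (w (p l)) * cis (t * p l)) *\<^sub>C (\<Phi> l j - \<Phi> l (Suc j))))" for l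
      proof -
        have "z l j = (of_real (w (p l)) * cis (t * p l)) * cis (real j * (2 * pi / real N))" for j
        proof -
          have "t * q l j = t * p l + real j * (t * h)" by (simp add: q_def algebra_simps)
          then show ?thesis unfolding z_def th by (simp add: cis_mult)
        qed
        then have "(\<Sum>j<N. z l j *\<^sub>C \<Phi> l j) = (of_real (w (p l)) * cis (t * p l)) *\<^sub>C (\<Sum>j<Suc m. cis (real j * (2 * pi / real N)) *\<^sub>C \<Phi> l j)"
          by (simp add: scaleC.sum_right scaleC_scaleC m del: sum.lessThan_Suc)
        also have "\<dots> = (of_real (w (p l)) * cis (t * p l)) *\<^sub>C (\<Sum>j<m. S j *\<^sub>C (\<Phi> l j - \<Phi> l (Suc j)))"
        proof -
          have "(\<Sum>i\<le>j. cis (real i * (2 * pi / real N))) = S j" for j by (simp only: S_def)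
          then show ?thesis by (simp only: Abel_partial_sums Sm scaleC.zero_left add_0_right)
        qed
        finally show ?thesis by (simp add: scaleC.sum_right scaleC_scaleC mult.commute)
      qed
      \<comment> \<open>For a fixed position j, the cells j and j + 1 of all periods form one
        separated family of pairs, to which the bound for adjacent cells applies together with all
        its subfamilies.\<close>
      have pairs: "norm (\<Sum>l<n. (of_real (w (p l)) * cis (t * p l)) *\<^sub>C (\<Phi> l j - \<Phi> l (Suc j))) \<le> 4 * W * \<eta>" if j: "j < m" for j
      proof (rule norm_complex_weighted_sum_le)
        show "cmod (of_real (w (p l)) * cis (t * p l)) \<le> W" if "l \<in> {..<n}" for l
          using W(2)[of "p l"] pb[of l] that c d by (auto simp: norm_mult)
        fix B assume B: "B \<subseteq> {..<n}"
        have finB: "finite B" using B finite_subset by auto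
        define y where "y = (\<lambda>l. q l (Suc j))"
        have ydist: "y l - y l' = (real l - real l') * d" for l l' by (simp add: y_def q_def p_def algebra_simps)
        have sepl: "2 * h < \<bar>y l - y l'\<bar>" if "l \<noteq> l'" for l l'
        proof -
          have "1 \<le> \<bar>real l - real l'\<bar>" using that by (auto simp: abs_if)
          then have "1 * d \<le> \<bar>real l - real l'\<bar> * d" using d by (intro mult_right_mono) auto
          then have "d \<le> \<bar>y l - y l'\<bar>" unfolding ydist using d by (simp add: abs_mult)
          moreover have "2 * h < real N * h" using N h by (intro mult_strict_right_mono) auto
          ultimately show ?thesis using h(3) by simp
        qed
        have inj: "inj_on y B" using sepl h(1) by (fastforce intro!: inj_onI)
        have "(\<Sum>l\<in>B. \<Phi> l j - \<Phi> l (Suc j)) = (\<Sum>l\<in>B. integral {y l - h..y l} F - integral {y l..y l + h} F)"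
          by (intro sum.cong refl) (simp add: \<Phi>_def y_def q_def algebra_simps)
        also have "\<dots> = (\<Sum>y\<in>y ` B. integral {y - h..y} F - integral {y..y + h} F)"
          by (simp add: sum.reindex[OF inj])
        also have "norm \<dots> \<le> \<eta>"
        proof (rule h0(2)[OF h(1,2)])
          show "finite (y ` B)" using finB by simp
          show "a \<le> v - h \<and> v + h \<le> b" if "v \<in> y ` B" for v
          proof -
            obtain l where l: "l < n" "v = y l" using \<open>v \<in> y ` B\<close> B by auto
            have "v - h = q l j" by (simp add: l y_def q_def algebra_simps)
            then show ?thesis using qb[of j l] qb[of "Suc j" l] pb[OF l(1)] j m c l(2) by (auto simp: y_def)
          qed
          show "2 * h < \<bar>v - v'\<bar>" if "v \<in> y ` B" "v' \<in> y ` B" "v \<noteq> v'" for v v'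
          proof -
            from that obtain l l' where "v = y l" "v' = y l'" by blast
            then show ?thesis using that(3) sepl[of l l'] by auto
          qed
        qed
        finally show "norm (\<Sum>l\<in>B. \<Phi> l j - \<Phi> l (Suc j)) \<le> \<eta>" .
      qed (use W in auto)
      have "(\<Sum>l<n. \<Sum>j<N. z l j *\<^sub>C \<Phi> l j) = (\<Sum>j<m. S j *\<^sub>C (\<Sum>l<n. (of_real (w (p l)) * cis (t * p l)) *\<^sub>C (\<Phi> l j - \<Phi> l (Suc j))))"
        unfolding inner scaleC.sum_right by (rule sum.swap)
      also have "norm \<dots> \<le> (\<Sum>j<m. real N * (4 * W * \<eta>))"
        using pairs Sb by (intro sum_norm_le) (auto simp: norm_scaleC intro!: mult_mono)
      also have "\<dots> = real m * (real N * (4 * W * \<eta>))" by simp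
      also have "\<dots> \<le> real N * (real N * (4 * W * \<eta>))"
        using W \<eta> m by (intro mult_right_mono) auto
      also have "\<dots> = e / 5" using W N by (simp add: \<eta>_def power2_eq_square)
      finally show ?thesis .
    qed
    have "integral {a..b} (\<lambda>s. \<psi> s *\<^sub>C F s) = integral {a..c} (\<lambda>s. \<psi> s *\<^sub>C F s) + integral {c..b} (\<lambda>s. \<psi> s *\<^sub>C F s)"
      using c int' by (intro integral_combine_interval[symmetric]) auto
    also have "integral {a..c} (\<lambda>s. \<psi> s *\<^sub>C F s) = (\<Sum>l<n. \<Sum>j<N. (integral {q l j..q l j + h} (\<lambda>s. \<psi> s *\<^sub>C F s) - z l j *\<^sub>C \<Phi> l j)) + (\<Sum>l<n. \<Sum>j<N. z l j *\<^sub>C \<Phi> l j)"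
      by (subst decomp[OF int']) (simp_all add: sum_subtractf)
    also have "norm (\<dots> + integral {c..b} (\<lambda>s. \<psi> s *\<^sub>C F s)) \<le> 2 * e / 5 + e / 5 + e / 5"
    proof (intro norm_triangle_mono main)
      have "norm (\<Sum>l<n. \<Sum>j<N. (integral {q l j..q l j + h} (\<lambda>s. \<psi> s *\<^sub>C F s) - z l j *\<^sub>C \<Phi> l j))
         \<le> (\<Sum>l<n. \<Sum>j<N. 2 * e / (5 * Z) * integral {q l j..q l j + h} (\<lambda>s. norm (F s)))"
        by (intro sum_norm_le cell) auto
      also have "\<dots> = 2 * e / (5 * Z) * integral {a..c} (\<lambda>s. norm (F s))"
        by (subst decomp[OF Fn']) (simp_all add: sum_distrib_left)
      also have "\<dots> \<le> 2 * e / (5 * Z) * Z"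
      proof (intro mult_left_mono)
        have "integral {a..c} (\<lambda>s. norm (F s)) \<le> integral {a..b} (\<lambda>s. norm (F s))"
          using c by (intro integral_subset_le Fn') auto
        then show "integral {a..c} (\<lambda>s. norm (F s)) \<le> Z" using Z by simp
      qed (use e Z in auto)
      also have "\<dots> = 2 * e / 5" using Z by simp
      finally show "norm (\<Sum>l<n. \<Sum>j<N. (integral {q l j..q l j + h} (\<lambda>s. \<psi> s *\<^sub>C F s) - z l j *\<^sub>C \<Phi> l j)) \<le> 2 * e / 5" .
      have "norm (integral {c..b} (\<lambda>s. \<psi> s *\<^sub>C F s)) \<le> integral {c..b} (\<lambda>s. W * norm (F s))"
      proof (rule integral_norm_bound_integral)
        fix s assume "s \<in> {c..b}"
        then show "norm (\<psi> s *\<^sub>C F s) \<le> W * norm (F s)"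
          unfolding norm_scaleC \<psi>_def using W(2)[of s] c by (intro mult_right_mono) (auto simp: norm_mult)
      qed (use c int' Fn' in \<open>auto intro!: integrable_on_mult_right\<close>)
      also have "\<dots> = W * integral {c..b} (\<lambda>s. norm (F s))" by (rule integral_mult_right)
      also have "\<dots> \<le> e / 5" using \<delta>2(2)[of c] c d by auto
      finally show "norm (integral {c..b} (\<lambda>s. \<psi> s *\<^sub>C F s)) \<le> e / 5" .
    qed
    finally show ?thesis using e by (simp add: \<psi>_def)
  qed
  then show "\<forall>\<^sub>F t in at_top. dist (integral {a..b} (\<lambda>s. (of_real (w s) * cis (t * s)) *\<^sub>C F s)) 0 < e"
    by (auto simp: eventually_at_top_linorder)
qed

section \<open>Cutoffs and convergence to zero\<close>

text \<open>In (b), each derivative of \<open>F\<close> costs a factor \<open>m(\<epsilon>)\<close>, which the factor \<open>1 / t\<close> absorbs, whereas a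
  derivative of the cutoff costs \<open>1 / \<epsilon>\<close>, which may be exponentially large in \<open>t\<close>. Hence a piecewise
  linear cutoff, whose kinks only contribute \<open>O(1 / t)\<close>.\<close>

definition trapezoid :: "real \<Rightarrow> nat \<Rightarrow> real \<Rightarrow> real" where
  "trapezoid \<epsilon> i s = (if i = 0 then 2 - s / \<epsilon> else if i = 1 then - 1 / \<epsilon> else 0)"

lemma trapezoid_simps:
  "trapezoid \<epsilon> 0 = (\<lambda>s. 2 - s / \<epsilon>)" "trapezoid \<epsilon> (Suc 0) = (\<lambda>s. - 1 / \<epsilon>)" "trapezoid \<epsilon> (Suc (Suc i)) = (\<lambda>s. 0)"
  by (rule ext, simp add: trapezoid_def)+

text \<open>The constant 16 is dictated by the slope: 1 / \<epsilon> <= 16 \<epsilon>^3 / s^4 holds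
  exactly up to s = 2 \<epsilon>.\<close>

lemma low_cutoff_trapezoid:
  assumes \<epsilon>: "0 < \<epsilon>" and R: "2 * \<epsilon> \<le> R" "1 \<le> R"
  shows "low_cutoff 16 \<epsilon> (2 * \<epsilon>) (trapezoid \<epsilon>) R"
proof -
  have d: "(trapezoid \<epsilon> i has_real_derivative trapezoid \<epsilon> (Suc i) s) (at s within S)" if "i < 2" for i s S
  proof -
    have "((\<lambda>s. 2 - s / \<epsilon>) has_real_derivative 0 - 1 / \<epsilon>) (at s within S)"
      by (intro DERIV_diff DERIV_cdivide DERIV_ident DERIV_const)
    moreover have "i = 0 \<or> i = Suc 0" using that by linarith
    ultimately show ?thesis by (elim disjE) (simp_all only: trapezoid_simps DERIV_const diff_0 minus_divide_left)
  qed
  have b: "\<bar>trapezoid \<epsilon> i s\<bar> \<le> 16 * \<epsilon>^3 / s^(3 + i)" if i: "i \<le> 2" and s: "s \<in> {\<epsilon>..2 * \<epsilon>}" for i s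
  proof -
    have s0: "s > 0" and s2: "\<epsilon> \<le> s" "s \<le> 2 * \<epsilon>" using s \<epsilon> by auto
    consider "i = 0" | "i = Suc 0" | "i = Suc (Suc 0)" using i by linarith
    then show ?thesis
    proof cases
      case 1
      have "s^3 \<le> (2 * \<epsilon>)^3" using s2 s0 by (intro power_mono) auto
      also have "(2 * \<epsilon>)^3 = 8 * \<epsilon>^3" by (simp add: power_mult_distrib)
      also have "8 * \<epsilon>^3 \<le> 16 * \<epsilon>^3" using \<epsilon> by simp
      finally have "1 * s^3 \<le> 16 * \<epsilon>^3" by simp
      then have "1 \<le> 16 * \<epsilon>^3 / s^3" using s0 by (simp only: pos_le_divide_eq zero_less_power)
      moreover have "1 * \<epsilon> \<le> s" "s \<le> 2 * \<epsilon>" using s2 by auto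
      then have "1 \<le> s / \<epsilon>" "s / \<epsilon> \<le> 2" using \<epsilon> by (simp_all only: pos_le_divide_eq pos_divide_le_eq)
      then have "\<bar>2 - s / \<epsilon>\<bar> \<le> 1" unfolding abs_le_iff by linarith
      ultimately show ?thesis unfolding 1 trapezoid_simps by simp
    next
      case 2
      have "s^4 \<le> (2 * \<epsilon>)^4" using s2 s0 by (intro power_mono) auto
      also have "(2 * \<epsilon>)^4 = 16 * \<epsilon>^3 * \<epsilon>" by (simp add: power_mult_distrib eval_nat_numeral)
      finally have "s^4 / \<epsilon> \<le> 16 * \<epsilon>^3" using \<epsilon> by (simp only: pos_divide_le_eq)
      then have "1 / \<epsilon> * s^4 \<le> 16 * \<epsilon>^3" by simp
      then have "1 / \<epsilon> \<le> 16 * \<epsilon>^3 / s^4" using s0 by (simp only: pos_le_divide_eq zero_less_power)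
      then show ?thesis unfolding 2 trapezoid_simps using \<epsilon> by (simp add: abs_divide)
    next
      case 3
      have "0 \<le> 16 * \<epsilon>^3 / s^(3 + i)" using \<epsilon> s0 by simp
      then show ?thesis unfolding 3 trapezoid_simps by simp
    qed
  qed
  have c: "continuous_on {\<epsilon>..2 * \<epsilon>} (trapezoid \<epsilon> 2)" unfolding numeral_2_eq_2 trapezoid_simps by (rule continuous_on_const)
  have e: "trapezoid \<epsilon> 0 \<epsilon> = 1" "trapezoid \<epsilon> 0 (2 * \<epsilon>) = 0" unfolding trapezoid_simps using \<epsilon> by simp_all
  show ?thesis unfolding low_cutoff_def
    using \<epsilon> R e by (intro conjI ballI allI impI d b c disjI2) simp_all
qed

text \<open>In (a), all boundary terms at \<open>\<epsilon>\<close> have to vanish. The function \<open>(1 - (\<epsilon> / s)\<^sup>3)\<^sup>k\<close> vanishes there to order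
  \<open>k\<close>, and in the variable \<open>\<epsilon> / s\<close> its derivatives are the polynomials obtained by iterating \<open>recip_deriv\<close>.\<close>

definition recip_deriv :: "real poly \<Rightarrow> real poly" where
  "recip_deriv p = - (monom 1 2 * pderiv p)"

text \<open>For w = \<epsilon> / s one has dw/ds = - w^2 / \<epsilon>; this yields the operator -
  w^2 d/dw and the powers of \<epsilon>.\<close>

lemma DERIV_poly_recip:
  assumes "s > 0" "\<epsilon> > 0"
  shows "((\<lambda>s. poly ((recip_deriv ^^ i) p) (\<epsilon> / s) / \<epsilon> ^ i) has_real_derivative
     poly ((recip_deriv ^^ Suc i) p) (\<epsilon> / s) / \<epsilon> ^ Suc i) (at s within S)"
proof -
  let ?q = "(recip_deriv ^^ i) p"
  have "((\<lambda>s. \<epsilon> / s) has_real_derivative - (\<epsilon> / s^2)) (at s within S)"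
  proof -
    have "((\<lambda>s. \<epsilon> * inverse s) has_real_derivative \<epsilon> * - (inverse s * 1 * inverse s)) (at s within S)"
      using assms by (intro DERIV_cmult DERIV_inverse' DERIV_ident) auto
    then show ?thesis by (simp add: divide_inverse power2_eq_square)
  qed
  from DERIV_cdivide[OF DERIV_chain2[OF poly_DERIV this], of ?q "\<epsilon> ^ i"]
  have "((\<lambda>s. poly ?q (\<epsilon> / s) / \<epsilon> ^ i) has_real_derivative poly (pderiv ?q) (\<epsilon> / s) * - (\<epsilon> / s\<^sup>2) / \<epsilon> ^ i) (at s within S)" .
  moreover have "poly (pderiv ?q) (\<epsilon> / s) * - (\<epsilon> / s\<^sup>2) / \<epsilon> ^ i = poly ((recip_deriv ^^ Suc i) p) (\<epsilon> / s) / \<epsilon> ^ Suc i"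
  proof -
    have "x * - (\<epsilon> / s\<^sup>2) / \<epsilon> ^ i = - ((\<epsilon> / s)\<^sup>2 * x) / (\<epsilon> * \<epsilon> ^ i)" for x
      using assms by (simp add: power_divide power2_eq_square mult_ac)
    then show ?thesis by (simp add: recip_deriv_def poly_monom)
  qed
  ultimately show ?thesis by simp
qed

text \<open>Each derivative raises the order of the zero at w = 0, that is, it adds a factor 1/s to
  the decay for large s.\<close>

lemma monom_dvd_recip_deriv: "monom 1 n dvd p \<Longrightarrow> monom 1 (Suc n) dvd recip_deriv p"
proof -
  assume "monom 1 n dvd p"
  then obtain q where q: "p = monom 1 n * q" by auto
  show ?thesis
  proof (cases n)
    case 0
    have "recip_deriv p = monom 1 (Suc n) * (- (monom 1 1 * pderiv p))"
      using 0 by (simp add: recip_deriv_def mult.assoc[symmetric] mult_monom numeral_2_eq_2)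
    then show ?thesis by (metis dvd_triv_left)
  next
    case (Suc k)
    have "pderiv p = monom (of_nat n) k * q + monom 1 n * pderiv q"
      using Suc by (simp add: q pderiv_mult pderiv_monom)
    moreover have "monom 1 2 * (monom (of_nat n) k * q) = monom 1 (Suc n) * smult (of_nat n) q"
    proof -
      have "monom 1 2 * (monom (of_nat n) k * q) = monom (of_nat n) (Suc n) * q"
        by (simp add: mult.assoc[symmetric] mult_monom Suc)
      also have "monom (of_nat n) (Suc n) = smult (of_nat n) (monom 1 (Suc n))" by (simp add: smult_monom)
      finally show ?thesis by simp
    qed
    moreover have "monom 1 2 * (monom 1 n * pderiv q) = monom 1 (Suc n) * (monom 1 1 * pderiv q)"
      by (simp add: mult.assoc[symmetric] mult_monom)
    ultimately have "recip_deriv p = monom 1 (Suc n) * - (smult (of_nat n) q + monom 1 1 * pderiv q)"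
      by (simp only: recip_deriv_def distrib_left mult_minus_right minus_add_distrib)
    then show ?thesis by (metis dvd_triv_left)
  qed
qed

text \<open>The value w = 1 corresponds to s = \<epsilon>. The order of the zero there drops by at
  most one per derivative.\<close>

lemma power_dvd_recip_deriv: "[:1, -1:] ^ Suc n dvd p \<Longrightarrow> [:1, -1:] ^ n dvd recip_deriv p"
proof -
  assume "[:1, -1:] ^ Suc n dvd p"
  then obtain q where q: "p = [:1, -1:] ^ Suc n * q" by auto
  have "[:1, -1:] ^ n dvd pderiv ([:1, -1 :: real:] ^ Suc n)"
    unfolding pderiv_power_Suc by (intro dvd_mult2 dvd_smult dvd_refl)
  then have "[:1, -1:] ^ n dvd pderiv p"
    unfolding q pderiv_mult by (intro dvd_add dvd_mult2[OF le_imp_power_dvd[OF le_SucI[OF order_refl]]] dvd_mult)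
  then show ?thesis by (simp add: recip_deriv_def)
qed

lemma poly_bound_of_monom_dvd:
  fixes p :: "real poly"
  assumes "monom 1 n dvd p"
  obtains A where "A > 0" "\<And>w. 0 \<le> w \<Longrightarrow> w \<le> 1 \<Longrightarrow> \<bar>poly p w\<bar> \<le> A * w ^ n"
proof -
  obtain q where q: "p = monom 1 n * q" using assms by auto
  have "continuous_on {0..1} (poly q)" by (intro continuous_intros)
  then obtain A where A: "A > 0" "\<And>w. w \<in> {0..1} \<Longrightarrow> \<bar>poly q w\<bar> \<le> A"
    using compact_imp_bounded[OF compact_continuous_image[of "{0..1}" "poly q"]] by (auto simp: bounded_pos)
  have "\<bar>poly p w\<bar> \<le> A * w ^ n" if "0 \<le> w" "w \<le> 1" for w
    using mult_right_mono[OF A(2)[of w], of "w ^ n"] that by (simp add: q poly_monom abs_mult power_abs mult.commute)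
  with A(1) that show thesis by blast
qed

definition step_poly :: "nat \<Rightarrow> real poly" where "step_poly k = (1 - monom 1 3) ^ k"

lemma poly_step_poly: "poly (step_poly k) w = (1 - w ^ 3) ^ k"
  by (simp add: step_poly_def poly_monom)

lemma step_poly_monom_dvd: "monom 1 i dvd (recip_deriv ^^ i) (step_poly k)"
  by (induction i) (auto simp: monom_dvd_recip_deriv monom_0 one_pCons[symmetric])

lemma step_poly_zero_at_one: "i < k \<Longrightarrow> poly ((recip_deriv ^^ i) (step_poly k)) 1 = 0"
proof -
  assume i: "i < k"
  have "[:1, -1:] ^ (k - j) dvd (recip_deriv ^^ j) (step_poly k)" if "j \<le> k" for j
    using that
  proof (induction j)
    case 0
    have "1 - monom 1 3 = [:1, -1:] * [:1, 1, 1 :: real:]"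
      by (simp add: monom_altdef one_pCons numeral_3_eq_3)
    then have "[:1, -1:] dvd (1 - monom 1 3 :: real poly)" by (metis dvd_triv_left)
    then show ?case by (simp add: step_poly_def dvd_power_same)
  next
    case (Suc j)
    then have "[:1, -1:] ^ Suc (k - Suc j) dvd (recip_deriv ^^ j) (step_poly k)" by (simp add: Suc_diff_Suc)
    then show ?case using power_dvd_recip_deriv by simp
  qed
  from this[of i] i have "[:1, -1:] dvd (recip_deriv ^^ i) (step_poly k)"
    by (metis dvd_power dvd_trans less_imp_le zero_less_diff)
  then obtain q where "(recip_deriv ^^ i) (step_poly k) = [:1, -1:] * q" by auto
  then show ?thesis by simp
qed

definition step_cutoff :: "nat \<Rightarrow> real \<Rightarrow> nat \<Rightarrow> real \<Rightarrow> real" where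
  "step_cutoff k \<epsilon> i s = poly ((recip_deriv ^^ i) (1 - step_poly k)) (\<epsilon> / s) / \<epsilon> ^ i"

text \<open>Here b = R, since this cutoff never reaches 0. Its decay holds because 1 - (1 - w^3)^k
  is divisible by w^3 and each derivative adds a power of w. As everything is a polynomial in w =
  \<epsilon> / s on [0, 1], the constant A depends on k only.\<close>

lemma low_cutoff_step:
  assumes k: "k \<ge> 1"
  obtains A where "A \<ge> 1" "\<And>\<epsilon> R. 0 < \<epsilon> \<Longrightarrow> \<epsilon> < R \<Longrightarrow> 1 \<le> R \<Longrightarrow> low_cutoff A \<epsilon> R (step_cutoff k \<epsilon>) R"
proof -
  have dv: "monom 1 (3 + i) dvd (recip_deriv ^^ i) (1 - step_poly k)" for i
  proof (induction i)
    case 0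
    have "1 - (1 - monom 1 3) dvd 1 - (1 - monom 1 3 :: real poly) ^ k"
    proof -
      have "1 - (1 - monom 1 3) dvd 1 ^ k - (1 - monom 1 3 :: real poly) ^ k"
        unfolding power_diff_sumr2 by (rule dvd_triv_left)
      then show ?thesis by simp
    qed
    then show ?case by (simp add: step_poly_def)
  next
    case (Suc i)
    then show ?case using monom_dvd_recip_deriv[of "3 + i"] by simp
  qed
  obtain A0 A1 A2 where A: "A0 > 0" "A1 > 0" "A2 > 0"
    "\<And>w. 0 \<le> w \<Longrightarrow> w \<le> 1 \<Longrightarrow> \<bar>poly ((recip_deriv ^^ 0) (1 - step_poly k)) w\<bar> \<le> A0 * w ^ (3 + 0)"
    "\<And>w. 0 \<le> w \<Longrightarrow> w \<le> 1 \<Longrightarrow> \<bar>poly ((recip_deriv ^^ 1) (1 - step_poly k)) w\<bar> \<le> A1 * w ^ (3 + 1)"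
    "\<And>w. 0 \<le> w \<Longrightarrow> w \<le> 1 \<Longrightarrow> \<bar>poly ((recip_deriv ^^ 2) (1 - step_poly k)) w\<bar> \<le> A2 * w ^ (3 + 2)"
    using poly_bound_of_monom_dvd[OF dv[of 0]] poly_bound_of_monom_dvd[OF dv[of 1]] poly_bound_of_monom_dvd[OF dv[of 2]]
    by metis
  define A where "A = 1 + A0 + A1 + A2"
  have Ab: "\<bar>poly ((recip_deriv ^^ i) (1 - step_poly k)) w\<bar> \<le> A * w ^ (3 + i)" if w: "0 \<le> w" "w \<le> 1" and i: "i \<le> 2" for w i
  proof -
    have m: "Ai * w ^ (3 + i) \<le> A * w ^ (3 + i)" if "Ai \<le> A" for Ai
      using that w by (intro mult_right_mono) auto
    consider "i = 0" | "i = 1" | "i = 2" using i by linarith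
    then show ?thesis
    proof cases
      case 1 then show ?thesis using order_trans[OF A(4)[OF w] m[of A0, unfolded 1]] A by (simp add: A_def)
    next
      case 2 then show ?thesis using order_trans[OF A(5)[OF w] m[of A1, unfolded 2]] A by (simp add: A_def)
    next
      case 3 then show ?thesis using order_trans[OF A(6)[OF w] m[of A2, unfolded 3]] A by (simp add: A_def)
    qed
  qed
  have "low_cutoff A \<epsilon> R (step_cutoff k \<epsilon>) R" if \<epsilon>: "0 < \<epsilon>" "\<epsilon> < R" "1 \<le> R" for \<epsilon> R
    unfolding low_cutoff_def
  proof (intro conjI ballI allI impI)
    show "1 \<le> A" using A by (simp add: A_def)
    fix i s assume i: "i < (2::nat)" and s: "s \<in> {\<epsilon>..R}"
    show "(step_cutoff k \<epsilon> i has_real_derivative step_cutoff k \<epsilon> (Suc i) s) (at s within {\<epsilon>..R})"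
      unfolding step_cutoff_def[abs_def] by (rule DERIV_poly_recip) (use s \<epsilon> in auto)
  next
    show "continuous_on {\<epsilon>..R} (step_cutoff k \<epsilon> 2)"
      unfolding step_cutoff_def[abs_def] using \<epsilon> by (intro continuous_intros) auto
  next
    fix i s assume i: "i \<le> (2::nat)" and s: "s \<in> {\<epsilon>..R}"
    have "\<bar>step_cutoff k \<epsilon> i s\<bar> \<le> A * (\<epsilon> / s) ^ (3 + i) / \<epsilon> ^ i"
      unfolding step_cutoff_def abs_divide using Ab[of "\<epsilon> / s" i] i s \<epsilon> by (intro frac_le) auto
    also have "\<dots> = A * \<epsilon>^3 / s^(3 + i)" using s \<epsilon> by (simp add: power_divide power_add)
    finally show "\<bar>step_cutoff k \<epsilon> i s\<bar> \<le> A * \<epsilon>^3 / s^(3 + i)" .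
  next
    show "step_cutoff k \<epsilon> 0 \<epsilon> = 1" using \<epsilon> k by (simp add: step_cutoff_def poly_step_poly)
  qed (use \<epsilon> in auto)
  then show thesis using that[of A] A by (simp add: A_def)
qed

section \<open>Decay without a rate\<close>

lemma norm_integral_two_sided:
  fixes g :: "real \<Rightarrow> 'a::banach"
  assumes g: "\<And>s. \<bar>s\<bar> < \<epsilon> \<or> \<bar>s\<bar> > R \<Longrightarrow> g s = 0" and \<epsilon>: "0 < \<epsilon>" "\<epsilon> < R"
  shows "norm (integral UNIV g) \<le> norm (integral {\<epsilon>..R} g) + norm (integral {-R..-\<epsilon>} g)"
proof -
  have "g = (\<lambda>s. if s \<in> {-R..R} then g s else 0)"
  proof
    fix s show "g s = (if s \<in> {-R..R} then g s else 0)"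
    proof (cases "s \<in> {-R..R}")
      case False
      then have "R < \<bar>s\<bar>" unfolding atLeastAtMost_iff by linarith
      then show ?thesis using g[of s] by simp
    qed simp
  qed
  then have eq: "integral UNIV g = integral {-R..R} g" by (metis integral_restrict_UNIV)
  show ?thesis
  proof (cases "g integrable_on {-R..R}")
    case False \<comment> \<open>the integral is \<open>0\<close> by convention\<close>
    then show ?thesis unfolding eq by (simp add: not_integrable_integral)
  next
    case True
    have "integral {-R..R} g = integral {-R..-\<epsilon>} g + integral {-\<epsilon>..R} g"
      using \<epsilon> True by (intro integral_combine_interval[symmetric]) auto
    also have "integral {-\<epsilon>..R} g = integral {-\<epsilon>..\<epsilon>} g + integral {\<epsilon>..R} g"
      using \<epsilon> by (intro integral_combine_interval[symmetric] integrable_subinterval_real[OF True]) auto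
    also have "integral {-\<epsilon>..\<epsilon>} g = integral {-\<epsilon>..\<epsilon>} (\<lambda>_. 0)"
    proof (rule integral_spike[of "{-\<epsilon>, \<epsilon>}"])
      fix s assume "s \<in> {-\<epsilon>..\<epsilon>} - {-\<epsilon>, \<epsilon>}"
      then have "\<bar>s\<bar> < \<epsilon>" by (auto simp: abs_less_iff)
      then show "0 = g s" using g[of s] by simp
    qed simp
    finally have "integral {-R..R} g = integral {-R..-\<epsilon>} g + integral {\<epsilon>..R} g" by simp
    then show ?thesis unfolding eq using norm_triangle_ineq[of "integral {-R..-\<epsilon>} g" "integral {\<epsilon>..R} g"] by simp
  qed
qed

lemma high_profile_zero:
  assumes "\<bar>s\<bar> < \<epsilon> \<or> \<bar>s\<bar> > R" shows "high_profile \<epsilon> b c R \<bar>s\<bar> = 0"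
  using assms by (auto simp: high_profile_def low_profile_def)

lemma Ingham_tendsto_zero:
  fixes f F :: "real \<Rightarrow> 'a::complex_banach"
  assumes f_bdd: "bounded (f ` {0..})"
    and f_cont: "continuous_on {0..} f"
    and f_lip: "\<exists>L. L-lipschitz_on {0..} f"
    and f_int_bdd: "bounded ((\<lambda>t. integral {0..t} f) ` {0..})"
    and F_loc: "\<And>K. compact K \<Longrightarrow> K \<subseteq> - {0} \<Longrightarrow> F integrable_on K \<and> (\<lambda>s. norm (F s)) integrable_on K"
    and F_bdry: "\<And>\<psi> :: real \<Rightarrow> complex. continuous_on UNIV \<psi> \<Longrightarrow>
          compact (closure {s. \<psi> s \<noteq> 0}) \<Longrightarrow> 0 \<notin> closure {s. \<psi> s \<noteq> 0} \<Longrightarrow>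
          ((\<lambda>\<alpha>. integral UNIV (\<lambda>s. \<psi> s *\<^sub>C laplace f (Complex \<alpha> s)))
             \<longlongrightarrow> integral UNIV (\<lambda>s. \<psi> s *\<^sub>C F s)) (at_right 0)"
  shows "(f \<longlongrightarrow> 0) at_top"
proof (rule tendstoI)
  fix e :: real assume e: "e > 0"
  obtain X K where XK: "X > 0" "K > 0" and est:
    "\<And>A \<epsilon> b c R t. low_cutoff A \<epsilon> b c R \<Longrightarrow> t \<ge> X \<Longrightarrow>
       norm (f t) \<le> K * A * (\<epsilon> + 1 / R) + norm (integral UNIV (\<lambda>s. (of_real (high_profile \<epsilon> b c R \<bar>s\<bar>) * cis (t * s)) *\<^sub>C F s))"
  proof (rule smoothing_estimate[OF f_bdd f_cont f_lip f_int_bdd, of F], goal_cases)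
    case 1
    from 1(2-4) show ?case by (rule F_bdry)
  next
    case (2 X K)
    from 2(2-4) show ?case by (rule 2(1))
  qed
  \<comment> \<open>With R = 1 / \<epsilon> the smoothing error is 32 K \<epsilon>, at most e / 2.
    These frequencies stay fixed while t grows, and the bound 1/4 provides 2 \<epsilon> <= R and R
    >= 1.\<close>
  define \<epsilon> where "\<epsilon> = min (1 / 4) (e / (4 * (K * 16)))"
  define R where "R = 1 / \<epsilon>"
  have \<epsilon>: "0 < \<epsilon>" "\<epsilon> \<le> 1 / 4" "K * 16 * (\<epsilon> + 1 / R) \<le> e / 2"
  proof -
    show e0: "0 < \<epsilon>" "\<epsilon> \<le> 1 / 4" using e XK by (auto simp: \<epsilon>_def)
    have "\<epsilon> \<le> e / (4 * (K * 16))" by (simp add: \<epsilon>_def)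
    then have "K * 16 * (\<epsilon> + \<epsilon>) \<le> e / 2" using XK by (simp add: pos_le_divide_eq field_simps)
    then show "K * 16 * (\<epsilon> + 1 / R) \<le> e / 2" using e0 by (simp add: R_def)
  qed
  have R: "4 \<le> R" using \<epsilon> by (simp add: R_def pos_le_divide_eq)
  have lc: "low_cutoff 16 \<epsilon> (2 * \<epsilon>) (trapezoid \<epsilon>) R"
    by (rule low_cutoff_trapezoid) (use \<epsilon> R in auto)
  let ?g = "\<lambda>t s. (of_real (high_profile \<epsilon> (2 * \<epsilon>) (trapezoid \<epsilon>) R \<bar>s\<bar>) * cis (t * s)) *\<^sub>C F s"
  have RL: "((\<lambda>t. integral {a..b} (?g t)) \<longlongrightarrow> 0) at_top" if ab: "a < b" "0 \<notin> {a..b}" for a b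
  proof (rule Riemann_Lebesgue_interval)
    show "F integrable_on {a..b}" "(\<lambda>s. norm (F s)) integrable_on {a..b}"
      using F_loc[of "{a..b}"] ab by auto
    show "continuous_on {a..b} (\<lambda>s. high_profile \<epsilon> (2 * \<epsilon>) (trapezoid \<epsilon>) R \<bar>s\<bar>)"
      by (rule continuous_on_subset[OF continuous_on_high_profile[OF lc]]) auto
  qed (use ab in auto)
  have "((\<lambda>t. norm (integral {\<epsilon>..R} (?g t)) + norm (integral {-R..-\<epsilon>} (?g t))) \<longlongrightarrow> norm (0::'a) + norm (0::'a)) at_top"
    using \<epsilon> R by (intro tendsto_intros RL) auto
  then have "eventually (\<lambda>t. norm (integral {\<epsilon>..R} (?g t)) + norm (integral {-R..-\<epsilon>} (?g t)) < e / 2) at_top"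
    using e by (intro order_tendstoD(2)) auto
  then show "\<forall>\<^sub>F t in at_top. dist (f t) 0 < e"
    using eventually_ge_at_top[of X]
  proof eventually_elim
    case (elim t)
    have "norm (f t) \<le> K * 16 * (\<epsilon> + 1 / R) + norm (integral UNIV (?g t))" by (rule est[OF lc elim(2)])
    also have "norm (integral UNIV (?g t)) \<le> norm (integral {\<epsilon>..R} (?g t)) + norm (integral {-R..-\<epsilon>} (?g t))"
      using \<epsilon> R by (intro norm_integral_two_sided) (auto simp: high_profile_zero scaleC.zero_left)
    finally show ?case using elim(1) \<epsilon>(3) by simp
  qed
qed

section \<open>Oscillatory integrals of the boundary function\<close>

lemma sum_binomial_row: "(\<Sum>i\<le>j. real (j choose i)) = 2 ^ j"
  using choose_row_sum[of j] by (metis of_nat_numeral of_nat_power of_nat_sum)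

text \<open>A derivative costs 1/s whether it falls on the weight or on \<open>D\<close>, so all
  terms have the same order in s and only the binomial row sum is lost.\<close>

lemma leibniz_bound_low:
  assumes p: "\<And>i. i \<le> j \<Longrightarrow> \<bar>p i s\<bar> \<le> A / s ^ i" and D: "\<And>i. i \<le> j \<Longrightarrow> norm (D i s) \<le> C * s ^ (k - i) * \<mu>"
    and s: "s > 0" and j: "j \<le> k" and nn: "A \<ge> 0" "C \<ge> 0" "\<mu> \<ge> 0"
  shows "norm (leibniz p D j s) \<le> (2 ^ k * A * C) * s ^ (k - j) * \<mu>"
proof -
  have "norm (leibniz p D j s) \<le> (\<Sum>i\<le>j. real (j choose i) * \<bar>p i s\<bar> * norm (D (j - i) s))" by (rule norm_leibniz_le)
  also have "\<dots> \<le> (\<Sum>i\<le>j. real (j choose i) * (A * C * s ^ (k - j) * \<mu>))"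
  proof (rule sum_mono)
    fix i assume "i \<in> {..j}"
    then have i: "i \<le> j" by simp
    have "\<bar>p i s\<bar> * norm (D (j - i) s) \<le> A / s ^ i * (C * s ^ (k - (j - i)) * \<mu>)"
      using p[OF i] D[of "j - i"] s nn by (intro mult_mono) auto
    also have "k - (j - i) = (k - j) + i" using i j by simp
    also have "A / s ^ i * (C * s ^ ((k - j) + i) * \<mu>) = A * C * s ^ (k - j) * \<mu>" using s by (simp add: power_add)
    finally show "real (j choose i) * \<bar>p i s\<bar> * norm (D (j - i) s) \<le> real (j choose i) * (A * C * s ^ (k - j) * \<mu>)"
      unfolding mult.assoc by (intro mult_left_mono) (simp_all add: mult.assoc)
  qed
  also have "\<dots> = 2 ^ j * (A * C * s ^ (k - j) * \<mu>)" by (simp add: sum_distrib_right[symmetric] sum_binomial_row)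
  also have "\<dots> \<le> 2 ^ k * (A * C * s ^ (k - j) * \<mu>)" using s j nn by (intro mult_right_mono power_increasing) auto
  finally show ?thesis by (simp add: mult_ac)
qed

text \<open>The derivatives of the weight are merely bounded, so with \<mu> >= 1 the worst case is
  that all derivatives fall on \<open>D\<close>.\<close>

lemma leibniz_bound_high:
  assumes p: "\<And>i. i \<le> j \<Longrightarrow> \<bar>p i s\<bar> \<le> A" and D: "\<And>i. i \<le> j \<Longrightarrow> norm (D i s) \<le> C * \<mu> ^ Suc i"
    and j: "j \<le> k" and nn: "A \<ge> 0" "C \<ge> 0" "\<mu> \<ge> 1"
  shows "norm (leibniz p D j s) \<le> (2 ^ k * A * C) * \<mu> ^ Suc j"
proof -
  have "norm (leibniz p D j s) \<le> (\<Sum>i\<le>j. real (j choose i) * \<bar>p i s\<bar> * norm (D (j - i) s))" by (rule norm_leibniz_le)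
  also have "\<dots> \<le> (\<Sum>i\<le>j. real (j choose i) * (A * C * \<mu> ^ Suc j))"
  proof (rule sum_mono)
    fix i assume "i \<in> {..j}"
    then have i: "i \<le> j" by simp
    have "norm (D (j - i) s) \<le> C * \<mu> ^ Suc (j - i)" using D[of "j - i"] by simp
    also have "\<dots> \<le> C * \<mu> ^ Suc j" using nn by (intro mult_left_mono power_increasing) auto
    finally have "\<bar>p i s\<bar> * norm (D (j - i) s) \<le> A * (C * \<mu> ^ Suc j)"
      using p[OF i] nn by (intro mult_mono) auto
    then show "real (j choose i) * \<bar>p i s\<bar> * norm (D (j - i) s) \<le> real (j choose i) * (A * C * \<mu> ^ Suc j)"
      unfolding mult.assoc by (intro mult_left_mono) simp_all
  qed
  also have "\<dots> = 2 ^ j * (A * C * \<mu> ^ Suc j)" by (simp add: sum_distrib_right[symmetric] sum_binomial_row)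
  also have "\<dots> \<le> 2 ^ k * (A * C * \<mu> ^ Suc j)" using j nn by (intro mult_right_mono power_increasing) auto
  finally show ?thesis by (simp add: mult_ac)
qed

text \<open>The double zero of the bump at \<^term>\<open>R\<close> is what keeps this boundary term small.\<close>

lemma leibniz_bump_end_bound:
  assumes D: "\<And>i. i \<le> j \<Longrightarrow> norm (D i R) \<le> C * \<mu> ^ Suc i"
    and j: "j \<le> k" and nn: "C \<ge> 0" "\<mu> \<ge> 1" "R \<ge> 1"
  shows "norm (leibniz (bump R) D j R) \<le> (2 ^ k * 24 * C) * \<mu> ^ (j - 1) / R^2"
    and "j < 2 \<Longrightarrow> leibniz (bump R) D j R = 0"
proof -
  have z: "bump R i R = 0" if "i < 2" for i
  proof -
    have "i = 0 \<or> i = Suc 0" using that by linarith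
    then show ?thesis using bump_zero_end[of R] nn by auto
  qed
  have "norm (leibniz (bump R) D j R) \<le> (\<Sum>i\<le>j. real (j choose i) * \<bar>bump R i R\<bar> * norm (D (j - i) R))" by (rule norm_leibniz_le)
  also have "\<dots> \<le> (\<Sum>i\<le>j. real (j choose i) * (24 * C * \<mu> ^ (j - 1) / R^2))"
  proof (rule sum_mono)
    fix i assume "i \<in> {..j}"
    then have i: "i \<le> j" by simp
    have "\<bar>bump R i R\<bar> * norm (D (j - i) R) \<le> 24 / R^2 * (C * \<mu> ^ (j - 1))"
    proof (cases "i < 2")
      case True then show ?thesis using z nn by simp
    next
      case False
      have "\<bar>bump R i R\<bar> \<le> 24 / R ^ i" using nn by (intro abs_bump_le) auto
      also have "\<dots> \<le> 24 / R ^ 2" using nn False by (intro divide_left_mono power_increasing) auto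
      finally have 1: "\<bar>bump R i R\<bar> \<le> 24 / R ^ 2" .
      have "norm (D (j - i) R) \<le> C * \<mu> ^ Suc (j - i)" using D[of "j - i"] by simp
      \<comment> \<open>At least two derivatives fall on the bump, so at most j - 2 are left for
        \<open>D\<close>.\<close>
      also have "\<dots> \<le> C * \<mu> ^ (j - 1)" using nn False i by (intro mult_left_mono power_increasing) auto
      finally show ?thesis using 1 nn by (intro mult_mono) auto
    qed
    then show "real (j choose i) * \<bar>bump R i R\<bar> * norm (D (j - i) R) \<le> real (j choose i) * (24 * C * \<mu> ^ (j - 1) / R^2)"
      unfolding mult.assoc by (intro mult_left_mono) simp_all
  qed
  also have "\<dots> = 2 ^ j * (24 * C * \<mu> ^ (j - 1) / R^2)"
    by (simp only: sum_distrib_right[symmetric] sum_binomial_row)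
  also have "\<dots> \<le> 2 ^ k * (24 * C * \<mu> ^ (j - 1) / R^2)" using j nn by (intro mult_right_mono power_increasing) auto
  finally show "norm (leibniz (bump R) D j R) \<le> (2 ^ k * 24 * C) * \<mu> ^ (j - 1) / R^2" by (simp add: mult_ac)
  show "leibniz (bump R) D j R = 0" if "j < 2"
    unfolding leibniz_def by (rule sum.neutral) (use that z in auto)
qed

section \<open>Oscillatory integrals under finite smoothness\<close>

definition step_rise :: "nat \<Rightarrow> real \<Rightarrow> nat \<Rightarrow> real \<Rightarrow> real" where
  "step_rise k \<epsilon> i s = poly ((recip_deriv ^^ i) (step_poly k)) (\<epsilon> / s) / \<epsilon> ^ i"

lemma step_rise_bound:
  obtains A where "A \<ge> 1" "\<And>\<epsilon> s i. 0 < \<epsilon> \<Longrightarrow> \<epsilon> \<le> s \<Longrightarrow> i \<le> n \<Longrightarrow> \<bar>step_rise k \<epsilon> i s\<bar> \<le> A / s ^ i"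
proof -
  have "\<exists>A>0. \<forall>w. 0 \<le> w \<and> w \<le> 1 \<longrightarrow> \<bar>poly ((recip_deriv ^^ i) (step_poly k)) w\<bar> \<le> A * w ^ i" for i
    using poly_bound_of_monom_dvd[OF step_poly_monom_dvd[of i k]] by metis
  then obtain A where A: "\<And>i. A i > 0" "\<And>i w. 0 \<le> w \<Longrightarrow> w \<le> 1 \<Longrightarrow> \<bar>poly ((recip_deriv ^^ i) (step_poly k)) w\<bar> \<le> A i * w ^ i"
    by metis
  define B where "B = 1 + (\<Sum>i\<le>n. A i)"
  have AB: "A i \<le> B" if "i \<le> n" for i
  proof -
    have "A i \<le> (\<Sum>i\<le>n. A i)" using that A(1) by (intro member_le_sum) (auto intro: less_imp_le)
    then show ?thesis by (simp add: B_def)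
  qed
  have "\<bar>step_rise k \<epsilon> i s\<bar> \<le> B / s ^ i" if "0 < \<epsilon>" "\<epsilon> \<le> s" "i \<le> n" for \<epsilon> s i
  proof -
    have "\<bar>poly ((recip_deriv ^^ i) (step_poly k)) (\<epsilon> / s)\<bar> \<le> A i * (\<epsilon> / s) ^ i" using that by (intro A) auto
    also have "\<dots> \<le> B * (\<epsilon> / s) ^ i" using AB that by (intro mult_right_mono) auto
    finally have "\<bar>step_rise k \<epsilon> i s\<bar> \<le> B * (\<epsilon> / s) ^ i / \<epsilon> ^ i"
      unfolding step_rise_def abs_divide using that by (simp add: divide_right_mono)
    also have "\<dots> = B / s ^ i" using that by (simp add: power_divide)
    finally show ?thesis .
  qed
  moreover have "B \<ge> 1" unfolding B_def using A(1) by (simp add: sum_nonneg less_imp_le)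
  ultimately show thesis using that by blast
qed

text \<open>The numbers m and M stand for the envelopes m(\<epsilon>)^(k+1) and M(R). The weight has
  a zero of order k at \<epsilon>, so no boundary term survives there; at R those of order 0 and 1
  vanish and the others keep 1 / R^2. The constant C' depends on k and C only.\<close>

lemma finite_smoothness_integral_bound:
  assumes C: "C > 0"
  obtains C' where "C' > 0"
    "\<And>D :: nat \<Rightarrow> real \<Rightarrow> 'a::complex_banach. \<And>m M \<epsilon> R \<tau>.
      (\<And>j s. j < k \<Longrightarrow> s > 0 \<Longrightarrow> (D j has_vector_derivative D (Suc j) s) (at s)) \<Longrightarrow>
      continuous_on {0<..} (D k) \<Longrightarrow>
      (\<And>j s. j \<le> k \<Longrightarrow> \<epsilon> \<le> s \<Longrightarrow> s \<le> 1 \<Longrightarrow> norm (D j s) \<le> C * s ^ (k - j) * m) \<Longrightarrow>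
      (\<And>j s. j \<le> k \<Longrightarrow> 1 \<le> s \<Longrightarrow> s \<le> R \<Longrightarrow> norm (D j s) \<le> C * M ^ Suc j) \<Longrightarrow>
      0 < \<epsilon> \<Longrightarrow> \<epsilon> \<le> 1 \<Longrightarrow> 1 \<le> R \<Longrightarrow> 0 \<le> m \<Longrightarrow> 1 \<le> M \<Longrightarrow> \<tau> \<noteq> 0 \<Longrightarrow>
      norm (integral {\<epsilon>..R} (\<lambda>s. cis (\<tau> * s) *\<^sub>C ((bump R 0 s * step_rise k \<epsilon> 0 s) *\<^sub>R D 0 s)))
       \<le> C' * ((\<Sum>j\<in>{2..<k}. M ^ (j - 1) / (R^2 * \<bar>\<tau>\<bar> ^ Suc j)) + (m + R * M ^ Suc k) / \<bar>\<tau>\<bar> ^ k)"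
proof -
  obtain A where A: "A \<ge> 1" "\<And>\<epsilon> s i. 0 < \<epsilon> \<Longrightarrow> \<epsilon> \<le> s \<Longrightarrow> i \<le> k \<Longrightarrow> \<bar>step_rise k \<epsilon> i s\<bar> \<le> A / s ^ i"
    using step_rise_bound[of k k] by blast
  define C1 where "C1 = 2 ^ k * A * C"
  define C2 where "C2 = 2 ^ k * 24 * C1"
  have C12: "C1 > 0" "C2 > 0" using A C by (auto simp: C1_def C2_def)
  show thesis
  proof (rule that[OF C12(2)])
    fix D :: "nat \<Rightarrow> real \<Rightarrow> 'a" and m M \<epsilon> R \<tau> :: real
    assume Dd: "\<And>j s. j < k \<Longrightarrow> s > 0 \<Longrightarrow> (D j has_vector_derivative D (Suc j) s) (at s)"
      and Dc: "continuous_on {0<..} (D k)"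
      and Dlow: "\<And>j s. j \<le> k \<Longrightarrow> \<epsilon> \<le> s \<Longrightarrow> s \<le> 1 \<Longrightarrow> norm (D j s) \<le> C * s ^ (k - j) * m"
      and Dhigh: "\<And>j s. j \<le> k \<Longrightarrow> 1 \<le> s \<Longrightarrow> s \<le> R \<Longrightarrow> norm (D j s) \<le> C * M ^ Suc j"
      and \<epsilon>: "0 < \<epsilon>" "\<epsilon> \<le> 1" and R: "1 \<le> R" and m: "0 \<le> m" and M: "1 \<le> M" and \<tau>: "\<tau> \<noteq> 0"
    let ?S = "{\<epsilon>..R}"
    define G where "G = leibniz (step_rise k \<epsilon>) D"
    define H where "H = leibniz (bump R) G"
    have Dd': "(D j has_vector_derivative D (Suc j) s) (at s within ?S)" if "j < k" "s \<in> ?S" for j s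
      using Dd[of j s] that \<epsilon> by (auto intro: has_vector_derivative_at_within)
    have rd: "(step_rise k \<epsilon> j has_vector_derivative step_rise k \<epsilon> (Suc j) s) (at s within ?S)" if "s \<in> ?S" for j s
      using DERIV_poly_recip[of s \<epsilon> j "step_poly k" ?S] that \<epsilon>
      by (simp add: step_rise_def[abs_def] has_real_derivative_iff_has_vector_derivative)
    have Gd: "(G j has_vector_derivative G (Suc j) s) (at s within ?S)" if "j < k" "s \<in> ?S" for j s
      unfolding G_def by (rule has_vector_derivative_leibniz) (use that in \<open>auto intro!: rd Dd'\<close>)
    have Hd: "(H j has_vector_derivative H (Suc j) s) (at s within ?S)" if "j < k" "s \<in> ?S" for j s
      unfolding H_def by (rule has_vector_derivative_leibniz) (use that R in \<open>auto intro!: has_vector_derivative_bump Gd\<close>)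
    have Dcj: "continuous_on ?S (D j)" if "j \<le> k" for j
    proof (cases "j = k")
      case True
      then show ?thesis using Dc \<epsilon> by (auto intro: continuous_on_subset)
    next
      case False
      then show ?thesis using that by (intro continuous_on_vector_derivative[OF Dd']) auto
    qed
    have rc: "continuous_on ?S (step_rise k \<epsilon> j)" for j
      by (rule continuous_on_vector_derivative[OF rd])
    have Hc: "continuous_on ?S (H k)"
      unfolding H_def G_def using R by (intro continuous_on_leibniz continuous_on_bump rc Dcj) auto
    have Glow: "norm (G j s) \<le> C1 * s ^ (k - j) * m" if "j \<le> k" "\<epsilon> \<le> s" "s \<le> 1" for j s
      unfolding G_def C1_def using that \<epsilon> A C m
      by (intro leibniz_bound_low Dlow A(2)) auto
    have Ghigh: "norm (G j s) \<le> C1 * M ^ Suc j" if "j \<le> k" "1 \<le> s" "s \<le> R" for j s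
      unfolding G_def C1_def
    proof (rule leibniz_bound_high)
      fix i assume "i \<le> j"
      then have "\<bar>step_rise k \<epsilon> i s\<bar> \<le> A / s ^ i" using that \<epsilon> by (intro A(2)) auto
      also have "\<dots> \<le> A / 1" using that A by (intro divide_left_mono) auto
      finally show "\<bar>step_rise k \<epsilon> i s\<bar> \<le> A" by simp
    qed (use that A C M in \<open>auto intro!: Dhigh[simplified]\<close>)
    \<comment> \<open>Since s <= R, the derivatives of the bump obey the same 1/s law as those of
      the step, which is the form required by \<open>leibniz_bound_low\<close>.\<close>
    have bl: "\<bar>bump R i s\<bar> \<le> 24 / s ^ i" if "0 < s" "s \<le> R" for i s
    proof -
      have "\<bar>bump R i s\<bar> \<le> 24 / R ^ i" using that R by (intro abs_bump_le) auto
      also have "\<dots> \<le> 24 / s ^ i" using that R by (intro divide_left_mono power_mono) auto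
      finally show ?thesis .
    qed
    have Hlow: "norm (H k s) \<le> C2 * m" if "\<epsilon> \<le> s" "s \<le> 1" for s
    proof -
      have "norm (H k s) \<le> (2 ^ k * 24 * C1) * s ^ (k - k) * m"
        unfolding H_def using that \<epsilon> R C12 m by (intro leibniz_bound_low Glow bl) auto
      then show ?thesis by (simp add: C2_def)
    qed
    have Hhigh: "norm (H k s) \<le> C2 * M ^ Suc k" if "1 \<le> s" "s \<le> R" for s
      unfolding H_def C2_def
    proof (rule leibniz_bound_high)
      fix i assume "i \<le> k"
      have "\<bar>bump R i s\<bar> \<le> 24 / s ^ i" using that by (intro bl) auto
      also have "\<dots> \<le> 24 / 1" using that by (intro divide_left_mono) auto
      finally show "\<bar>bump R i s\<bar> \<le> 24" by simp
    qed (use that C12 M Ghigh in auto)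
    have G\<epsilon>: "G j \<epsilon> = 0" if "j < k" for j
      unfolding G_def leibniz_def by (rule sum.neutral) (use that \<epsilon> in \<open>auto simp: step_rise_def step_poly_zero_at_one\<close>)
    have H\<epsilon>: "H j \<epsilon> = 0" if "j < k" for j
      unfolding H_def leibniz_def by (rule sum.neutral) (use that G\<epsilon> in auto)
    have HR: "norm (H j R) \<le> (if j < 2 then 0 else C2 * M ^ (j - 1) / R^2)" if "j < k" for j
      unfolding H_def C2_def using leibniz_bump_end_bound[of j G R C1 M k] Ghigh[of _ R] that C12 M R by auto
    have I: "integral ?S (\<lambda>s. norm (H k s)) \<le> C2 * (m + R * M ^ Suc k)"
    proof -
      have ci: "(\<lambda>s. norm (H k s)) integrable_on {u..v}" if "{u..v} \<subseteq> ?S" for u v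
        by (intro integrable_continuous_interval continuous_intros continuous_on_subset[OF Hc that])
      have "integral ?S (\<lambda>s. norm (H k s)) = integral {\<epsilon>..1} (\<lambda>s. norm (H k s)) + integral {1..R} (\<lambda>s. norm (H k s))"
        using \<epsilon> R by (intro integral_combine_interval[symmetric] ci) auto
      also have "\<dots> \<le> integral {\<epsilon>..1} (\<lambda>s. C2 * m) + integral {1..R} (\<lambda>s. C2 * M ^ Suc k)"
        using \<epsilon> R Hlow Hhigh by (intro add_mono integral_le ci integrable_continuous_interval continuous_intros) auto
      also have "\<dots> = (1 - \<epsilon>) * (C2 * m) + (R - 1) * (C2 * M ^ Suc k)" using \<epsilon> R by simp
      also have "\<dots> \<le> 1 * (C2 * m) + R * (C2 * M ^ Suc k)"
        using \<epsilon> C12 m M by (intro add_mono mult_right_mono) auto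
      finally show ?thesis by (simp add: algebra_simps)
    qed
    have "norm (integral ?S (\<lambda>s. cis (\<tau> * s) *\<^sub>C H 0 s)) \<le> (\<Sum>j<k. (norm (H j \<epsilon>) + norm (H j R)) / \<bar>\<tau>\<bar> ^ Suc j)
      + integral ?S (\<lambda>s. norm (H k s)) / \<bar>\<tau>\<bar> ^ k"
      using \<epsilon> R \<tau> Hd Hc by (intro oscillatory_integral_bound) auto
    also have "(\<Sum>j<k. (norm (H j \<epsilon>) + norm (H j R)) / \<bar>\<tau>\<bar> ^ Suc j) \<le> (\<Sum>j<k. if j < 2 then 0 else C2 * (M ^ (j - 1) / (R^2 * \<bar>\<tau>\<bar> ^ Suc j)))"
    proof (rule sum_mono)
      fix j assume "j \<in> {..<k}"
      then have "norm (H j \<epsilon>) + norm (H j R) \<le> (if j < 2 then 0 else C2 * M ^ (j - 1) / R^2)"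
        using H\<epsilon>[of j] HR[of j] by simp
      then have "(norm (H j \<epsilon>) + norm (H j R)) / \<bar>\<tau>\<bar> ^ Suc j \<le> (if j < 2 then 0 else C2 * M ^ (j - 1) / R^2) / \<bar>\<tau>\<bar> ^ Suc j"
        by (intro divide_right_mono) auto
      then show "(norm (H j \<epsilon>) + norm (H j R)) / \<bar>\<tau>\<bar> ^ Suc j \<le> (if j < 2 then 0 else C2 * (M ^ (j - 1) / (R^2 * \<bar>\<tau>\<bar> ^ Suc j)))"
        by (simp split: if_splits)
    qed
    also have "\<dots> = (\<Sum>j\<in>{2..<k}. C2 * (M ^ (j - 1) / (R^2 * \<bar>\<tau>\<bar> ^ Suc j)))"
      by (rule sum.mono_neutral_cong_right) auto
    also have "\<dots> = C2 * (\<Sum>j\<in>{2..<k}. M ^ (j - 1) / (R^2 * \<bar>\<tau>\<bar> ^ Suc j))" by (simp only: sum_distrib_left)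
    also have "integral ?S (\<lambda>s. norm (H k s)) / \<bar>\<tau>\<bar> ^ k \<le> C2 * (m + R * M ^ Suc k) / \<bar>\<tau>\<bar> ^ k"
      by (intro divide_right_mono I) auto
    finally have "norm (integral ?S (\<lambda>s. cis (\<tau> * s) *\<^sub>C H 0 s)) \<le>
       C2 * ((\<Sum>j\<in>{2..<k}. M ^ (j - 1) / (R^2 * \<bar>\<tau>\<bar> ^ Suc j)) + (m + R * M ^ Suc k) / \<bar>\<tau>\<bar> ^ k)"
      by (simp add: distrib_left)
    moreover have "H 0 s = (bump R 0 s * step_rise k \<epsilon> 0 s) *\<^sub>R D 0 s" for s
      by (simp add: H_def G_def leibniz_def)
    ultimately show "norm (integral ?S (\<lambda>s. cis (\<tau> * s) *\<^sub>C ((bump R 0 s * step_rise k \<epsilon> 0 s) *\<^sub>R D 0 s)))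
       \<le> C2 * ((\<Sum>j\<in>{2..<k}. M ^ (j - 1) / (R^2 * \<bar>\<tau>\<bar> ^ Suc j)) + (m + R * M ^ Suc k) / \<bar>\<tau>\<bar> ^ k)" by simp
  qed
qed

section \<open>Factorial estimates\<close>

lemma sum_fact_power_le:
  fixes x :: real
  assumes "0 \<le> x" "real n * x \<le> 1"
  shows "(\<Sum>j<n. fact j * x ^ j) \<le> 4"
proof (cases "n = 0")
  case False
  then have n: "real n \<ge> 1" by simp
  have x: "x \<le> 1 / real n" using assms n by (simp add: pos_le_divide_eq mult.commute)
  \<comment> \<open>The ratio of consecutive terms, (j + 1) x, is at most n x <= 1, so from j = 2 on
    no term exceeds 2 x^2. Fewer than n + 1 such terms add up to at most 2 x (n x) <= 2; the terms j
    = 0 and j = 1 add at most 2 more.\<close>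
  have ind: "fact j * x ^ j \<le> 2 * x^2" if "2 \<le> j" "j \<le> n" for j
    using that
  proof (induction j rule: dec_induct)
    case base
    then show ?case by (simp add: fact_numeral)
  next
    case (step j)
    have "fact (Suc j) * x ^ Suc j = (real (Suc j) * x) * (fact j * x ^ j)" by simp
    also have "\<dots> \<le> 1 * (2 * x^2)"
    proof (rule mult_mono)
      have "real (Suc j) * x \<le> real n * x" using step assms by (intro mult_right_mono) auto
      then show "real (Suc j) * x \<le> 1" using assms by linarith
      show "fact j * x ^ j \<le> 2 * x^2" using step by simp
    qed (use assms in auto)
    finally show ?case by simp
  qed
  have x1: "x \<le> 1" using x n by (smt (verit) divide_le_eq_1)
  have tb: "fact j * x ^ j \<le> (if j = 0 then 1 else 0) + (if j = 1 then 1 else 0) + 2 * x^2" if "j < n" for j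
  proof -
    consider "j = 0" | "j = 1" | "2 \<le> j" by linarith
    moreover have "0 \<le> x^2" by simp
    ultimately show ?thesis
    proof cases
      case 2
      have "x \<le> 1 + 2 * x^2" using x1 \<open>0 \<le> x^2\<close> by linarith
      then show ?thesis using 2 by simp
    qed (use ind[of j] that in auto)
  qed
  have "(\<Sum>j<n. fact j * x ^ j) \<le> (\<Sum>j<n. (if j = 0 then 1 else 0) + (if j = 1 then 1 else 0) + 2 * x^2)"
    by (intro sum_mono tb) simp
  also have "\<dots> = (\<Sum>j<n. if j = 0 then 1 else 0) + (\<Sum>j<n. if j = 1 then 1 else 0) + real n * (2 * x^2)"
    by (simp add: sum.distrib)
  also have "\<dots> \<le> 1 + 1 + real n * (2 * x^2)"
    by (intro add_mono) (auto simp: sum.delta)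
  also have "real n * (2 * x^2) = 2 * x * (real n * x)" by (simp add: power2_eq_square)
  also have "\<dots> \<le> 2 * 1 * 1" using assms x1 by (intro mult_mono) auto
  finally show ?thesis by simp
qed simp

text \<open>The induction step comes down to e <= (1 + 1/n)^(n+1), which is ln (1 + 1/n) >=
  1/(n+1).\<close>

lemma fact_le_exp_bound:
  assumes "n \<ge> 1"
  shows "fact n \<le> exp 1 * real n * (real n / exp 1) ^ n"
  using assms
proof (induction n rule: dec_induct)
  case base
  then show ?case by simp
next
  case (step n)
  have n: "real n > 0" using step by simp
  have "exp 1 \<le> (1 + 1 / real n) ^ Suc n"
  proof -
    have "1 / real (Suc n) \<le> ln (1 + 1 / real n)"
    proof -
      have "ln (1 / (1 + 1 / real n)) \<le> 1 / (1 + 1 / real n) - 1" using n by (intro ln_le_minus_one) (auto intro: add_pos_pos)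
      moreover have "ln (1 / (1 + 1 / real n)) = - ln (1 + 1 / real n)" using n by (simp add: ln_div add_pos_pos)
      moreover have "1 / (1 + 1 / real n) - 1 = - (1 / real (Suc n))" using n by (simp add: field_simps)
      ultimately show ?thesis by linarith
    qed
    then have "1 \<le> real (Suc n) * ln (1 + 1 / real n)" by (simp add: pos_divide_le_eq mult.commute)
    also have "\<dots> = ln ((1 + 1 / real n) ^ Suc n)" using n by (simp add: ln_realpow add_pos_pos del: power_Suc)
    finally have "exp 1 \<le> exp (ln ((1 + 1 / real n) ^ Suc n))" by simp
    also have "\<dots> = (1 + 1 / real n) ^ Suc n" using n by (intro exp_ln zero_less_power add_pos_pos) auto
    finally show ?thesis .
  qed
  then have "exp 1 * real n ^ Suc n \<le> (1 + 1 / real n) ^ Suc n * real n ^ Suc n"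
    using n by (intro mult_right_mono) auto
  also have "\<dots> = ((1 + 1 / real n) * real n) ^ Suc n" by (simp only: power_mult_distrib)
  also have "(1 + 1 / real n) * real n = real (Suc n)" using n by (simp add: field_simps)
  finally have key: "exp 1 * real n ^ Suc n \<le> real (Suc n) ^ Suc n" .
  have "fact (Suc n) = real (Suc n) * fact n" by simp
  also have "\<dots> \<le> real (Suc n) * (exp 1 * real n * (real n / exp 1) ^ n)" using step by (intro mult_left_mono) auto
  also have "\<dots> = real (Suc n) * (exp 1 * real n ^ Suc n) / exp 1 ^ n" by (simp add: power_divide)
  also have "\<dots> \<le> real (Suc n) * real (Suc n) ^ Suc n / exp 1 ^ n"
    by (intro divide_right_mono mult_left_mono key) auto
  also have "\<dots> = exp 1 * real (Suc n) * (real (Suc n) / exp 1) ^ Suc n" by (simp add: power_divide)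
  finally show ?case .
qed

text \<open>The quantity n! / y^n is smallest for n near y, where the previous bound gives e^2 y
  exp(-y). The factor y is absorbed by lowering the exponential rate from 1 to 2 c, at the price 1 /
  (1 - 2 c).\<close>

lemma fact_power_floor_le:
  fixes y :: real
  assumes c: "0 < c" "c < 1 / 2" and y: "y \<ge> 1"
  shows "fact (nat \<lfloor>y\<rfloor>) * (1 / y) ^ nat \<lfloor>y\<rfloor> \<le> exp 2 / (1 - 2 * c) * exp (- 2 * c * y)"
proof -
  define n where "n = nat \<lfloor>y\<rfloor>"
  have n: "n \<ge> 1" "real n \<le> y" "y \<le> real n + 1" using y by (auto simp: n_def le_nat_iff)
  have "fact n * (1 / y) ^ n \<le> (exp 1 * real n * (real n / exp 1) ^ n) * (1 / real n) ^ n"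
    using n y by (intro mult_mono fact_le_exp_bound power_mono frac_le) auto
  also have "\<dots> = exp 1 * real n * exp (- real n)"
  proof -
    have "(real n / exp 1) ^ n * (1 / real n) ^ n = exp (- 1) ^ n"
      unfolding power_mult_distrib[symmetric] using n by (simp add: exp_minus inverse_eq_divide)
    also have "\<dots> = exp (- real n)" by (simp add: exp_of_nat_mult[symmetric])
    finally show ?thesis by (simp only: mult.assoc)
  qed
  also have "\<dots> \<le> exp 1 * y * exp (1 - y)"
    using n by (intro mult_mono) auto
  also have "\<dots> = exp 2 * (y * exp (- y))" by (simp add: exp_diff exp_minus divide_inverse mult_exp_exp)
  also have "\<dots> \<le> exp 2 * (exp (- 2 * c * y) / (1 - 2 * c))"
  proof (rule mult_left_mono)
    have "(1 - 2 * c) * y \<le> exp ((1 - 2 * c) * y)" using exp_ge_add_one_self[of "(1 - 2 * c) * y"] by linarith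
    then have "(1 - 2 * c) * y * exp (- y) \<le> exp ((1 - 2 * c) * y) * exp (- y)" by (intro mult_right_mono) auto
    also have "\<dots> = exp (- 2 * c * y)" by (simp add: mult_exp_exp algebra_simps)
    finally show "y * exp (- y) \<le> exp (- 2 * c * y) / (1 - 2 * c)" using c by (simp add: pos_le_divide_eq mult_ac)
  qed simp
  finally show ?thesis by (simp add: n_def)
qed

text \<open>The number j of derivatives grows with t, so a binomial row sum 2^j would spoil the
  estimate. Only five derivatives of the bump are non-zero, each at most 24, and (j choose i) (j -
  i)! <= j!, hence 120 for all j. At s = R the term i = 0 vanishes, which saves one power of
  \<nu>.\<close>

lemma leibniz_bump_fact_bound:
  assumes D: "\<And>i. i \<le> j \<Longrightarrow> norm (D i s) \<le> C * fact i * a * \<nu> ^ Suc i"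
    and s: "0 \<le> s" "s \<le> R" and R: "R \<ge> 1" and nn: "C \<ge> 0" "a \<ge> 0" "\<nu> \<ge> 1"
  shows "norm (leibniz (bump R) D j s) \<le> 120 * C * fact j * a * \<nu> ^ Suc j"
    and "s = R \<Longrightarrow> norm (leibniz (bump R) D j s) \<le> 120 * C * fact j * a * \<nu> ^ j"
proof -
  have gen: "norm (leibniz (bump R) D j s) \<le> 120 * C * fact j * a * \<nu> ^ l"
    if l: "\<And>i. i \<le> j \<Longrightarrow> bump R i s = 0 \<or> Suc (j - i) \<le> l" for l
  proof -
    have "norm (leibniz (bump R) D j s) \<le> (\<Sum>i\<le>j. real (j choose i) * \<bar>bump R i s\<bar> * norm (D (j - i) s))" by (rule norm_leibniz_le)
    also have "\<dots> \<le> (\<Sum>i\<le>j. (if i < 5 then 24 else 0) * (C * fact j * a * \<nu> ^ l))"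
    proof (rule sum_mono)
      fix i assume "i \<in> {..j}"
      then have i: "i \<le> j" by simp
      show "real (j choose i) * \<bar>bump R i s\<bar> * norm (D (j - i) s) \<le> (if i < 5 then 24 else 0) * (C * fact j * a * \<nu> ^ l)"
      proof (cases "i < 5 \<and> bump R i s \<noteq> 0")
        case False
        then have "bump R i s = 0"
        proof (cases i rule: nat_cases_5)
          case (6 j) then show ?thesis by (simp add: bump_simps)
        qed auto
        then show ?thesis using nn by simp
      next
        case True
        have "\<bar>bump R i s\<bar> \<le> 24 / R ^ i" using s R by (intro abs_bump_le) auto
        also have "\<dots> \<le> 24 / 1" using R by (intro divide_left_mono) auto
        finally have b: "\<bar>bump R i s\<bar> \<le> 24" by simp
        have "norm (D (j - i) s) \<le> C * fact (j - i) * a * \<nu> ^ Suc (j - i)" using D[of "j - i"] by simp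
        also have "\<dots> \<le> C * fact (j - i) * a * \<nu> ^ l"
          using l[OF i] True nn by (intro mult_left_mono power_increasing) auto
        finally have d: "norm (D (j - i) s) \<le> C * fact (j - i) * a * \<nu> ^ l" .
        have bf: "real (j choose i) * fact (j - i) \<le> fact j"
        proof -
          have "real (j choose i) * fact (j - i) = fact j / fact i" using binomial_fact[OF i, where 'a = real] by simp
          also have "\<dots> \<le> fact j / 1" by (intro divide_left_mono fact_ge_1) auto
          finally show ?thesis by simp
        qed
        have "real (j choose i) * \<bar>bump R i s\<bar> * norm (D (j - i) s) \<le> real (j choose i) * 24 * (C * fact (j - i) * a * \<nu> ^ l)"
          using b d by (intro mult_mono) auto
        also have "\<dots> = 24 * (real (j choose i) * fact (j - i)) * (C * a * \<nu> ^ l)" by simp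
        also have "\<dots> \<le> 24 * fact j * (C * a * \<nu> ^ l)" using bf nn by (intro mult_right_mono mult_left_mono) auto
        finally show ?thesis using True by (simp add: mult_ac)
      qed
    qed
    also have "\<dots> = (\<Sum>i\<le>j. if i < 5 then 24 else 0) * (C * fact j * a * \<nu> ^ l)" by (simp only: sum_distrib_right)
    also have "\<dots> \<le> 120 * (C * fact j * a * \<nu> ^ l)"
    proof (rule mult_right_mono)
      have "(\<Sum>i\<le>j. if i < 5 then 24 else (0::real)) = (\<Sum>i\<in>{..j} \<inter> {..<5}. 24)"
        by (subst sum.inter_restrict) (auto intro!: sum.cong)
      also have "\<dots> \<le> (\<Sum>i\<in>{..<5::nat}. 24)" by (intro sum_mono2) auto
      finally show "(\<Sum>i\<le>j. if i < 5 then 24 else (0::real)) \<le> 120" by simp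
    qed (use nn in auto)
    finally show ?thesis by (simp add: mult_ac)
  qed
  show "norm (leibniz (bump R) D j s) \<le> 120 * C * fact j * a * \<nu> ^ Suc j" by (rule gen) simp
  show "norm (leibniz (bump R) D j s) \<le> 120 * C * fact j * a * \<nu> ^ j" if "s = R"
  proof (rule gen)
    fix i assume "i \<le> j"
    consider "i = 0" | "i \<ge> 1" by linarith
    then show "bump R i s = 0 \<or> Suc (j - i) \<le> j"
      by cases (use that bump_zero_end(1)[of R] R \<open>i \<le> j\<close> in auto)
  qed
qed

text \<open>The complement of the trapezoid on [\<epsilon>, 2 \<epsilon>], as a chain of
  derivatives.\<close>

definition ramp :: "real \<Rightarrow> nat \<Rightarrow> real \<Rightarrow> real" where
  "ramp \<epsilon> i s = (if i = 0 then s / \<epsilon> - 1 else if i = 1 then 1 / \<epsilon> else 0)"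

lemma has_vector_derivative_ramp: "(ramp \<epsilon> i has_vector_derivative ramp \<epsilon> (Suc i) s) (at s within S)"
proof -
  have e: "ramp \<epsilon> 0 = (\<lambda>s. s / \<epsilon> - 1)" "ramp \<epsilon> (Suc 0) = (\<lambda>s. 1 / \<epsilon>)" "ramp \<epsilon> (Suc (Suc j)) = (\<lambda>s. 0)" for j
    by (rule ext, simp add: ramp_def)+
  have "((\<lambda>s. s / \<epsilon> - 1) has_real_derivative 1 / \<epsilon> - 0) (at s within S)"
    by (intro DERIV_diff DERIV_cdivide DERIV_ident DERIV_const)
  then have 0: "(ramp \<epsilon> 0 has_real_derivative ramp \<epsilon> (Suc 0) s) (at s within S)" unfolding e by simp
  consider "i = 0" | "i = Suc 0" | j where "i = Suc (Suc j)" by (cases i; cases "i - 1") auto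
  then have "(ramp \<epsilon> i has_real_derivative ramp \<epsilon> (Suc i) s) (at s within S)"
    by cases (use 0 in \<open>simp_all only: e DERIV_const\<close>)
  then show ?thesis by (simp add: has_real_derivative_iff_has_vector_derivative)
qed

text \<open>The ramp is linear, so at most one derivative falls on it. That derivative costs 1 /
  \<epsilon>, which the factor s <= 2 \<epsilon> in the bound for \<open>E\<close> compensates, and
  j (j - 1)! = j! preserves the factorial growth.\<close>

lemma leibniz_ramp_fact_bound:
  assumes E: "\<And>i. i \<le> j \<Longrightarrow> norm (E i s) \<le> C * fact i * s * \<mu> ^ Suc i"
    and s: "\<epsilon> \<le> s" "s \<le> 2 * \<epsilon>" and \<epsilon>: "0 < \<epsilon>" and nn: "C \<ge> 0" "\<mu> \<ge> 0"
  shows "norm (leibniz (ramp \<epsilon>) E j s) \<le> 2 * C * fact j * \<mu> ^ j * (\<epsilon> * \<mu> + 1)"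
proof -
  have r: "0 \<le> ramp \<epsilon> 0 s" "ramp \<epsilon> 0 s \<le> 1" "ramp \<epsilon> 1 s = 1 / \<epsilon>" using s \<epsilon>
    by (auto simp: ramp_def pos_le_divide_eq pos_divide_le_eq)
  have e: "leibniz (ramp \<epsilon>) E j s = ramp \<epsilon> 0 s *\<^sub>R E j s + (if j = 0 then 0 else (real j / \<epsilon>) *\<^sub>R E (j - 1) s)"
  proof (cases j)
    case 0 then show ?thesis by (simp add: leibniz_def)
  next
    case (Suc l)
    have "leibniz (ramp \<epsilon>) E j s = ramp \<epsilon> 0 s *\<^sub>R E j s + (\<Sum>i\<le>l. (real (Suc l choose Suc i) * ramp \<epsilon> (Suc i) s) *\<^sub>R E (l - i) s)"
      unfolding leibniz_def Suc by (subst sum.atMost_Suc_shift) simp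
    also have "(\<Sum>i\<le>l. (real (Suc l choose Suc i) * ramp \<epsilon> (Suc i) s) *\<^sub>R E (l - i) s) = (\<Sum>i\<in>{0}. (real (Suc l choose Suc i) * ramp \<epsilon> (Suc i) s) *\<^sub>R E (l - i) s)"
      by (rule sum.mono_neutral_right) (auto simp: ramp_def)
    finally show ?thesis using Suc r(3) by simp
  qed
  have "norm (ramp \<epsilon> 0 s *\<^sub>R E j s) \<le> 1 * (C * fact j * (2 * \<epsilon>) * \<mu> ^ Suc j)"
    unfolding norm_scaleR
  proof (rule mult_mono)
    have "norm (E j s) \<le> C * fact j * s * \<mu> ^ Suc j" by (rule E) simp
    also have "\<dots> \<le> C * fact j * (2 * \<epsilon>) * \<mu> ^ Suc j" using s nn by (intro mult_right_mono mult_left_mono) auto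
    finally show "norm (E j s) \<le> C * fact j * (2 * \<epsilon>) * \<mu> ^ Suc j" .
  qed (use r in auto)
  moreover have "norm (if j = 0 then 0 else (real j / \<epsilon>) *\<^sub>R E (j - 1) s) \<le> 2 * C * fact j * \<mu> ^ j"
  proof (cases j)
    case 0 then show ?thesis using nn by simp
  next
    case (Suc l)
    have "norm (E l s) \<le> C * fact l * s * \<mu> ^ Suc l" using E[of l] Suc by simp
    also have "\<dots> \<le> C * fact l * (2 * \<epsilon>) * \<mu> ^ Suc l" using s nn by (intro mult_right_mono mult_left_mono) auto
    finally have "real j / \<epsilon> * norm (E l s) \<le> real j / \<epsilon> * (C * fact l * (2 * \<epsilon>) * \<mu> ^ Suc l)"
      using \<epsilon> by (intro mult_left_mono) auto
    also have "\<dots> = 2 * C * (real j * fact l) * \<mu> ^ j" using \<epsilon> Suc by simp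
    also have "real j * fact l = fact j" using Suc by simp
    finally show ?thesis using Suc \<epsilon> by simp
  qed
  ultimately have "norm (leibniz (ramp \<epsilon>) E j s) \<le> 1 * (C * fact j * (2 * \<epsilon>) * \<mu> ^ Suc j) + 2 * C * fact j * \<mu> ^ j"
    unfolding e by (rule norm_triangle_mono)
  then show ?thesis by (simp add: algebra_simps)
qed

text \<open>Boundary terms of size j! \<mu>^j / t^(j+1) keep decreasing as long as j \<mu> <= t. The
  condition on n stops the integrations by parts in that range, where the terms sum to at most four
  times the first.\<close>

lemma oscillatory_bound_const:
  fixes H :: "nat \<Rightarrow> real \<Rightarrow> 'a::complex_banach"
  assumes "a \<le> b" "\<bar>\<tau>\<bar> = t" "t > 0"
    and "\<And>j s. s \<in> {a..b} \<Longrightarrow> (H j has_vector_derivative H (Suc j) s) (at s within {a..b})"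
    and bd: "\<And>j. j < n \<Longrightarrow> norm (H j a) + norm (H j b) \<le> Q * (fact j * \<mu> ^ j)"
    and N: "\<And>s. s \<in> {a..b} \<Longrightarrow> norm (H n s) \<le> N"
    and \<mu>: "\<mu> \<ge> 0" "n * \<mu> \<le> t" and Q: "Q \<ge> 0"
  shows "norm (integral {a..b} (\<lambda>s. cis (\<tau> * s) *\<^sub>C H 0 s)) \<le> 4 * Q / t + (b - a) * N / t ^ n"
proof -
  have Hc: "continuous_on {a..b} (H n)" using assms(4) by (rule continuous_on_vector_derivative)
  have "norm (integral {a..b} (\<lambda>s. cis (\<tau> * s) *\<^sub>C H 0 s)) \<le> (\<Sum>j<n. (norm (H j a) + norm (H j b)) / \<bar>\<tau>\<bar> ^ Suc j)
      + integral {a..b} (\<lambda>s. norm (H n s)) / \<bar>\<tau>\<bar> ^ n"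
    using assms Hc by (intro oscillatory_integral_bound) auto
  also have "(\<Sum>j<n. (norm (H j a) + norm (H j b)) / \<bar>\<tau>\<bar> ^ Suc j) \<le> (\<Sum>j<n. Q / t * (fact j * (\<mu> / t) ^ j))"
  proof (rule sum_mono)
    fix j assume "j \<in> {..<n}"
    then have "(norm (H j a) + norm (H j b)) / \<bar>\<tau>\<bar> ^ Suc j \<le> Q * (fact j * \<mu> ^ j) / \<bar>\<tau>\<bar> ^ Suc j"
      by (intro divide_right_mono bd) auto
    then show "(norm (H j a) + norm (H j b)) / \<bar>\<tau>\<bar> ^ Suc j \<le> Q / t * (fact j * (\<mu> / t) ^ j)"
      using assms by (simp add: power_divide)
  qed
  also have "\<dots> = Q / t * (\<Sum>j<n. fact j * (\<mu> / t) ^ j)" by (simp only: sum_distrib_left)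
  also have "\<dots> \<le> Q / t * 4" using assms by (intro mult_left_mono sum_fact_power_le) auto
  also have "integral {a..b} (\<lambda>s. norm (H n s)) \<le> integral {a..b} (\<lambda>s. N)"
    using N by (intro integral_le integrable_continuous_interval continuous_intros Hc) auto
  then have "integral {a..b} (\<lambda>s. norm (H n s)) / \<bar>\<tau>\<bar> ^ n \<le> (b - a) * N / t ^ n"
    unfolding assms(2) using assms(1,3) by (intro divide_right_mono) auto
  finally show ?thesis by (simp add: mult.commute)
qed

text \<open>The integral is split at the kink 2 \<epsilon> and at 1, with n1 integrations by parts
  below 1 and n2 above. The split at 1 creates boundary terms there. Estimated with \<mu> or M they
  would be of size \<mu> / t or M / t, hence the separate bound at 1 with a constant \<kappa> below
  both. The factor 4800 is 40 * 120.\<close>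

lemma analytic_integral_bound:
  fixes D :: "nat \<Rightarrow> real \<Rightarrow> 'a::complex_banach"
  assumes Dd: "\<And>j s. s > 0 \<Longrightarrow> (D j has_vector_derivative D (Suc j) s) (at s)"
    and Dlow: "\<And>j s. \<epsilon> \<le> s \<Longrightarrow> s \<le> 1 \<Longrightarrow> norm (D j s) \<le> C * fact j * s * \<mu> ^ Suc j"
    and Dhigh: "\<And>j s. 1 \<le> s \<Longrightarrow> s \<le> R \<Longrightarrow> norm (D j s) \<le> C * fact j * M ^ Suc j"
    and D1: "\<And>j. norm (D j 1) \<le> C * fact j * \<kappa> ^ Suc j"
    and \<epsilon>: "0 < \<epsilon>" "2 * \<epsilon> \<le> 1" and R: "1 \<le> R" and \<kappa>: "1 \<le> \<kappa>" "\<kappa> \<le> \<mu>" "\<kappa> \<le> M" and C: "C > 0"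
    and \<tau>: "\<bar>\<tau>\<bar> = t" "t > 0" and n: "n1 * \<mu> \<le> t" "n2 * M \<le> t"
  shows "norm (integral {\<epsilon>..R} (\<lambda>s. cis (\<tau> * s) *\<^sub>C ((bump R 0 s * (1 - low_profile \<epsilon> (2 * \<epsilon>) (trapezoid \<epsilon>) s)) *\<^sub>R D 0 s)))
    \<le> 4800 * C * \<kappa> * ((\<epsilon> * \<mu> + 1) / t + \<mu> * (fact n1 * (\<mu> / t) ^ n1) + R * M * (fact n2 * (M / t) ^ n2))"
proof -
  define E where "E = leibniz (bump R) D"
  define K where "K = leibniz (ramp \<epsilon>) E"
  define B where "B = 120 * C"
  have B: "B > 0" using C by (simp add: B_def)
  have \<mu>: "\<mu> \<ge> 1" and M: "M \<ge> 1" using \<kappa> by auto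
  have Ed: "(E j has_vector_derivative E (Suc j) s) (at s within S)" if "s > 0" for j s S
    unfolding E_def using that R
    by (intro has_vector_derivative_leibniz has_vector_derivative_bump has_vector_derivative_at_within[OF Dd]) auto
  have Kd: "(K j has_vector_derivative K (Suc j) s) (at s within S)" if "s > 0" for j s S
    unfolding K_def using that by (intro has_vector_derivative_leibniz has_vector_derivative_ramp Ed)
  have Elow: "norm (E j s) \<le> B * fact j * s * \<mu> ^ Suc j" if "\<epsilon> \<le> s" "s \<le> 1" for j s
    unfolding E_def B_def using that \<epsilon> R C \<mu> by (intro leibniz_bump_fact_bound(1) Dlow) auto
  have Ehigh: "norm (E j s) \<le> B * fact j * M ^ Suc j" if "1 \<le> s" "s \<le> R" for j s
    using leibniz_bump_fact_bound(1)[of j D s C 1 M R] Dhigh[OF that] that R C M by (simp add: E_def B_def)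
  have E1: "norm (E j 1) \<le> B * fact j * \<kappa> ^ Suc j" for j
    using leibniz_bump_fact_bound(1)[of j D 1 C 1 \<kappa> R] D1 R C \<kappa> by (simp add: E_def B_def)
  have ER: "norm (E j R) \<le> B * fact j * M ^ j" for j
    using leibniz_bump_fact_bound(2)[of j D R C 1 M R] Dhigh[of R] R C M by (simp add: E_def B_def)
  have Klow: "norm (K j s) \<le> 2 * B * fact j * \<mu> ^ j * (\<epsilon> * \<mu> + 1)" if "\<epsilon> \<le> s" "s \<le> 2 * \<epsilon>" for j s
    unfolding K_def using that \<epsilon> B \<mu> by (intro leibniz_ramp_fact_bound Elow) auto
  \<comment> \<open>One power of \<kappa> is kept as a constant; the others are enlarged to \<mu> or
    M to fit the factorial sum.\<close>
  have kp: "\<kappa> ^ Suc j \<le> \<kappa> * \<mu> ^ j" "\<kappa> ^ Suc j \<le> \<kappa> * M ^ j" for j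
    using \<kappa> by (auto intro!: mult_left_mono power_mono)
  let ?w = "\<lambda>s. bump R 0 s * (1 - low_profile \<epsilon> (2 * \<epsilon>) (trapezoid \<epsilon>) s)"
  let ?I = "\<lambda>u v. integral {u..v} (\<lambda>s. cis (\<tau> * s) *\<^sub>C (?w s *\<^sub>R D 0 s))"
  have wi: "?w s *\<^sub>R D 0 s = K 0 s" if "s \<in> {\<epsilon>..2 * \<epsilon>}" for s
    using that \<epsilon> by (auto simp: K_def E_def leibniz_def low_profile_def trapezoid_def ramp_def mult.commute)
  have wo: "?w s *\<^sub>R D 0 s = E 0 s" if "s \<ge> 2 * \<epsilon>" for s
    using that \<epsilon> by (auto simp: E_def leibniz_def low_profile_def trapezoid_def)
  have p1: "?I \<epsilon> (2 * \<epsilon>) = integral {\<epsilon>..2 * \<epsilon>} (\<lambda>s. cis (\<tau> * s) *\<^sub>C K 0 s)"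
    by (intro integral_cong) (simp only: wi)
  have p2: "?I (2 * \<epsilon>) 1 = integral {2 * \<epsilon>..1} (\<lambda>s. cis (\<tau> * s) *\<^sub>C E 0 s)"
    by (intro integral_cong) (simp add: wo)
  have p3: "?I 1 R = integral {1..R} (\<lambda>s. cis (\<tau> * s) *\<^sub>C E 0 s)"
    using \<epsilon> by (intro integral_cong) (simp add: wo)
  have ii: "(\<lambda>s. cis (\<tau> * s) *\<^sub>C (?w s *\<^sub>R D 0 s)) integrable_on {\<epsilon>..R}"
  proof -
    have Kc: "continuous_on {\<epsilon>..2 * \<epsilon>} (K 0)" using \<epsilon> by (intro continuous_on_vector_derivative[OF Kd]) auto
    have Ec: "continuous_on {2 * \<epsilon>..R} (E 0)" using \<epsilon> by (intro continuous_on_vector_derivative[OF Ed]) auto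
    have "(\<lambda>s. cis (\<tau> * s) *\<^sub>C (?w s *\<^sub>R D 0 s)) integrable_on {\<epsilon>..2 * \<epsilon>}"
      by (rule integrable_eq[of "\<lambda>s. cis (\<tau> * s) *\<^sub>C K 0 s"])
         (auto intro!: integrable_continuous_interval continuous_intros Kc simp: wi[simplified])
    moreover have "(\<lambda>s. cis (\<tau> * s) *\<^sub>C (?w s *\<^sub>R D 0 s)) integrable_on {2 * \<epsilon>..R}"
      by (rule integrable_eq[of "\<lambda>s. cis (\<tau> * s) *\<^sub>C E 0 s"])
         (auto intro!: integrable_continuous_interval continuous_intros Ec simp: wo)
    ultimately show ?thesis using \<epsilon> R by (intro Henstock_Kurzweil_Integration.integrable_combine[of \<epsilon> "2 * \<epsilon>" R]) auto
  qed
  have split: "?I \<epsilon> R = ?I \<epsilon> (2 * \<epsilon>) + ?I (2 * \<epsilon>) 1 + ?I 1 R"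
  proof -
    have "?I \<epsilon> (2 * \<epsilon>) + ?I (2 * \<epsilon>) R = ?I \<epsilon> R"
      using \<epsilon> R by (intro integral_combine_interval ii) auto
    moreover have "?I (2 * \<epsilon>) 1 + ?I 1 R = ?I (2 * \<epsilon>) R"
      using \<epsilon> R by (intro integral_combine_interval integrable_subinterval_real[OF ii]) auto
    ultimately show ?thesis by (simp add: add.assoc)
  qed
  define q1 where "q1 = fact n1 * (\<mu> / t) ^ n1"
  define q2 where "q2 = fact n2 * (M / t) ^ n2"
  have q0: "q1 \<ge> 0" "q2 \<ge> 0" using \<mu> M \<tau> by (auto simp: q1_def q2_def)
  define y where "y = (\<epsilon> * \<mu> + 1) / t"
  have y: "y \<ge> 0" "1 / t \<le> y" using \<epsilon> \<mu> \<tau> by (auto simp: y_def divide_right_mono)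
  have I1: "norm (?I \<epsilon> (2 * \<epsilon>)) \<le> 16 * B * y + 4 * B * (\<mu> * q1)"
  proof -
    have "norm (?I \<epsilon> (2 * \<epsilon>)) \<le> 4 * (4 * B * (\<epsilon> * \<mu> + 1)) / t + (2 * \<epsilon> - \<epsilon>) * (2 * B * fact n1 * \<mu> ^ n1 * (\<epsilon> * \<mu> + 1)) / t ^ n1"
      unfolding p1
    proof (rule oscillatory_bound_const[OF _ \<tau>, where \<mu> = \<mu>])
      fix j
      show "norm (K j \<epsilon>) + norm (K j (2 * \<epsilon>)) \<le> 4 * B * (\<epsilon> * \<mu> + 1) * (fact j * \<mu> ^ j)"
      proof -
        have "norm (K j \<epsilon>) + norm (K j (2 * \<epsilon>)) \<le> 2 * (2 * B * fact j * \<mu> ^ j * (\<epsilon> * \<mu> + 1))"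
          using Klow[of \<epsilon> j] Klow[of "2 * \<epsilon>" j] \<epsilon> by linarith
        also have "\<dots> = 4 * B * (\<epsilon> * \<mu> + 1) * (fact j * \<mu> ^ j)" by (simp add: algebra_simps)
        finally show ?thesis .
      qed
    qed (use \<epsilon> B \<mu> n in \<open>auto intro!: Kd Klow mult_nonneg_nonneg\<close>)
    also have "4 * (4 * B * (\<epsilon> * \<mu> + 1)) / t = 16 * B * y" by (simp add: y_def)
    also have "(2 * \<epsilon> - \<epsilon>) * (2 * B * fact n1 * \<mu> ^ n1 * (\<epsilon> * \<mu> + 1)) / t ^ n1 = 2 * B * q1 * (\<epsilon> * (\<epsilon> * \<mu> + 1))"
      by (simp add: q1_def power_divide)
    also have "\<dots> \<le> 2 * B * q1 * (1 * (1 * \<mu> + \<mu>))"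
      using \<epsilon> B q0 \<mu> by (intro mult_left_mono mult_mono add_mono mult_right_mono) auto
    finally show ?thesis by (simp add: mult_ac)
  qed
  have I2: "norm (?I (2 * \<epsilon>) 1) \<le> (8 + 4 * \<kappa>) * B * y + B * (\<mu> * q1)"
  proof -
    have "norm (?I (2 * \<epsilon>) 1) \<le> 4 * (B * (2 * \<epsilon> * \<mu> + \<kappa>)) / t + (1 - 2 * \<epsilon>) * (B * fact n1 * \<mu> ^ Suc n1) / t ^ n1"
      unfolding p2
    proof (rule oscillatory_bound_const[OF _ \<tau>, where \<mu> = \<mu>])
      fix j
      have "norm (E j (2 * \<epsilon>)) \<le> B * fact j * (2 * \<epsilon>) * \<mu> ^ Suc j" using \<epsilon> by (intro Elow) auto
      moreover have "norm (E j 1) \<le> B * fact j * (\<kappa> * \<mu> ^ j)"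
        using kp(1)[of j] B by (intro order_trans[OF E1] mult_left_mono) auto
      ultimately show "norm (E j (2 * \<epsilon>)) + norm (E j 1) \<le> B * (2 * \<epsilon> * \<mu> + \<kappa>) * (fact j * \<mu> ^ j)"
        by (simp add: algebra_simps)
    next
      fix s assume s: "s \<in> {2 * \<epsilon>..1}"
      have "norm (E n1 s) \<le> B * fact n1 * s * \<mu> ^ Suc n1" using s \<epsilon> by (intro Elow) auto
      also have "\<dots> \<le> B * fact n1 * 1 * \<mu> ^ Suc n1" using s \<mu> B by (intro mult_right_mono mult_left_mono) auto
      finally show "norm (E n1 s) \<le> B * fact n1 * \<mu> ^ Suc n1" by simp
    qed (use \<epsilon> B \<mu> \<kappa> n in \<open>auto intro!: Ed mult_nonneg_nonneg\<close>)
    also have "(1 - 2 * \<epsilon>) * (B * fact n1 * \<mu> ^ Suc n1) / t ^ n1 = (1 - 2 * \<epsilon>) * (B * (\<mu> * q1))"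
      by (simp add: q1_def power_divide)
    also have "\<dots> \<le> 1 * (B * (\<mu> * q1))" using \<epsilon> B \<mu> q0 by (intro mult_right_mono) auto
    also have "4 * (B * (2 * \<epsilon> * \<mu> + \<kappa>)) / t \<le> 4 * (B * ((2 + \<kappa>) * (\<epsilon> * \<mu> + 1))) / t"
    proof (intro divide_right_mono mult_left_mono)
      have "0 \<le> \<kappa> * (\<epsilon> * \<mu>)" using \<kappa> \<epsilon> \<mu> by simp
      then show "2 * \<epsilon> * \<mu> + \<kappa> \<le> (2 + \<kappa>) * (\<epsilon> * \<mu> + 1)" by (simp add: algebra_simps)
    qed (use B \<tau> in auto)
    also have "4 * (B * ((2 + \<kappa>) * (\<epsilon> * \<mu> + 1))) / t = (8 + 4 * \<kappa>) * B * y"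
    proof -
      have "4 * (B * ((2 + \<kappa>) * v)) = (8 + 4 * \<kappa>) * B * v" for v by (simp add: algebra_simps)
      then show ?thesis unfolding y_def times_divide_eq_right by simp
    qed
    finally show ?thesis by simp
  qed
  have I3: "norm (?I 1 R) \<le> (4 + 4 * \<kappa>) * B * y + B * (R * M * q2)"
  proof -
    have "norm (?I 1 R) \<le> 4 * (B * (\<kappa> + 1)) / t + (R - 1) * (B * fact n2 * M ^ Suc n2) / t ^ n2"
      unfolding p3
    proof (rule oscillatory_bound_const[OF _ \<tau>, where \<mu> = M])
      fix j
      have "norm (E j 1) \<le> B * fact j * (\<kappa> * M ^ j)"
        using kp(2)[of j] B by (intro order_trans[OF E1] mult_left_mono) auto
      then show "norm (E j 1) + norm (E j R) \<le> B * (\<kappa> + 1) * (fact j * M ^ j)"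
        using ER[of j] by (simp add: algebra_simps)
    next
      fix s assume s: "s \<in> {1..R}"
      then show "norm (E n2 s) \<le> B * fact n2 * M ^ Suc n2" by (intro Ehigh) auto
    qed (use R B M \<kappa> n in \<open>auto intro!: Ed mult_nonneg_nonneg\<close>)
    also have "(R - 1) * (B * fact n2 * M ^ Suc n2) / t ^ n2 = (R - 1) * (B * (M * q2))"
      by (simp add: q2_def power_divide)
    also have "\<dots> \<le> R * (B * (M * q2))" using B M q0 by (intro mult_right_mono) auto
    also have "4 * (B * (\<kappa> + 1)) / t = 4 * B * (\<kappa> + 1) * (1 / t)" by simp
    also have "\<dots> \<le> 4 * B * (\<kappa> + 1) * y" using B \<kappa> y by (intro mult_left_mono) auto
    finally show ?thesis by (simp add: algebra_simps)
  qed
  have "norm (?I \<epsilon> R) \<le> norm (?I \<epsilon> (2 * \<epsilon>)) + norm (?I (2 * \<epsilon>) 1) + norm (?I 1 R)"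
    unfolding split by (intro norm_triangle_mono norm_triangle_ineq order_refl)
  also have "\<dots> \<le> (28 + 8 * \<kappa>) * B * y + 5 * B * (\<mu> * q1) + B * (R * M * q2)"
    using I1 I2 I3 by (simp add: algebra_simps)
  also have "\<dots> \<le> 40 * \<kappa> * B * y + 40 * \<kappa> * B * (\<mu> * q1) + 40 * \<kappa> * B * (R * M * q2)"
    using B \<kappa> y q0 \<mu> M R by (intro add_mono mult_right_mono) auto
  also have "\<dots> = 4800 * C * \<kappa> * (y + \<mu> * q1 + R * M * q2)" by (simp add: B_def algebra_simps)
  finally show ?thesis by (simp add: y_def q1_def q2_def)
qed

section \<open>Decay rates\<close>

lemma inv_small_properties:
  fixes g :: "real \<Rightarrow> real"
  assumes g: "continuous_on {0<..1} g" and dec: "\<And>x y. 0 < x \<Longrightarrow> x < y \<Longrightarrow> y \<le> 1 \<Longrightarrow> g y < g x"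
    and unb: "\<And>y. \<exists>r\<in>{0<..1}. g r \<ge> y" and y: "y \<ge> g 1"
  shows "inv_small g y \<in> {0<..1}" "g (inv_small g y) = y"
proof -
  have inj: "inj_on g {0<..1}"
  proof (rule inj_onI)
    fix u v assume "u \<in> {0<..1}" "v \<in> {0<..1}" "g u = g v"
    then show "u = v" using dec[of u v] dec[of v u] by (cases u v rule: linorder_cases) auto
  qed
  obtain r where r: "r \<in> {0<..1}" "g r \<ge> y" using unb by blast
  have "continuous_on {r..1} g" using r by (intro continuous_on_subset[OF g]) auto
  then obtain x where "r \<le> x" "x \<le> 1" "g x = y" using IVT2'[of g 1 y r] y r by auto
  then have "y \<in> g ` {0<..1}" using r by force
  then show "inv_small g y \<in> {0<..1}" "g (inv_small g y) = y"
    unfolding inv_small_def using the_inv_into_into[OF inj _ order_refl] f_the_inv_into_f[OF inj] by auto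
qed

lemma inv_large_properties:
  fixes g :: "real \<Rightarrow> real"
  assumes g: "continuous_on {1..} g" and inc: "\<And>x y. 1 \<le> x \<Longrightarrow> x < y \<Longrightarrow> g x < g y"
    and unb: "\<And>y. \<exists>r\<in>{1..}. g r \<ge> y" and y: "y \<ge> g 1"
  shows "inv_large g y \<in> {1..}" "g (inv_large g y) = y"
proof -
  have inj: "inj_on g {1..}"
  proof (rule inj_onI)
    fix u v assume "u \<in> {1..}" "v \<in> {1..}" "g u = g v"
    then show "u = v" using inc[of u v] inc[of v u] by (cases u v rule: linorder_cases) auto
  qed
  obtain r where r: "r \<in> {1..}" "g r \<ge> y" using unb by blast
  have "continuous_on {1..r} g" using r by (intro continuous_on_subset[OF g]) auto
  then obtain x where "1 \<le> x" "x \<le> r" "g x = y" using IVT'[of g 1 y r] y r by auto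
  then have "y \<in> g ` {1..}" by force
  then show "inv_large g y \<in> {1..}" "g (inv_large g y) = y"
    unfolding inv_large_def using the_inv_into_into[OF inj _ order_refl] f_the_inv_into_f[OF inj] by auto
qed

locale growth_functions =
  fixes m M :: "real \<Rightarrow> real"
  assumes mc: "continuous_on {0<..1} m" and mdec: "\<And>x y. 0 < x \<Longrightarrow> x \<le> y \<Longrightarrow> y \<le> 1 \<Longrightarrow> m y \<le> m x"
    and m1: "\<And>r. 0 < r \<Longrightarrow> r \<le> 1 \<Longrightarrow> 1 \<le> m r"
    and Mc: "continuous_on {1..} M" and Minc: "\<And>x y. 1 \<le> x \<Longrightarrow> x \<le> y \<Longrightarrow> M x \<le> M y"
    and M1: "\<And>R. 1 \<le> R \<Longrightarrow> 1 \<le> M R"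
begin

lemma quotient_decreasing: "0 < x \<Longrightarrow> x < y \<Longrightarrow> y \<le> 1 \<Longrightarrow> m y / y < m x / x"
proof -
  assume a: "0 < x" "x < y" "y \<le> 1"
  have "m y / y \<le> m x / y" using a mdec[of x y] by (intro divide_right_mono) auto
  also have "\<dots> < m x / x" using a m1[of x] by (intro divide_strict_left_mono) auto
  finally show ?thesis .
qed

lemma m_k_decreasing: "k \<ge> 1 \<Longrightarrow> 0 < x \<Longrightarrow> x < y \<Longrightarrow> y \<le> 1 \<Longrightarrow> m_k m k y < m_k m k x"
proof -
  assume a: "k \<ge> 1" "0 < x" "x < y" "y \<le> 1"
  have "(m y / y) powr (1 / real k) < (m x / x) powr (1 / real k)"
    using a m1[of y] by (intro powr_less_mono2 quotient_decreasing) auto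
  moreover have "0 < m y" "m y \<le> m x" using a m1[of y] mdec[of x y] by auto
  moreover have "0 \<le> (m y / y) powr (1 / real k)" by simp
  ultimately show ?thesis unfolding m_k_def by (intro mult_le_less_imp_less) auto
qed

lemma m_log_decreasing: "0 < x \<Longrightarrow> x < y \<Longrightarrow> y \<le> 1 \<Longrightarrow> m_log m y < m_log m x"
proof -
  assume a: "0 < x" "x < y" "y \<le> 1"
  have y0: "0 < m y / y" using a m1[of y] by auto
  then have "0 < ln (1 + m y / y)" by simp
  moreover have "ln (1 + m y / y) < ln (1 + m x / x)" using y0 quotient_decreasing[OF a] by simp
  moreover have "0 < m y" "m y \<le> m x" using a m1[of y] mdec[of x y] by auto
  ultimately show ?thesis unfolding m_log_def by (intro mult_le_less_imp_less) auto
qed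

lemma M_k_increasing: "k \<ge> 1 \<Longrightarrow> 1 \<le> x \<Longrightarrow> x < y \<Longrightarrow> M_k M k x < M_k M k y"
proof -
  assume a: "k \<ge> 1" "1 \<le> x" "x < y"
  have M: "1 \<le> M x" "M x \<le> M y" using a M1 Minc by auto
  have "(1 + x)^2 * M x < (1 + y)^2 * M y"
    using a M by (intro mult_less_le_imp_less power_strict_mono) auto
  moreover have "0 \<le> (1 + x)^2 * M x" using M by simp
  ultimately have "((1 + x)^2 * M x) powr (1 / real k) < ((1 + y)^2 * M y) powr (1 / real k)"
    using a by (intro powr_less_mono2) auto
  then show ?thesis unfolding M_k_def using M by (intro mult_le_less_imp_less) auto
qed

lemma M_log_increasing: "1 \<le> x \<Longrightarrow> x < y \<Longrightarrow> M_log M x < M_log M y"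
proof -
  assume a: "1 \<le> x" "x < y"
  have M: "1 \<le> M x" "M x \<le> M y" using a M1 Minc by auto
  have "ln (1 + x) + ln (M x) < ln (1 + y) + ln (M y)" using a M by (intro add_less_le_mono) auto
  moreover have "0 \<le> ln (1 + x) + ln (M x)" using a M by simp
  ultimately show ?thesis unfolding M_log_def using M by (intro mult_le_less_imp_less) auto
qed

lemma m_k_unbounded: assumes "k \<ge> 1" shows "\<exists>r\<in>{0<..1}. m_k m k r \<ge> y"
proof
  define z where "z = max y 1"
  \<comment> \<open>As m is at least 1, the k-th root of m(r) / r alone already reaches z at this
    r.\<close>
  define r where "r = 1 / z ^ k"
  have z: "z \<ge> 1" "z \<ge> y" by (auto simp: z_def)
  show r: "r \<in> {0<..1}" using z by (auto simp: r_def one_le_power)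
  have "z = (z ^ k) powr (1 / real k)" using z assms by (simp add: powr_realpow[symmetric] powr_powr)
  also have "\<dots> \<le> (m r / r) powr (1 / real k)"
    using z m1[of r] r by (intro powr_mono2) (auto simp: r_def mult_right_mono)
  also have "\<dots> \<le> m r * (m r / r) powr (1 / real k)" using m1[of r] r by (simp add: mult_right_mono)
  finally show "m_k m k r \<ge> y" using z by (simp add: m_k_def)
qed

lemma m_log_unbounded: "\<exists>r\<in>{0<..1}. m_log m r \<ge> y"
proof
  define z where "z = max y 0"
  define r where "r = exp (- z)"
  have z: "z \<ge> 0" "z \<ge> y" by (auto simp: z_def)
  show r: "r \<in> {0<..1}" using z by (auto simp: r_def)
  have mr: "m r \<ge> 1" using m1 r by simp
  have "exp z = 1 / r" by (simp add: r_def exp_minus inverse_eq_divide)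
  also have "1 / r \<le> 1 + m r / r" using divide_right_mono[OF mr, of r] r by simp
  finally have "ln (exp z) \<le> ln (1 + m r / r)" by (intro ln_mono) auto
  also have "\<dots> \<le> m r * ln (1 + m r / r)"
    using mult_right_mono[OF mr, of "ln (1 + m r / r)"] mr r by simp
  finally show "m_log m r \<ge> y" using z by (simp add: m_log_def)
qed

lemma M_k_unbounded: assumes "k \<ge> 1" shows "\<exists>r\<in>{1..}. M_k M k r \<ge> y"
proof
  define z where "z = max y 1"
  define r where "r = z ^ k"
  have z: "z \<ge> 1" "z \<ge> y" by (auto simp: z_def)
  show r: "r \<in> {1..}" using z by (auto simp: r_def one_le_power)
  have "z = (z ^ k) powr (1 / real k)" using z assms by (simp add: powr_realpow[symmetric] powr_powr)
  also have "\<dots> \<le> ((1 + r)^2 * M r) powr (1 / real k)"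
  proof (rule powr_mono2)
    have "r * 1 \<le> (1 + r)^2 * M r" using M1[of r] r by (intro mult_mono) (auto simp: power2_eq_square algebra_simps)
    then show "z ^ k \<le> (1 + r)^2 * M r" by (simp add: r_def)
  qed (use z in auto)
  also have "\<dots> \<le> M r * ((1 + r)^2 * M r) powr (1 / real k)" using M1[of r] r by (simp add: mult_right_mono)
  finally show "M_k M k r \<ge> y" using z by (simp add: M_k_def)
qed

lemma M_log_unbounded: "\<exists>r\<in>{1..}. M_log M r \<ge> y"
proof
  define z where "z = max y 0"
  define r where "r = exp z"
  have z: "z \<ge> 0" "z \<ge> y" by (auto simp: z_def)
  show r: "r \<in> {1..}" using z by (auto simp: r_def)
  have Mr: "M r \<ge> 1" using M1 r by simp
  have "z = ln r" by (simp add: r_def)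
  also have "\<dots> \<le> ln (1 + r) + ln (M r)" using r Mr by (intro order_trans[OF ln_mono[of r "1 + r"]]) auto
  also have "\<dots> \<le> M r * (ln (1 + r) + ln (M r))"
    using mult_right_mono[OF Mr, of "ln (1 + r) + ln (M r)"] Mr r by simp
  finally show "M_log M r \<ge> y" using z by (simp add: M_log_def)
qed

lemma continuous_on_m_k: "continuous_on {0<..1} (m_k m k)"
proof -
  have "m r / r > 0" if "r \<in> {0<..1}" for r using m1[of r] that by auto
  then show ?thesis unfolding m_k_def[abs_def] by (intro continuous_intros mc) (force simp: less_le)+
qed

lemma continuous_on_m_log: "continuous_on {0<..1} (m_log m)"
proof -
  have "1 + m r / r \<noteq> 0" if "r \<in> {0<..1}" for r
  proof -
    have "m r / r > 0" using m1[of r] that by auto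
    then show ?thesis by linarith
  qed
  then show ?thesis unfolding m_log_def[abs_def] by (intro continuous_intros mc) auto
qed

lemma continuous_on_M_k: "continuous_on {1..} (M_k M k)"
proof -
  have "(1 + R)^2 * M R > 0" if "R \<in> {1..}" for R using M1[of R] that by auto
  then show ?thesis unfolding M_k_def[abs_def] by (intro continuous_intros Mc) (force simp: less_le)+
qed

lemma continuous_on_M_log: "continuous_on {1..} (M_log M)"
proof -
  have "M R \<noteq> 0" if "R \<in> {1..}" for R using M1[of R] that by auto
  then show ?thesis unfolding M_log_def[abs_def] by (intro continuous_intros Mc) auto
qed

end

text \<open>The sign \<open>\<sigma>\<close> selects the half-line, so that both are treated as \<open>(0, \<infinity>)\<close>.\<close>

definition sided_deriv :: "(real \<Rightarrow> 'a::complex_banach) \<Rightarrow> real \<Rightarrow> nat \<Rightarrow> real \<Rightarrow> 'a" where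
  "sided_deriv F \<sigma> j s = \<sigma> ^ j *\<^sub>R nth_vderiv j F (\<sigma> * s)"

lemma norm_sided_deriv: "\<bar>\<sigma>\<bar> = 1 \<Longrightarrow> norm (sided_deriv F \<sigma> j s) = norm (nth_vderiv j F (\<sigma> * s))"
  by (simp add: sided_deriv_def power_abs)

lemma sided_deriv_0: "sided_deriv F \<sigma> 0 s = F (\<sigma> * s)"
  by (simp add: sided_deriv_def nth_vderiv_def)

lemma has_vector_derivative_sided_deriv:
  assumes "Ck_on k (- {0}) F" "j < k" "s \<noteq> 0" "\<bar>\<sigma>\<bar> = 1"
  shows "(sided_deriv F \<sigma> j has_vector_derivative sided_deriv F \<sigma> (Suc j) s) (at s)"
proof -
  have ns: "\<sigma> * s \<noteq> 0" using assms by auto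
  then have "nth_vderiv j F differentiable (at (\<sigma> * s))" using assms by (auto simp: Ck_on_def)
  then have d: "(nth_vderiv j F has_vector_derivative nth_vderiv (Suc j) F (\<sigma> * s)) (at (\<sigma> * s))"
    by (simp add: vector_derivative_works nth_vderiv_def)
  have "((\<lambda>s. \<sigma> * s) has_vector_derivative \<sigma>) (at s)"
    using DERIV_cmult_Id[of \<sigma> s UNIV] by (simp add: has_real_derivative_iff_has_vector_derivative)
  from vector_diff_chain_at[OF this d]
  have "((\<lambda>s. nth_vderiv j F (\<sigma> * s)) has_vector_derivative \<sigma> *\<^sub>R nth_vderiv (Suc j) F (\<sigma> * s)) (at s)"
    by (simp add: o_def)
  from bounded_linear.has_vector_derivative[OF bounded_linear_scaleR_right this, of "\<sigma> ^ j"]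
  show ?thesis by (simp add: sided_deriv_def[abs_def] mult.commute)
qed

lemma continuous_on_sided_deriv:
  assumes "Ck_on k (- {0}) F" "\<bar>\<sigma>\<bar> = 1"
  shows "continuous_on {0<..} (sided_deriv F \<sigma> k)"
proof -
  have "continuous_on (- {0}) (nth_vderiv k F)" using assms by (auto simp: Ck_on_def)
  then have "continuous_on {0<..} (\<lambda>s. nth_vderiv k F (\<sigma> * s))"
    by (rule continuous_on_compose2) (use assms(2) in \<open>auto intro!: continuous_intros\<close>)
  then show ?thesis unfolding sided_deriv_def[abs_def] by (intro continuous_intros)
qed

lemma two_sided_integral_bound:
  fixes F :: "real \<Rightarrow> 'a::complex_banach" and w :: "real \<Rightarrow> real"
  assumes w: "\<And>s. \<bar>s\<bar> < \<epsilon> \<or> \<bar>s\<bar> > R \<Longrightarrow> w \<bar>s\<bar> = 0" and \<epsilon>: "0 < \<epsilon>" "\<epsilon> < R"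
    and b: "\<And>\<sigma>. \<bar>\<sigma>\<bar> = 1 \<Longrightarrow> norm (integral {\<epsilon>..R} (\<lambda>s. cis (\<sigma> * t * s) *\<^sub>C (w s *\<^sub>R sided_deriv F \<sigma> 0 s))) \<le> Q"
  shows "norm (integral UNIV (\<lambda>s. (of_real (w \<bar>s\<bar>) * cis (t * s)) *\<^sub>C F s)) \<le> 2 * Q"
proof -
  let ?g = "\<lambda>s. (of_real (w \<bar>s\<bar>) * cis (t * s)) *\<^sub>C F s"
  have e: "(of_real x * z) *\<^sub>C v = z *\<^sub>C (x *\<^sub>R v)" for x z and v :: 'a
    by (metis mult.commute scaleC_of_real scaleC_scaleC)
  have "integral {\<epsilon>..R} ?g = integral {\<epsilon>..R} (\<lambda>s. cis (1 * t * s) *\<^sub>C (w s *\<^sub>R sided_deriv F 1 0 s))"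
    using \<epsilon> by (intro integral_cong) (simp add: e sided_deriv_0)
  then have 1: "norm (integral {\<epsilon>..R} ?g) \<le> Q" using b[of 1] by simp
  have "integral {-R..-\<epsilon>} ?g = integral {\<epsilon>..R} (\<lambda>s. ?g (- s))"
    using Henstock_Kurzweil_Integration.integral_reflect_real[of R \<epsilon> "\<lambda>s. ?g (- s)"] by simp
  also have "\<dots> = integral {\<epsilon>..R} (\<lambda>s. cis (- 1 * t * s) *\<^sub>C (w s *\<^sub>R sided_deriv F (- 1) 0 s))"
    using \<epsilon> by (intro integral_cong) (simp add: e sided_deriv_0)
  finally have 2: "norm (integral {-R..-\<epsilon>} ?g) \<le> Q" using b[of "- 1"] by simp
  have "norm (integral UNIV ?g) \<le> norm (integral {\<epsilon>..R} ?g) + norm (integral {-R..-\<epsilon>} ?g)"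
    using w \<epsilon> by (intro norm_integral_two_sided) (auto simp: scaleC.zero_left)
  with 1 2 show ?thesis by linarith
qed

section \<open>Balancing the error terms\<close>

lemma powr_inverse_power: "0 < x \<Longrightarrow> k \<ge> 1 \<Longrightarrow> (x powr (1 / real k)) ^ k = x"
  by (simp add: powr_realpow[symmetric] powr_powr)

text \<open>The constant c enters the error terms only through the powers collected in
  \<open>N\<close>, hence every positive c is allowed.\<close>

lemma polynomial_decay_rate:
  fixes f F :: "real \<Rightarrow> 'a::complex_banach"
  assumes gf: "growth_functions m M"
    and est:
    "\<And>A \<epsilon> b c R t. low_cutoff A \<epsilon> b c R \<Longrightarrow> t \<ge> X \<Longrightarrow>
       norm (f t) \<le> K * A * (\<epsilon> + 1 / R) + norm (integral UNIV (\<lambda>s. (of_real (high_profile \<epsilon> b c R \<bar>s\<bar>) * cis (t * s)) *\<^sub>C F s))"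
    and k: "k \<ge> 1" and Ck: "Ck_on k (- {0}) F" and C: "C > 0"
    and low: "\<And>j s. j \<le> k \<Longrightarrow> 0 < \<bar>s\<bar> \<Longrightarrow> \<bar>s\<bar> \<le> 1 \<Longrightarrow> norm (nth_vderiv j F s) \<le> C * \<bar>s\<bar> ^ (k - j) * m \<bar>s\<bar> ^ (k + 1)"
    and high: "\<And>j s. j \<le> k \<Longrightarrow> 1 \<le> \<bar>s\<bar> \<Longrightarrow> norm (nth_vderiv j F s) \<le> C * M \<bar>s\<bar> ^ (j + 1)"
    and c: "c > 0"
  shows "(\<lambda>t. norm (f t)) \<in> O[at_top](\<lambda>t. inv_small (m_k m k) (c * t) + 1 / inv_large (M_k M k) (c * t))"
proof -
  interpret growth_functions m M by fact
  obtain A where A: "A \<ge> 1" "\<And>\<epsilon> R. 0 < \<epsilon> \<Longrightarrow> \<epsilon> < R \<Longrightarrow> 1 \<le> R \<Longrightarrow> low_cutoff A \<epsilon> R (step_cutoff k \<epsilon>) R"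
    using low_cutoff_step[OF k] by blast
  obtain C' where C': "C' > 0"
    "\<And>D :: nat \<Rightarrow> real \<Rightarrow> 'a. \<And>m M \<epsilon> R \<tau>.
      (\<And>j s. j < k \<Longrightarrow> s > 0 \<Longrightarrow> (D j has_vector_derivative D (Suc j) s) (at s)) \<Longrightarrow>
      continuous_on {0<..} (D k) \<Longrightarrow>
      (\<And>j s. j \<le> k \<Longrightarrow> \<epsilon> \<le> s \<Longrightarrow> s \<le> 1 \<Longrightarrow> norm (D j s) \<le> C * s ^ (k - j) * m) \<Longrightarrow>
      (\<And>j s. j \<le> k \<Longrightarrow> 1 \<le> s \<Longrightarrow> s \<le> R \<Longrightarrow> norm (D j s) \<le> C * M ^ Suc j) \<Longrightarrow>
      0 < \<epsilon> \<Longrightarrow> \<epsilon> \<le> 1 \<Longrightarrow> 1 \<le> R \<Longrightarrow> 0 \<le> m \<Longrightarrow> 1 \<le> M \<Longrightarrow> \<tau> \<noteq> 0 \<Longrightarrow>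
      norm (integral {\<epsilon>..R} (\<lambda>s. cis (\<tau> * s) *\<^sub>C ((bump R 0 s * step_rise k \<epsilon> 0 s) *\<^sub>R D 0 s)))
       \<le> C' * ((\<Sum>j\<in>{2..<k}. M ^ (j - 1) / (R^2 * \<bar>\<tau>\<bar> ^ Suc j)) + (m + R * M ^ Suc k) / \<bar>\<tau>\<bar> ^ k)"
  proof (rule finite_smoothness_integral_bound[OF C, where k = k and 'a = 'a], goal_cases)
    case (1 C')
    from 1(2,3) show ?case by (rule 1(1))
  qed
  define N where "N = (\<Sum>j\<in>{2..<k}. c ^ (j - 1)) + c ^ k"
  have N0: "N > 0" unfolding N_def using c by (intro add_nonneg_pos sum_nonneg) auto
  define Q where "Q = K * A + 2 * C' * N"
  show ?thesis
  proof (rule bigoI[of _ Q])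
    have "eventually (\<lambda>t. t \<ge> max X (max 1 ((max (m_k m k 1) (M_k M k 1) + 1) / c))) at_top" by (rule eventually_ge_at_top)
    then show "\<forall>\<^sub>F t in at_top. norm (norm (f t)) \<le> Q * norm (inv_small (m_k m k) (c * t) + 1 / inv_large (M_k M k) (c * t))"
    proof eventually_elim
      case (elim t)
      then have t: "t \<ge> X" "t \<ge> 1" "(max (m_k m k 1) (M_k M k 1) + 1) / c \<le> t" by auto
      have "max (m_k m k 1) (M_k M k 1) + 1 \<le> c * t" using t(3) c by (simp add: pos_divide_le_eq mult.commute)
      \<comment> \<open>The strict second inequality yields R > 1 >= \<epsilon>, so that the
        interval between \<epsilon> and R is not degenerate.\<close>
      then have ct: "c * t \<ge> m_k m k 1" "c * t > M_k M k 1" by auto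
      define \<epsilon> where "\<epsilon> = inv_small (m_k m k) (c * t)"
      define R where "R = inv_large (M_k M k) (c * t)"
      have \<epsilon>: "\<epsilon> \<in> {0<..1}" "m_k m k \<epsilon> = c * t"
        unfolding \<epsilon>_def
        by (rule inv_small_properties[OF continuous_on_m_k m_k_decreasing[OF k] m_k_unbounded[OF k] ct(1)]; assumption)+
      have R: "R \<in> {1..}" "M_k M k R = c * t"
        unfolding R_def
        by (rule inv_large_properties[OF continuous_on_M_k M_k_increasing[OF k] M_k_unbounded[OF k] less_imp_le[OF ct(2)]]; assumption)+
      have R1: "R > 1" using R ct by (cases "R = 1") auto
      have \<epsilon>0: "0 < \<epsilon>" "\<epsilon> \<le> 1" using \<epsilon> by auto
      have m\<epsilon>: "m \<epsilon> \<ge> 1" and MR: "M R \<ge> 1" using m1 M1 \<epsilon>0 R1 by auto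
      \<comment> \<open>The k-th power of the equation that defines \<epsilon>: dividing by t^k, the
        contribution of the low frequencies becomes c^k \<epsilon>.\<close>
      have km: "m \<epsilon> ^ (k + 1) = (c * t) ^ k * \<epsilon>"
      proof -
        have "(c * t) ^ k = m \<epsilon> ^ k * ((m \<epsilon> / \<epsilon>) powr (1 / real k)) ^ k"
          unfolding \<epsilon>(2)[symmetric] m_k_def by (rule power_mult_distrib)
        also have "((m \<epsilon> / \<epsilon>) powr (1 / real k)) ^ k = m \<epsilon> / \<epsilon>"
          using k m\<epsilon> \<epsilon>0 by (intro powr_inverse_power divide_pos_pos) auto
        finally show ?thesis using \<epsilon>0 by simp
      qed
      have kM: "M R ^ Suc k * (1 + R)^2 = (c * t) ^ k"
      proof -
        have "(c * t) ^ k = M R ^ k * (((1 + R)^2 * M R) powr (1 / real k)) ^ k"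
          unfolding R(2)[symmetric] M_k_def by (rule power_mult_distrib)
        also have "(((1 + R)^2 * M R) powr (1 / real k)) ^ k = (1 + R)^2 * M R"
          using k MR R1 by (intro powr_inverse_power mult_pos_pos zero_less_power) auto
        finally show ?thesis by (simp add: mult_ac)
      qed
      have Mct: "M R \<le> c * t"
      proof -
        have "1 * 1 \<le> (1 + R)^2 * M R" using MR R1 by (intro mult_mono) auto
        then have "1 \<le> ((1 + R)^2 * M R) powr (1 / real k)" by (intro ge_one_powr_ge_zero) auto
        then have "M R * 1 \<le> M R * ((1 + R)^2 * M R) powr (1 / real k)" using MR by (intro mult_left_mono) auto
        then show ?thesis using R(2) by (simp add: M_k_def)
      qed
      have hp: "high_profile \<epsilon> R (step_cutoff k \<epsilon>) R s = bump R 0 s * step_rise k \<epsilon> 0 s" if "s \<in> {\<epsilon>..R}" for s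
        using that \<epsilon>0 k by (auto simp: high_profile_def low_profile_def step_rise_def step_cutoff_def poly_step_poly)
      have bnd: "norm (integral {\<epsilon>..R} (\<lambda>s. cis (\<sigma> * t * s) *\<^sub>C (high_profile \<epsilon> R (step_cutoff k \<epsilon>) R s *\<^sub>R sided_deriv F \<sigma> 0 s)))
         \<le> C' * (N * (\<epsilon> + 1 / R))" if \<sigma>: "\<bar>\<sigma>\<bar> = 1" for \<sigma>
      proof -
        have \<sigma>s: "\<bar>\<sigma> * s\<bar> = \<bar>s\<bar>" for s using \<sigma> by (simp add: abs_mult)
        have "integral {\<epsilon>..R} (\<lambda>s. cis (\<sigma> * t * s) *\<^sub>C (high_profile \<epsilon> R (step_cutoff k \<epsilon>) R s *\<^sub>R sided_deriv F \<sigma> 0 s))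
          = integral {\<epsilon>..R} (\<lambda>s. cis (\<sigma> * t * s) *\<^sub>C ((bump R 0 s * step_rise k \<epsilon> 0 s) *\<^sub>R sided_deriv F \<sigma> 0 s))"
          by (intro integral_cong) (simp only: hp)
        also have "norm \<dots> \<le> C' * ((\<Sum>j\<in>{2..<k}. M R ^ (j - 1) / (R^2 * \<bar>\<sigma> * t\<bar> ^ Suc j)) + (m \<epsilon> ^ (k + 1) + R * M R ^ Suc k) / \<bar>\<sigma> * t\<bar> ^ k)"
        proof (rule C'(2))
          show "(sided_deriv F \<sigma> j has_vector_derivative sided_deriv F \<sigma> (Suc j) s) (at s)" if "j < k" "0 < s" for j s
            using that by (intro has_vector_derivative_sided_deriv[OF Ck] \<sigma>) auto
          show "continuous_on {0<..} (sided_deriv F \<sigma> k)" by (rule continuous_on_sided_deriv[OF Ck \<sigma>])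
          show "norm (sided_deriv F \<sigma> j s) \<le> C * s ^ (k - j) * m \<epsilon> ^ (k + 1)" if "j \<le> k" "\<epsilon> \<le> s" "s \<le> 1" for j s
          proof -
            have "norm (sided_deriv F \<sigma> j s) \<le> C * s ^ (k - j) * m s ^ (k + 1)"
              unfolding norm_sided_deriv[OF \<sigma>] using low[of j "\<sigma> * s"] that \<epsilon>0 by (simp add: \<sigma>s)
            also have "\<dots> \<le> C * s ^ (k - j) * m \<epsilon> ^ (k + 1)"
              using C that \<epsilon>0 m1[of s] mdec[of \<epsilon> s] by (intro mult_left_mono power_mono) auto
            finally show ?thesis .
          qed
          show "norm (sided_deriv F \<sigma> j s) \<le> C * M R ^ Suc j" if "j \<le> k" "1 \<le> s" "s \<le> R" for j s
          proof -
            have "norm (sided_deriv F \<sigma> j s) \<le> C * M s ^ Suc j"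
              unfolding norm_sided_deriv[OF \<sigma>] using high[of j "\<sigma> * s"] that by (simp add: \<sigma>s)
            also have "\<dots> \<le> C * M R ^ Suc j"
              using C that M1[of s] Minc[of s R] by (intro mult_left_mono power_mono) auto
            finally show ?thesis .
          qed
        qed (use \<epsilon>0 R1 m\<epsilon> MR t \<sigma> in auto)
        also have "\<bar>\<sigma> * t\<bar> = t" using \<sigma> t by (simp add: abs_mult)
        also have "(\<Sum>j\<in>{2..<k}. M R ^ (j - 1) / (R^2 * t ^ Suc j)) \<le> (\<Sum>j\<in>{2..<k}. c ^ (j - 1) * (1 / R))"
        proof (rule sum_mono)
          fix j assume j: "j \<in> {2..<k}"
          have "M R ^ (j - 1) / (R^2 * t ^ Suc j) \<le> (c * t) ^ (j - 1) / (R * t ^ (j - 1))"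
          \<comment> \<open>M(R) <= c t turns the powers of M(R) into powers of c. The factor 1 /
            R^2 from the double zero and the two spare powers of 1/t leave more than the required
            1/R.\<close>
          proof (rule frac_le)
            show "M R ^ (j - 1) \<le> (c * t) ^ (j - 1)" using Mct MR by (intro power_mono) auto
            show "R * t ^ (j - 1) \<le> R^2 * t ^ Suc j"
              using R1 t by (intro mult_mono power_increasing) (auto simp: power2_eq_square)
          qed (use c t R1 in auto)
          also have "\<dots> = c ^ (j - 1) * (1 / R)" using t by (simp add: power_mult_distrib)
          finally show "M R ^ (j - 1) / (R^2 * t ^ Suc j) \<le> c ^ (j - 1) * (1 / R)" .
        qed
        also have "\<dots> = (\<Sum>j\<in>{2..<k}. c ^ (j - 1)) * (1 / R)" by (simp only: sum_distrib_right)
        also have "(m \<epsilon> ^ (k + 1) + R * M R ^ Suc k) / t ^ k \<le> c ^ k * (\<epsilon> + 1 / R)"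
        proof -
          \<comment> \<open>Of the square (1 + R)^2 in \<open>M_k\<close>, one factor pays for the
            length of [1, R] and the other one is the gain 1/R.\<close>
          have "R * M R ^ Suc k \<le> (c * t) ^ k * (1 / R)"
          proof -
            define v where "v = M R ^ Suc k"
            have v: "v \<ge> 0" "(1 + R)^2 * v = (c * t) ^ k" using MR kM unfolding v_def by (simp, simp only: mult.commute[of "(1 + R)^2"])
            have "R^2 * v \<le> (1 + R)^2 * v"
              using R1 v(1) by (intro mult_right_mono power_mono) auto
            then have "R * v * R \<le> (c * t) ^ k" unfolding v(2) by (simp only: power2_eq_square mult_ac)
            then have "R * v \<le> (c * t) ^ k / R" using R1 by (simp only: pos_le_divide_eq)
            then show ?thesis by (simp only: v_def times_divide_eq_right mult_1_right)
          qed
          then have "m \<epsilon> ^ (k + 1) + R * M R ^ Suc k \<le> (c * t) ^ k * (\<epsilon> + 1 / R)"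
            unfolding km distrib_left by (rule add_left_mono)
          then have "(m \<epsilon> ^ (k + 1) + R * M R ^ Suc k) / t ^ k \<le> (c * t) ^ k * (\<epsilon> + 1 / R) / t ^ k"
            using t by (intro divide_right_mono) auto
          also have "(c * t) ^ k * (\<epsilon> + 1 / R) / t ^ k = c ^ k * (\<epsilon> + 1 / R)"
            using t by (simp add: power_mult_distrib)
          finally show ?thesis .
        qed
        also have "(\<Sum>j\<in>{2..<k}. c ^ (j - 1)) * (1 / R) + c ^ k * (\<epsilon> + 1 / R) \<le> N * (\<epsilon> + 1 / R)"
        proof -
          have "(\<Sum>j\<in>{2..<k}. c ^ (j - 1)) * (1 / R) \<le> (\<Sum>j\<in>{2..<k}. c ^ (j - 1)) * (\<epsilon> + 1 / R)"
            using c \<epsilon>0 by (intro mult_left_mono sum_nonneg) auto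
          then show ?thesis by (simp add: N_def distrib_right)
        qed
        finally show ?thesis using C'(1) by simp
      qed
      have "norm (integral UNIV (\<lambda>s. (of_real (high_profile \<epsilon> R (step_cutoff k \<epsilon>) R \<bar>s\<bar>) * cis (t * s)) *\<^sub>C F s)) \<le> 2 * (C' * (N * (\<epsilon> + 1 / R)))"
        by (rule two_sided_integral_bound[of \<epsilon> R]) (use \<epsilon>0 R1 bnd in \<open>auto simp: high_profile_zero\<close>)
      moreover have "norm (f t) \<le> K * A * (\<epsilon> + 1 / R) + norm (integral UNIV (\<lambda>s. (of_real (high_profile \<epsilon> R (step_cutoff k \<epsilon>) R \<bar>s\<bar>) * cis (t * s)) *\<^sub>C F s))"
        using \<epsilon>0 R1 by (intro est A(2) t) auto
      ultimately have "norm (f t) \<le> Q * (\<epsilon> + 1 / R)" by (simp add: Q_def algebra_simps)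
      moreover have "\<epsilon> + 1 / R \<ge> 0" using \<epsilon>0 R1 by simp
      ultimately show ?case by (simp add: \<epsilon>_def[symmetric] R_def[symmetric])
    qed
  qed
qed

text \<open>The numbers of integrations by parts are n1 and n2, the integer parts of t /
  m(\<epsilon>) and t / M(R). The equations for \<epsilon> and R express c times these quotients as
  logarithms, so the factorial gain becomes an inverse power of 1 + m(\<epsilon>) / \<epsilon> and
  of (1 + R) M(R). The term 1/t of the rate comes from the boundary terms at the kinks, at 1 and at
  R.\<close>

lemma exponential_decay_rate:
  fixes f F :: "real \<Rightarrow> 'a::complex_banach"
  assumes gf: "growth_functions m M"
    and K: "K > 0" and est:
    "\<And>A \<epsilon> b c R t. low_cutoff A \<epsilon> b c R \<Longrightarrow> t \<ge> X \<Longrightarrow>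
       norm (f t) \<le> K * A * (\<epsilon> + 1 / R) + norm (integral UNIV (\<lambda>s. (of_real (high_profile \<epsilon> b c R \<bar>s\<bar>) * cis (t * s)) *\<^sub>C F s))"
    and Ck: "Cinf_on (- {0}) F" and C: "C > 0"
    and low: "\<And>j s. 0 < \<bar>s\<bar> \<Longrightarrow> \<bar>s\<bar> \<le> 1 \<Longrightarrow> norm (nth_vderiv j F s) \<le> C * fact j * \<bar>s\<bar> * m \<bar>s\<bar> ^ (j + 1)"
    and high: "\<And>j s. 1 \<le> \<bar>s\<bar> \<Longrightarrow> norm (nth_vderiv j F s) \<le> C * fact j * M \<bar>s\<bar> ^ (j + 1)"
    and c: "0 < c" "c < 1 / 2"
  shows "(\<lambda>t. norm (f t)) \<in> O[at_top](\<lambda>t. inv_small (m_log m) (c * t) + 1 / inv_large (M_log M) (c * t) + 1 / t)"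
proof -
  interpret growth_functions m M by fact
  \<comment> \<open>Both growth conditions apply at |s| = 1, so the derivatives there obey the
    smaller of the two bounds, which does not change with t.\<close>
  define \<kappa> where "\<kappa> = min (m 1) (M 1)"
  have \<kappa>1: "\<kappa> \<ge> 1" using m1[of 1] M1[of 1] by (simp add: \<kappa>_def)
  define L where "L = exp 2 / (1 - 2 * c)"
  have L: "L > 0" using c by (simp add: L_def)
  define Q where "Q = K * 16 + 2 * (4800 * C * \<kappa> * (1 + L))"
  have ln2: "(1::real) / 2 \<le> ln 2" using ln2_ge_two_thirds by simp
  show ?thesis
  proof (rule bigoI[of _ Q])
    \<comment> \<open>The value at 1/2 forces \<epsilon> <= 1/2, so that the trapezoid ends at 2
      \<epsilon> <= 1, before the split at 1. The added 1 makes the inequalities strict.\<close>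
    have "eventually (\<lambda>t. t \<ge> max X (max 1 ((max (m_log m 1) (max (m_log m (1 / 2)) (M_log M 1)) + 1) / c))) at_top" by (rule eventually_ge_at_top)
    then show "\<forall>\<^sub>F t in at_top. norm (norm (f t)) \<le> Q * norm (inv_small (m_log m) (c * t) + 1 / inv_large (M_log M) (c * t) + 1 / t)"
    proof eventually_elim
      case (elim t)
      then have t: "t \<ge> X" "t \<ge> 1" "(max (m_log m 1) (max (m_log m (1 / 2)) (M_log M 1)) + 1) / c \<le> t" by auto
      have "max (m_log m 1) (max (m_log m (1 / 2)) (M_log M 1)) + 1 \<le> c * t" using t(3) c by (simp add: pos_divide_le_eq mult.commute)
      then have ct: "c * t \<ge> m_log m 1" "c * t > m_log m (1 / 2)" "c * t > M_log M 1" by auto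
      define \<epsilon> where "\<epsilon> = inv_small (m_log m) (c * t)"
      define R where "R = inv_large (M_log M) (c * t)"
      have \<epsilon>: "\<epsilon> \<in> {0<..1}" "m_log m \<epsilon> = c * t"
        unfolding \<epsilon>_def
        by (rule inv_small_properties[OF continuous_on_m_log m_log_decreasing m_log_unbounded ct(1)]; assumption)+
      have R: "R \<in> {1..}" "M_log M R = c * t"
        unfolding R_def
        by (rule inv_large_properties[OF continuous_on_M_log M_log_increasing M_log_unbounded less_imp_le[OF ct(3)]]; assumption)+
      have R1: "R > 1" using R ct by (cases "R = 1") auto
      have \<epsilon>0: "0 < \<epsilon>" using \<epsilon> by auto
      have \<epsilon>2: "2 * \<epsilon> \<le> 1"
      proof (rule ccontr)
        assume "\<not> 2 * \<epsilon> \<le> 1"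
        then have "m_log m \<epsilon> < m_log m (1 / 2)" using \<epsilon> by (intro m_log_decreasing) auto
        then show False using \<epsilon>(2) ct(2) by simp
      qed
      have m\<epsilon>: "m \<epsilon> \<ge> 1" and MR: "M R \<ge> 1" using m1 M1 \<epsilon> R1 by auto
      have \<kappa>m: "\<kappa> \<le> m \<epsilon>" "\<kappa> \<le> M R" using mdec[of \<epsilon> 1] Minc[of 1 R] \<epsilon> R1 by (auto simp: \<kappa>_def)
      have ye: "c * (t / m \<epsilon>) = ln (1 + m \<epsilon> / \<epsilon>)" using \<epsilon>(2) m\<epsilon> by (simp add: m_log_def field_simps)
      have yR: "c * (t / M R) = ln (1 + R) + ln (M R)" using R(2) MR by (simp add: M_log_def field_simps)
      have "\<epsilon> \<le> m \<epsilon>" using m\<epsilon> \<epsilon> by simp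
      then have me1: "1 \<le> m \<epsilon> / \<epsilon>" using \<epsilon>0 by (simp add: pos_le_divide_eq)
      have lge: "1 / 2 \<le> ln (1 + m \<epsilon> / \<epsilon>)" using me1 by (intro order_trans[OF ln2] ln_mono) auto
      have lgR: "1 / 2 \<le> ln (1 + R) + ln (M R)"
      proof -
        have "ln 2 \<le> ln (1 + R)" using R1 by (intro ln_mono) auto
        moreover have "0 \<le> ln (M R)" using MR by simp
        ultimately show ?thesis using ln2 by linarith
      qed
      \<comment> \<open>Both logarithms are at least ln 2 > 1/2 > c, so both quotients are at least
        1 and \<open>fact_power_floor_le\<close> applies.\<close>
      have y1: "1 \<le> t / m \<epsilon>" "1 \<le> t / M R"
      proof -
        have aux: "1 \<le> y" if "1 / 2 \<le> c * y" for y
        proof (rule ccontr)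
          assume "\<not> 1 \<le> y"
          then have "c * y \<le> c * 1" using c by (intro mult_left_mono) auto
          then show False using that c by linarith
        qed
        show "1 \<le> t / m \<epsilon>" "1 \<le> t / M R" using lge lgR ye yR by (auto intro!: aux)
      qed
      define n1 where "n1 = nat \<lfloor>t / m \<epsilon>\<rfloor>"
      define n2 where "n2 = nat \<lfloor>t / M R\<rfloor>"
      have n1: "real n1 * m \<epsilon> \<le> t"
      proof -
        have "real n1 \<le> t / m \<epsilon>" using y1 by (simp add: n1_def)
        then show ?thesis using m\<epsilon> by (simp add: pos_le_divide_eq)
      qed
      have n2: "real n2 * M R \<le> t"
      proof -
        have "real n2 \<le> t / M R" using y1 by (simp add: n2_def)
        then show ?thesis using MR by (simp add: pos_le_divide_eq)
      qed
      have q1: "m \<epsilon> * (fact n1 * (m \<epsilon> / t) ^ n1) \<le> L * \<epsilon>"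
      proof -
        have "fact n1 * (m \<epsilon> / t) ^ n1 \<le> L * exp (- 2 * c * (t / m \<epsilon>))"
          using fact_power_floor_le[OF c y1(1)] by (simp add: n1_def L_def)
        also have "exp (- 2 * c * (t / m \<epsilon>)) = 1 / exp (ln (1 + m \<epsilon> / \<epsilon>)) ^ 2"
          unfolding ye[symmetric] by (simp add: exp_minus exp_of_nat_mult[symmetric] inverse_eq_divide)
        also have "exp (ln (1 + m \<epsilon> / \<epsilon>)) = 1 + m \<epsilon> / \<epsilon>" using me1 by (intro exp_ln) simp
        finally have "m \<epsilon> * (fact n1 * (m \<epsilon> / t) ^ n1) \<le> m \<epsilon> * (L * (1 / (1 + m \<epsilon> / \<epsilon>) ^ 2))"
          using m\<epsilon> by (intro mult_left_mono) auto
        \<comment> \<open>One factor of the square suffices at low frequencies: m(\<epsilon>) times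
          \<epsilon> / m(\<epsilon>) is \<epsilon>.\<close>
        also have "\<dots> \<le> m \<epsilon> * (L * (1 / (m \<epsilon> / \<epsilon>)))"
        proof (intro mult_left_mono divide_left_mono)
          have "(m \<epsilon> / \<epsilon>) * 1 \<le> (1 + m \<epsilon> / \<epsilon>) * (1 + m \<epsilon> / \<epsilon>)" using me1 by (intro mult_mono) auto
          then show "m \<epsilon> / \<epsilon> \<le> (1 + m \<epsilon> / \<epsilon>) ^ 2" by (simp add: power2_eq_square)
          have "0 < 1 + m \<epsilon> / \<epsilon>" using me1 by linarith
          then show "0 < (1 + m \<epsilon> / \<epsilon>) ^ 2 * (m \<epsilon> / \<epsilon>)" using me1 by (intro mult_pos_pos zero_less_power) auto
        qed (use L m\<epsilon> in auto)
        also have "\<dots> = L * \<epsilon>" using m\<epsilon> by simp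
        finally show ?thesis .
      qed
      have q2: "R * M R * (fact n2 * (M R / t) ^ n2) \<le> L * (1 / R)"
      proof -
        have "fact n2 * (M R / t) ^ n2 \<le> L * exp (- 2 * c * (t / M R))"
          using fact_power_floor_le[OF c y1(2)] by (simp add: n2_def L_def)
        also have "exp (- 2 * c * (t / M R)) = 1 / exp (ln (1 + R) + ln (M R)) ^ 2"
          unfolding yR[symmetric] by (simp add: exp_minus exp_of_nat_mult[symmetric] inverse_eq_divide)
        also have "exp (ln (1 + R) + ln (M R)) = (1 + R) * M R" using R1 MR by (simp add: exp_add)
        finally have "R * M R * (fact n2 * (M R / t) ^ n2) \<le> R * M R * (L * (1 / ((1 + R) * M R) ^ 2))"
          using R1 MR by (intro mult_left_mono) auto
        \<comment> \<open>Here the square is really used: R^2 is needed to turn the prefactor R M(R)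
          into 1/R.\<close>
        also have "\<dots> \<le> R * M R * (L * (1 / (R^2 * M R)))"
        proof (intro mult_left_mono divide_left_mono)
          have "R^2 * (M R * 1) \<le> (1 + R)^2 * (M R * M R)" using R1 MR by (intro mult_mono power_mono) auto
          then show "R^2 * M R \<le> ((1 + R) * M R) ^ 2" by (simp add: power_mult_distrib power2_eq_square[of "M R"])
        qed (use R1 L MR in auto)
        also have "\<dots> = L * (1 / R)" using R1 MR by (simp add: power2_eq_square)
        finally show ?thesis .
      qed
      \<comment> \<open>The boundary terms at the kinks stay within the rate because m(\<epsilon>)
        <= t.\<close>
      have q3: "(\<epsilon> * m \<epsilon> + 1) / t \<le> \<epsilon> + 1 / t"
      proof -
        have "m \<epsilon> \<le> t" using y1(1) m\<epsilon> by (simp add: pos_le_divide_eq)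
        then have "m \<epsilon> / t \<le> 1" using t by simp
        then have "\<epsilon> * (m \<epsilon> / t) \<le> \<epsilon> * 1" using \<epsilon>0 by (intro mult_left_mono) auto
        then show ?thesis by (simp add: add_divide_distrib)
      qed
      define Z where "Z = \<epsilon> + 1 / R + 1 / t"
      have Z: "0 \<le> Z" "\<epsilon> + 1 / R \<le> Z" "\<epsilon> + 1 / t \<le> Z" using \<epsilon>0 R1 t by (auto simp: Z_def)
      have bnd: "norm (integral {\<epsilon>..R} (\<lambda>s. cis (\<sigma> * t * s) *\<^sub>C (high_profile \<epsilon> (2 * \<epsilon>) (trapezoid \<epsilon>) R s *\<^sub>R sided_deriv F \<sigma> 0 s)))
         \<le> 4800 * C * \<kappa> * ((1 + L) * Z)" if \<sigma>: "\<bar>\<sigma>\<bar> = 1" for \<sigma>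
      proof -
        have \<sigma>s: "\<bar>\<sigma> * s\<bar> = \<bar>s\<bar>" for s using \<sigma> by (simp add: abs_mult)
        have lowD: "norm (sided_deriv F \<sigma> j s) \<le> C * fact j * s * m s ^ Suc j" if "0 < s" "s \<le> 1" for j s
          unfolding norm_sided_deriv[OF \<sigma>] using low[of "\<sigma> * s" j] that by (simp add: \<sigma>s)
        have highD: "norm (sided_deriv F \<sigma> j s) \<le> C * fact j * M s ^ Suc j" if "1 \<le> s" for j s
          unfolding norm_sided_deriv[OF \<sigma>] using high[of "\<sigma> * s" j] that by (simp add: \<sigma>s)
        have "integral {\<epsilon>..R} (\<lambda>s. cis (\<sigma> * t * s) *\<^sub>C (high_profile \<epsilon> (2 * \<epsilon>) (trapezoid \<epsilon>) R s *\<^sub>R sided_deriv F \<sigma> 0 s))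
          = integral {\<epsilon>..R} (\<lambda>s. cis (\<sigma> * t * s) *\<^sub>C ((bump R 0 s * (1 - low_profile \<epsilon> (2 * \<epsilon>) (trapezoid \<epsilon>) s)) *\<^sub>R sided_deriv F \<sigma> 0 s))"
          by (intro integral_cong) (simp add: high_profile_def)
        also have "norm \<dots> \<le> 4800 * C * \<kappa> * ((\<epsilon> * m \<epsilon> + 1) / t + m \<epsilon> * (fact n1 * (m \<epsilon> / t) ^ n1) + R * M R * (fact n2 * (M R / t) ^ n2))"
        proof (rule analytic_integral_bound)
          show "(sided_deriv F \<sigma> j has_vector_derivative sided_deriv F \<sigma> (Suc j) s) (at s)" if "0 < s" for j s
            using that Ck unfolding Cinf_on_def by (intro has_vector_derivative_sided_deriv[of "Suc j"] \<sigma>) auto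
          show "norm (sided_deriv F \<sigma> j s) \<le> C * fact j * s * m \<epsilon> ^ Suc j" if "\<epsilon> \<le> s" "s \<le> 1" for j s
          proof -
            have "norm (sided_deriv F \<sigma> j s) \<le> C * fact j * s * m s ^ Suc j" using that \<epsilon>0 by (intro lowD) auto
            also have "\<dots> \<le> C * fact j * s * m \<epsilon> ^ Suc j"
              using C that \<epsilon>0 m1[of s] mdec[of \<epsilon> s] by (intro mult_left_mono power_mono) auto
            finally show ?thesis .
          qed
          show "norm (sided_deriv F \<sigma> j s) \<le> C * fact j * M R ^ Suc j" if "1 \<le> s" "s \<le> R" for j s
          proof -
            have "norm (sided_deriv F \<sigma> j s) \<le> C * fact j * M s ^ Suc j" using that by (intro highD) auto
            also have "\<dots> \<le> C * fact j * M R ^ Suc j"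
              using C that M1[of s] Minc[of s R] by (intro mult_left_mono power_mono) auto
            finally show ?thesis .
          qed
          show "norm (sided_deriv F \<sigma> j 1) \<le> C * fact j * \<kappa> ^ Suc j" for j
            using lowD[of 1 j] highD[of 1 j] by (auto simp: \<kappa>_def min_def)
          show "\<bar>\<sigma> * t\<bar> = t" using \<sigma> t by (simp add: abs_mult)
        qed (use \<epsilon>0 \<epsilon>2 R1 \<kappa>1 \<kappa>m C t n1 n2 in auto)
        also have "\<dots> \<le> 4800 * C * \<kappa> * ((\<epsilon> + 1 / t) + L * \<epsilon> + L * (1 / R))"
          using C \<kappa>1 q1 q2 q3 by (intro mult_left_mono add_mono) auto
        also have "\<dots> \<le> 4800 * C * \<kappa> * ((1 + L) * Z)"
        proof (intro mult_left_mono)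
          have "L * (\<epsilon> + 1 / R) \<le> L * Z" using L Z by (intro mult_left_mono) auto
          then show "(\<epsilon> + 1 / t) + L * \<epsilon> + L * (1 / R) \<le> (1 + L) * Z" using Z by (simp add: algebra_simps)
        qed (use C \<kappa>1 in auto)
        finally show ?thesis .
      qed
      have "norm (integral UNIV (\<lambda>s. (of_real (high_profile \<epsilon> (2 * \<epsilon>) (trapezoid \<epsilon>) R \<bar>s\<bar>) * cis (t * s)) *\<^sub>C F s)) \<le> 2 * (4800 * C * \<kappa> * ((1 + L) * Z))"
        by (rule two_sided_integral_bound[of \<epsilon> R]) (use \<epsilon>0 \<epsilon>2 R1 bnd in \<open>auto simp: high_profile_zero\<close>)
      moreover have "norm (f t) \<le> K * 16 * (\<epsilon> + 1 / R) + norm (integral UNIV (\<lambda>s. (of_real (high_profile \<epsilon> (2 * \<epsilon>) (trapezoid \<epsilon>) R \<bar>s\<bar>) * cis (t * s)) *\<^sub>C F s))"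
        using \<epsilon>0 \<epsilon>2 R1 by (intro est low_cutoff_trapezoid t) auto
      moreover have "K * 16 * (\<epsilon> + 1 / R) \<le> K * 16 * Z" using Z K by (intro mult_left_mono) auto
      ultimately have "norm (f t) \<le> Q * Z" by (simp add: Q_def algebra_simps)
      then show ?case using Z(1) by (simp add: Z_def \<epsilon>_def[symmetric] R_def[symmetric])
    qed
  qed
qed

theorem theorem2p13:
  fixes f :: "real \<Rightarrow> 'a::complex_banach"
    and F :: "real \<Rightarrow> 'a"
  assumes f_bdd: "bounded (f ` {0..})"
    and f_cont: "continuous_on {0..} f"
    and f_lip: "\<exists>L. L-lipschitz_on {0..} f"
    and f_int_bdd: "bounded ((\<lambda>t. integral {0..t} f) ` {0..})"
    and F_loc: "\<And>K. compact K \<Longrightarrow> K \<subseteq> - {0} \<Longrightarrow> F integrable_on K \<and> (\<lambda>s. norm (F s)) integrable_on K"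
    and F_bdry: "\<And>\<psi> :: real \<Rightarrow> complex. continuous_on UNIV \<psi> \<Longrightarrow>
          compact (closure {s. \<psi> s \<noteq> 0}) \<Longrightarrow> 0 \<notin> closure {s. \<psi> s \<noteq> 0} \<Longrightarrow>
          ((\<lambda>\<alpha>. integral UNIV (\<lambda>s. \<psi> s *\<^sub>C laplace f (Complex \<alpha> s)))
             \<longlongrightarrow> integral UNIV (\<lambda>s. \<psi> s *\<^sub>C F s)) (at_right 0)"
  shows "(f \<longlongrightarrow> 0) at_top \<and>
    (\<forall>(m :: real \<Rightarrow> real) (M :: real \<Rightarrow> real).
       continuous_on {0<..1} m \<and> (\<forall>x y. 0 < x \<and> x \<le> y \<and> y \<le> 1 \<longrightarrow> m y \<le> m x)
       \<and> (\<forall>r\<in>{0<..1}. 1 \<le> m r)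
       \<and> continuous_on {1..} M \<and> (\<forall>x y. 1 \<le> x \<and> x \<le> y \<longrightarrow> M x \<le> M y)
       \<and> (\<forall>R\<in>{1..}. 1 \<le> M R)
     \<longrightarrow>
       (\<forall>k::nat. k \<ge> 1 \<and> Ck_on k (- {0}) F \<and>
          (\<exists>C>0. (\<forall>j\<le>k. \<forall>s. 0 < \<bar>s\<bar> \<and> \<bar>s\<bar> \<le> 1 \<longrightarrow>
                    norm (nth_vderiv j F s) \<le> C * \<bar>s\<bar> ^ (k - j) * m \<bar>s\<bar> ^ (k + 1))
               \<and> (\<forall>j\<le>k. \<forall>s. 1 \<le> \<bar>s\<bar> \<longrightarrow>
                    norm (nth_vderiv j F s) \<le> C * M \<bar>s\<bar> ^ (j + 1)))
        \<longrightarrow> (\<forall>c>0. (\<lambda>t. norm (f t)) \<in>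
               O[at_top](\<lambda>t. inv_small (m_k m k) (c * t) + 1 / inv_large (M_k M k) (c * t))))
     \<and>
       (Cinf_on (- {0}) F \<and>
          (\<exists>C>0. (\<forall>j. \<forall>s. 0 < \<bar>s\<bar> \<and> \<bar>s\<bar> \<le> 1 \<longrightarrow>
                    norm (nth_vderiv j F s) \<le> C * fact j * \<bar>s\<bar> * m \<bar>s\<bar> ^ (j + 1))
               \<and> (\<forall>j. \<forall>s. 1 \<le> \<bar>s\<bar> \<longrightarrow>
                    norm (nth_vderiv j F s) \<le> C * fact j * M \<bar>s\<bar> ^ (j + 1)))
        \<longrightarrow> (\<forall>c. 0 < c \<and> c < 1/2 \<longrightarrow> (\<lambda>t. norm (f t)) \<in>
               O[at_top](\<lambda>t. inv_small (m_log m) (c * t) + 1 / inv_large (M_log M) (c * t) + 1 / t))))"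
proof -
  obtain X K where XK: "X > 0" "K > 0" and est:
    "\<And>A \<epsilon> b c R t. low_cutoff A \<epsilon> b c R \<Longrightarrow> t \<ge> X \<Longrightarrow>
       norm (f t) \<le> K * A * (\<epsilon> + 1 / R) + norm (integral UNIV (\<lambda>s. (of_real (high_profile \<epsilon> b c R \<bar>s\<bar>) * cis (t * s)) *\<^sub>C F s))"
  proof (rule smoothing_estimate[OF f_bdd f_cont f_lip f_int_bdd, of F], goal_cases)
    case 1
    from 1(2-4) show ?case by (rule F_bdry)
  next
    case (2 X K)
    from 2(2-4) show ?case by (rule 2(1))
  qed
  have zero: "(f \<longlongrightarrow> 0) at_top"
    by (rule Ingham_tendsto_zero[OF f_bdd f_cont f_lip f_int_bdd F_loc F_bdry])
  show ?thesis
  proof (intro conjI allI impI zero; (elim conjE exE)?)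
    fix m M :: "real \<Rightarrow> real" and k :: nat and c C :: real
    assume "continuous_on {0<..1} m" "\<forall>x y. 0 < x \<and> x \<le> y \<and> y \<le> 1 \<longrightarrow> m y \<le> m x" "\<forall>r\<in>{0<..1}. 1 \<le> m r"
      "continuous_on {1..} M" "\<forall>x y. 1 \<le> x \<and> x \<le> y \<longrightarrow> M x \<le> M y" "\<forall>R\<in>{1..}. 1 \<le> M R"
    then have gf: "growth_functions m M" by unfold_locales auto
    {
      assume c: "0 < c" and *: "1 \<le> k" "Ck_on k (- {0}) F" "0 < C"
        "\<forall>j\<le>k. \<forall>s. 0 < \<bar>s\<bar> \<and> \<bar>s\<bar> \<le> 1 \<longrightarrow> norm (nth_vderiv j F s) \<le> C * \<bar>s\<bar> ^ (k - j) * m \<bar>s\<bar> ^ (k + 1)"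
        "\<forall>j\<le>k. \<forall>s. 1 \<le> \<bar>s\<bar> \<longrightarrow> norm (nth_vderiv j F s) \<le> C * M \<bar>s\<bar> ^ (j + 1)"
      show "(\<lambda>t. norm (f t)) \<in> O[at_top](\<lambda>t. inv_small (m_k m k) (c * t) + 1 / inv_large (M_k M k) (c * t))"
        by (rule polynomial_decay_rate[OF gf est *(1-3) _ _ c]) (use * in auto)
    }
    {
      assume c: "0 < c" "c < 1 / 2" and *: "Cinf_on (- {0}) F" "0 < C"
        "\<forall>j s. 0 < \<bar>s\<bar> \<and> \<bar>s\<bar> \<le> 1 \<longrightarrow> norm (nth_vderiv j F s) \<le> C * fact j * \<bar>s\<bar> * m \<bar>s\<bar> ^ (j + 1)"
        "\<forall>j s. 1 \<le> \<bar>s\<bar> \<longrightarrow> norm (nth_vderiv j F s) \<le> C * fact j * M \<bar>s\<bar> ^ (j + 1)"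
      show "(\<lambda>t. norm (f t)) \<in> O[at_top](\<lambda>t. inv_small (m_log m) (c * t) + 1 / inv_large (M_log M) (c * t) + 1 / t)"
        by (rule exponential_decay_rate[OF gf XK(2) est *(1-2) _ _ c]) (use * in auto)
    }
  qed
qed

end
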